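(* Let $L/K$ be a finite Galois extension of local fields of characteristic $0$ with Galois group $G$, and let $\mathcal{F}$ be a formal group over $\mathcal{O}_K$. Suppose that $L/K$ is tamely ramified. Then the associated groups $F_L^n$ are cohomologically trivial $G$-modules for every integer $n\geq 1$.
   Context: A local field here is a non-archimedean local field (complete discretely valued field with finite residue field). For a local field $L$, let $\mathcal{O}_L$ be its ring of integers, $v_L$ its normalized valuation, and $\mathfrak{P}_L$ the maximal ideal of $\mathcal{O}_L$. A (commutative) formal group $\mathcal{F}$ over a commutative ring $R$ is given by a power series $F(X,Y)\in R[[X,Y]]$ with $F(X,Y)\equiv X+Y$ modulo terms of degree $\geq 2$, $F(X,F(Y,Z))=F(F(X,Y),Z)$ and $F(X,Y)=F(Y,X)$. For $\mathcal{F}$ over $\mathcal{O}_K$ and an integer $n\ge1$, $F_L^n=\mathcal{F}(\mathfrak{P}_L^n)$ denotes the group which as a set equals $\mathfrak{P}_L^n$, with group law $x+_{\mathcal{F}}y := F(x,y)$; since $F$ has coefficients in $\mathcal{O}_K$, $G=\mathrm{Gal}(L/K)$ acts on $F_L^n$ by group automorphisms. The extension $L/K$ is called tamely ramified if $G_1=1$, where $G_1:=\{\sigma\in G\mid v_L(\sigma(x)-x)\ge 2\ \forall x\in\mathcal{O}_L\}$; in particular unramified extensions are tamely ramified. For a $\mathbb{Z}[G]$-module $M$, $H^q(G,M)$ ($q\in\mathbb{Z}$) denotes Tate cohomology. $M$ is called cohomologically trivial if $H^q(U,M)=0$ for all $q\in\mathbb{Z}$ and all subgroups $U$ of $G$.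 *)

theory Defs
  imports "HOL-Algebra.Algebra" "HOL-Algebra.Algebraic_Closure_Type"
    "HOL-Computational_Algebra.Formal_Power_Series"
begin

section \<open>Local fields\<close>

text \<open>
  Fields are subsets \<open>K\<close> of an ambient type of class \<open>field\<close>. A discrete valuation is a function
  \<open>v :: 'a \<Rightarrow> int\<close> of which only the values on \<open>K - {0}\<close> matter; \<open>v 0 = \<infinity>\<close> is encoded by writing
  \<open>x = 0 \<or> v x \<ge> n\<close> for \<open>v x \<ge> n\<close>.
\<close>

definition valuation_ring :: "'a::field set \<Rightarrow> ('a \<Rightarrow> int) \<Rightarrow> 'a set" where
  "valuation_ring K v = {x \<in> K. x = 0 \<or> v x \<ge> 0}"

text \<open>The powers of the maximal ideal, which itself is the case \<open>n = 1\<close>.\<close>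

definition maximal_ideal_power :: "'a::field set \<Rightarrow> ('a \<Rightarrow> int) \<Rightarrow> nat \<Rightarrow> 'a set" where
  "maximal_ideal_power K v n = {x \<in> K. x = 0 \<or> v x \<ge> int n}"

definition v_tendsto :: "('a::field \<Rightarrow> int) \<Rightarrow> (nat \<Rightarrow> 'a) \<Rightarrow> 'a \<Rightarrow> bool" where
  "v_tendsto v s l \<longleftrightarrow> (\<forall>N. \<exists>m0. \<forall>m\<ge>m0. s m - l = 0 \<or> v (s m - l) \<ge> N)"

definition v_Cauchy :: "('a::field \<Rightarrow> int) \<Rightarrow> (nat \<Rightarrow> 'a) \<Rightarrow> bool" where
  "v_Cauchy v s \<longleftrightarrow> (\<forall>N. \<exists>m0. \<forall>m\<ge>m0. \<forall>k\<ge>m0. s m - s k = 0 \<or> v (s m - s k) \<ge> N)"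

locale discretely_valued_field =
  fixes K :: "'a::field set" and v :: "'a \<Rightarrow> int"
  assumes subfield: "subfield K ring_of_type_algebra"
    and v_mult: "\<lbrakk>x \<in> K; y \<in> K; x \<noteq> 0; y \<noteq> 0\<rbrakk> \<Longrightarrow> v (x * y) = v x + v y"
    and v_add: "\<lbrakk>x \<in> K; y \<in> K; x \<noteq> 0; y \<noteq> 0; x + y \<noteq> 0\<rbrakk> \<Longrightarrow> v (x + y) \<ge> min (v x) (v y)"
    and v_normalized: "\<exists>\<pi>\<in>K. \<pi> \<noteq> 0 \<and> v \<pi> = 1"

locale local_field = discretely_valued_field +
  assumes complete: "\<lbrakk>\<And>m. s m \<in> K; v_Cauchy v s\<rbrakk> \<Longrightarrow> \<exists>l\<in>K. v_tendsto v s l"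
    and finite_residue_field:
      "finite (carrier ((ring_of_type_algebra\<lparr>carrier := valuation_ring K v\<rparr>)
                          Quot (maximal_ideal_power K v 1)))"


section \<open>Galois extensions\<close>

text \<open>The top field of an extension is the whole type.\<close>

definition Gal :: "'a::field set \<Rightarrow> ('a \<Rightarrow> 'a) monoid" where
  "Gal K = \<lparr>carrier = {\<sigma> \<in> ring_iso ring_of_type_algebra ring_of_type_algebra. \<forall>x\<in>K. \<sigma> x = x},
            monoid.mult = (\<circ>), one = id\<rparr>"

definition finite_galois :: "'a::field set \<Rightarrow> bool" where
  "finite_galois K \<longleftrightarrow>
     ring.finite_dimension ring_of_type_algebra K (UNIV :: 'a set) \<and>
     {x. \<forall>\<sigma>\<in>carrier (Gal K). \<sigma> x = x} = K"

text \<open>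
  The valuation of the top field restricts to that of the base field up to normalization; \<open>e\<close> is
  the ramification index.
\<close>

locale finite_galois_extension_of_local_fields =
  base: local_field K vK + top: local_field "UNIV :: 'a::field_char_0 set" vL
  for K :: "'a::field_char_0 set" and vK vL :: "'a \<Rightarrow> int" +
  assumes valuation_extends: "\<exists>e>0. \<forall>x\<in>K. x \<noteq> 0 \<longrightarrow> vL x = e * vK x"
    and galois: "finite_galois K"

definition first_ramification_group :: "'a::field set \<Rightarrow> ('a \<Rightarrow> int) \<Rightarrow> ('a \<Rightarrow> 'a) set" where
  "first_ramification_group K vL =
     {\<sigma> \<in> carrier (Gal K). \<forall>x \<in> valuation_ring UNIV vL. \<sigma> x - x = 0 \<or> vL (\<sigma> x - x) \<ge> 2}"

definition tamely_ramified :: "'a::field set \<Rightarrow> ('a \<Rightarrow> int) \<Rightarrow> bool" where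
  "tamely_ramified K vL \<longleftrightarrow> first_ramification_group K vL = {\<one>\<^bsub>Gal K\<^esub>}"


section \<open>Formal groups\<close>

unbundle fps_syntax

text \<open>
  Power series in two variables are represented by \<open>'a fps fps\<close>, the coefficient of
  \<open>X^i * Y^j\<close> in \<open>F\<close> being \<open>F $ i $ j\<close>; similarly for three variables. In \<open>fps_subst2 F A B\<close> the
  series \<open>A\<close> and \<open>B\<close> must have zero constant term: then all monomials of \<open>A ^ i * B ^ j\<close> have total
  degree at least \<open>i + j\<close>, so that only finitely many terms contribute to a coefficient of
  \<open>F(A,B)\<close> and the sum below is exact.
\<close>

definition fps_subst2 ::
  "'a::comm_ring_1 fps fps \<Rightarrow> 'a fps fps fps \<Rightarrow> 'a fps fps fps \<Rightarrow> 'a fps fps fps" where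
  "fps_subst2 F A B =
     Abs_fps (\<lambda>a. Abs_fps (\<lambda>b. Abs_fps (\<lambda>c.
       \<Sum>i\<le>a + b + c. \<Sum>j\<le>a + b + c - i. F $ i $ j * (A ^ i * B ^ j) $ a $ b $ c)))"

definition formal_group_law :: "'a::comm_ring_1 set \<Rightarrow> 'a fps fps \<Rightarrow> bool" where
  "formal_group_law R F \<longleftrightarrow>
     (\<forall>i j. F $ i $ j \<in> R) \<and>
     F $ 0 $ 0 = 0 \<and> F $ 1 $ 0 = 1 \<and> F $ 0 $ 1 = 1 \<and>
     (let x = fps_X; y = fps_const fps_X; z = fps_const (fps_const fps_X)
      in fps_subst2 F x (fps_subst2 F y z) = fps_subst2 F (fps_subst2 F x y) z) \<and>
     (\<forall>i j. F $ i $ j = F $ j $ i)"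

definition fps_eval2 :: "('a::field \<Rightarrow> int) \<Rightarrow> 'a fps fps \<Rightarrow> 'a \<Rightarrow> 'a \<Rightarrow> 'a" where
  "fps_eval2 v F x y =
     (THE z. v_tendsto v (\<lambda>m. \<Sum>i\<le>m. \<Sum>j\<le>m - i. F $ i $ j * x ^ i * y ^ j) z)"

definition formal_group_points :: "'a::field fps fps \<Rightarrow> ('a \<Rightarrow> int) \<Rightarrow> nat \<Rightarrow> 'a monoid" where
  "formal_group_points F vL n =
     \<lparr>carrier = maximal_ideal_power UNIV vL n, monoid.mult = fps_eval2 vL F, one = 0\<rparr>"

text \<open>The restriction is needed since the library's group actions are by extensional maps.\<close>

definition galois_action :: "('a::field \<Rightarrow> int) \<Rightarrow> nat \<Rightarrow> ('a \<Rightarrow> 'a) \<Rightarrow> 'a \<Rightarrow> 'a" where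
  "galois_action vL n \<sigma> = restrict \<sigma> (maximal_ideal_power UNIV vL n)"


section \<open>Tate cohomology\<close>

text \<open>Modules over \<open>\<int>[G]\<close>, with the underlying abelian group written multiplicatively.\<close>

locale G_module =
  fixes G :: "('g, 'x) monoid_scheme" and M :: "('m, 'y) monoid_scheme" and \<phi> :: "'g \<Rightarrow> 'm \<Rightarrow> 'm"
  assumes group_G: "group G"
    and comm_group_M: "comm_group M"
    and action: "group_action G (carrier M) \<phi>"
    and action_hom: "g \<in> carrier G \<Longrightarrow> \<phi> g \<in> hom M M"

text \<open>
  For finite \<open>G\<close>, Tate cohomology is the cohomology of \<open>Hom\<^sub>G(X, M)\<close> where \<open>X\<close> is the complete standard
  resolution: \<open>X\<^sub>q = \<int>[G\<^sup>q\<^sup>+\<^sup>1]\<close> for \<open>q \<ge> 0\<close> with the usual homogeneous boundary maps, and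
  \<open>X\<^sub>-\<^sub>1\<^sub>-\<^sub>q = Hom(X\<^sub>q, \<int>)\<close>, the two halves being spliced by the norm. Using the dual basis of
  \<open>Hom(\<int>[G\<^sup>q\<^sup>+\<^sup>1], \<int>)\<close>, cochains in every degree are \<open>G\<close>-equivariant maps from tuples to \<open>M\<close>.
\<close>

definition tate_arity :: "int \<Rightarrow> nat" where
  "tate_arity q = (if q \<ge> 0 then nat q + 1 else nat (- q))"

definition tate_tuples :: "('g, 'x) monoid_scheme \<Rightarrow> int \<Rightarrow> 'g list set" where
  "tate_tuples G q = {gs. set gs \<subseteq> carrier G \<and> length gs = tate_arity q}"

definition tate_cochains ::
  "('g, 'x) monoid_scheme \<Rightarrow> ('m, 'y) monoid_scheme \<Rightarrow> ('g \<Rightarrow> 'm \<Rightarrow> 'm) \<Rightarrow> int \<Rightarrow> ('g list \<Rightarrow> 'm) monoid"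
where
  "tate_cochains G M \<phi> q =
     \<lparr>carrier = {f \<in> tate_tuples G q \<rightarrow>\<^sub>E carrier M.
                   \<forall>g\<in>carrier G. \<forall>gs\<in>tate_tuples G q. f (map (\<lambda>h. g \<otimes>\<^bsub>G\<^esub> h) gs) = \<phi> g (f gs)},
      monoid.mult = (\<lambda>f f'. \<lambda>gs\<in>tate_tuples G q. f gs \<otimes>\<^bsub>M\<^esub> f' gs),
      one = (\<lambda>gs\<in>tate_tuples G q. \<one>\<^bsub>M\<^esub>)\<rparr>"

text \<open>
  In additive notation, the coboundary from degree \<open>q\<close> to degree \<open>q + 1\<close> is
  \<open>\<Sum>\<^sub>i (-1)\<^sup>i f(\<dots>, g\<^sub>i omitted, \<dots>)\<close> for \<open>q \<ge> 0\<close>, the norm \<open>\<Sum>\<^sub>\<tau> f(\<tau>)\<close> for \<open>q = -1\<close>, and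
  \<open>\<Sum>\<^sub>\<tau> \<Sum>\<^sub>i (-1)\<^sup>i f(\<dots>, g\<^sub>i\<^sub>-\<^sub>1, \<tau>, g\<^sub>i, \<dots>)\<close> for \<open>q \<le> -2\<close>.
\<close>

definition tate_coboundary ::
  "('g, 'x) monoid_scheme \<Rightarrow> ('m, 'y) monoid_scheme \<Rightarrow> int \<Rightarrow> ('g list \<Rightarrow> 'm) \<Rightarrow> 'g list \<Rightarrow> 'm"
where
  "tate_coboundary G M q f = (\<lambda>gs\<in>tate_tuples G (q + 1).
     if q \<ge> 0 then
       finprod M (\<lambda>i. f (take i gs @ drop (Suc i) gs) [^]\<^bsub>M\<^esub> ((- 1) ^ i :: int)) {..<tate_arity (q + 1)}
     else if q = - 1 then
       finprod M (\<lambda>\<tau>. f [\<tau>]) (carrier G)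
     else
       finprod M (\<lambda>\<tau>. finprod M (\<lambda>i. f (take i gs @ \<tau> # drop i gs) [^]\<^bsub>M\<^esub> ((- 1) ^ i :: int))
                          {..<tate_arity q}) (carrier G))"

definition tate_cohomology ::
  "('g, 'x) monoid_scheme \<Rightarrow> ('m, 'y) monoid_scheme \<Rightarrow> ('g \<Rightarrow> 'm \<Rightarrow> 'm) \<Rightarrow> int \<Rightarrow> ('g list \<Rightarrow> 'm) set monoid"
where
  "tate_cohomology G M \<phi> q =
     (tate_cochains G M \<phi> q)
       \<lparr>carrier := kernel (tate_cochains G M \<phi> q) (tate_cochains G M \<phi> (q + 1)) (tate_coboundary G M q)\<rparr>
     Mod (tate_coboundary G M (q - 1) ` carrier (tate_cochains G M \<phi> (q - 1)))"

locale cohomologically_trivial_module = G_module +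
  assumes finite_G: "finite (carrier G)"
    and cohomology_trivial: "subgroup U G \<Longrightarrow> trivial_group (tate_cohomology (G\<lparr>carrier := U\<rparr>) M \<phi> q)"

end

theory Submission
  imports Defs
begin

text \<open>
  Write \<open>P N\<close> for the elements of \<open>L\<close> of valuation at least \<open>N\<close>. The theorem rests on two facts.

  Tameness gives, for every subgroup \<open>U\<close> of the Galois group, an element \<open>a\<close> of the valuation ring
  with \<open>\<Sum>\<sigma>\<in>U. \<sigma> a = 1\<close> (\<open>tame_trace_one\<close>). Modulo the maximal ideal the trace over \<open>U\<close> is \<open>card
  U\<^sub>0\<close> times a sum of distinct automorphisms of the residue field, where \<open>U\<^sub>0\<close> is the inertia
  subgroup. Such a sum does not vanish identically, by independence of characters, and \<open>card U\<^sub>0\<close>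
  is a unit: an element of \<open>U\<^sub>0\<close> whose order is the residue characteristic would lie in the first
  ramification group. Averaging with \<open>a\<close> makes the additive groups \<open>P N\<close> cohomologically trivial,
  by an explicit contracting homotopy of the complete standard complex (\<open>homotopy_identity\<close>) that
  maps cochains with values in \<open>P N\<close> to cochains with values in \<open>P N\<close>.

  The formal group law is \<open>F(x, y) = x + y + \<dots>\<close>, the further terms having degree at least 2. Hence
  for cochains with values in \<open>P N\<close>, \<open>N \<ge> 1\<close>, the coboundary of the formal group agrees with the
  additive one modulo \<open>P (N + 1)\<close> (\<open>coboundary_approx\<close>). So if \<open>f\<close> is a cocycle of the formal
  group with values in \<open>P N\<close>, subtracting the coboundary of its image under the homotopy leaves a
  cocycle with values in \<open>P (N + 1)\<close>. As \<open>L\<close> is complete the corrections add up to a cochain with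
  coboundary \<open>f\<close> (\<open>trivial_cohomology_by_approximation\<close>).

  It must also be known that the points form a \<open>G\<close>-module at all. That automorphisms respect the
  valuation is deduced from the field structure (\<open>v_invariant\<close>). The group laws for the points
  follow from the identities between power series by evaluating truncations modulo \<open>P N\<close> for all
  \<open>N\<close> (\<open>approx_hom_fps\<close>, \<open>fadd_assoc\<close>); the inverse comes from a contraction argument
  (\<open>near_identity_surj\<close>).
\<close>

section \<open>Complete discretely valued fields\<close>

locale complete_valued_field = local_field "UNIV :: 'a::field_char_0 set" v for v :: "'a::field_char_0 \<Rightarrow> int"
begin

definition P :: "int \<Rightarrow> 'a set" where "P N = {x. x = 0 \<or> v x \<ge> N}"

lemma v_mult': "x \<noteq> 0 \<Longrightarrow> y \<noteq> 0 \<Longrightarrow> v (x * y) = v x + v y"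
  by (rule v_mult) auto

lemma v_one: "v 1 = 0"
  using v_mult'[of 1 1] by simp

lemma v_minus: "v (- x) = v x"
proof (cases "x = 0")
  case False
  have "v (- 1) + v (- 1) = 0" using v_mult'[of "- 1" "- 1"] v_one by simp
  then show ?thesis using v_mult'[of "- 1" x] False by simp
qed simp

lemma v_inverse: "x \<noteq> 0 \<Longrightarrow> v (inverse x) = - v x"
  using v_mult'[of x "inverse x"] v_one by simp

lemma v_power: "x \<noteq> 0 \<Longrightarrow> v (x ^ k) = int k * v x"
  by (induction k) (auto simp: v_one v_mult' algebra_simps)

lemma P_zero [simp]: "0 \<in> P N" by (simp add: P_def)

lemma P_one [simp]: "1 \<in> P 0" by (simp add: P_def v_one)

lemma P_mono: "x \<in> P M \<Longrightarrow> N \<le> M \<Longrightarrow> x \<in> P N" by (auto simp: P_def)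

lemma P_add: "x \<in> P N \<Longrightarrow> y \<in> P N \<Longrightarrow> x + y \<in> P N"
  using v_add[of x y] by (cases "x = 0 \<or> y = 0 \<or> x + y = 0") (auto simp: P_def)

lemma P_minus: "x \<in> P N \<Longrightarrow> - x \<in> P N" by (auto simp: P_def v_minus)

lemma P_minus_iff [simp]: "- x \<in> P N \<longleftrightarrow> x \<in> P N" using P_minus[of x] P_minus[of "- x"] by auto

lemma P_diff: "x \<in> P N \<Longrightarrow> y \<in> P N \<Longrightarrow> x - y \<in> P N"
  using P_add[of x N "- y"] by simp

lemma P_diff_commute: "x - y \<in> P N \<Longrightarrow> y - x \<in> P N"
  using P_minus[of "x - y" N] by simp

lemma P_diff_trans: "x - y \<in> P N \<Longrightarrow> y - z \<in> P N \<Longrightarrow> x - z \<in> P N"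
  using P_add[of "x - y" N "y - z"] by simp

lemma P_mult: "x \<in> P M \<Longrightarrow> y \<in> P N \<Longrightarrow> x * y \<in> P (M + N)"
  by (cases "x = 0 \<or> y = 0") (auto simp: P_def v_mult')

lemma P_mult_le: "x \<in> P M \<Longrightarrow> y \<in> P N \<Longrightarrow> K \<le> M + N \<Longrightarrow> x * y \<in> P K"
  using P_mult P_mono by blast

lemma P_mult0: "x \<in> P 0 \<Longrightarrow> y \<in> P N \<Longrightarrow> x * y \<in> P N" "y \<in> P N \<Longrightarrow> x \<in> P 0 \<Longrightarrow> y * x \<in> P N"
  using P_mult[of x 0 y N] P_mult[of y N x 0] by simp_all

lemma P_sum: "(\<And>i. i \<in> I \<Longrightarrow> f i \<in> P N) \<Longrightarrow> sum f I \<in> P N"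
  by (induction I rule: infinite_finite_induct) (auto intro: P_add)

lemma P_power: "x \<in> P N \<Longrightarrow> x ^ k \<in> P (int k * N)"
  by (induction k) (auto simp: algebra_simps intro: P_mult_le)

lemma P_power0: "x \<in> P 0 \<Longrightarrow> x ^ k \<in> P 0"
  using P_power[of x 0 k] by simp

lemma P_power1: "x \<in> P 1 \<Longrightarrow> x ^ k \<in> P (int k)"
  using P_power[of x 1 k] by simp

lemma P_of_nat: "of_nat m \<in> P 0"
  by (induction m) (auto intro: P_add)

lemma P_numeral: "numeral k \<in> P 0"
  using P_of_nat[of "numeral k"] by simp

lemma P_Inter: "(\<And>k::nat. x \<in> P (N + int k)) \<Longrightarrow> x = 0"
proof (rule ccontr)
  assume x: "\<And>k::nat. x \<in> P (N + int k)" "x \<noteq> 0"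
  have "v x \<ge> N + int (nat (v x - N + 1))" using x(1)[of "nat (v x - N + 1)"] x(2) by (auto simp: P_def)
  then show False by linarith
qed

lemma P_Inter': "(\<And>N. N \<ge> N0 \<Longrightarrow> x \<in> P N) \<Longrightarrow> x = 0"
  by (rule P_Inter[of x N0]) auto

lemma P1_prime: "x \<in> P 0 \<Longrightarrow> y \<in> P 0 \<Longrightarrow> x * y \<in> P 1 \<Longrightarrow> x \<in> P 1 \<or> y \<in> P 1"
  by (cases "x = 0 \<or> y = 0") (auto simp: P_def v_mult')

lemma P1_power: "x \<in> P 0 \<Longrightarrow> x ^ k \<in> P 1 \<Longrightarrow> x \<in> P 1"
proof (induction k)
  case 0
  then show ?case by (simp add: P_def v_one)
next
  case (Suc k)
  then show ?case using P1_prime[of x "x ^ k"] P_power0 by auto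
qed

lemma unit_iff: "x \<in> P 0 \<and> x \<notin> P 1 \<longleftrightarrow> x \<noteq> 0 \<and> v x = 0"
  by (auto simp: P_def)

lemma P_divide_unit: "x \<in> P N \<Longrightarrow> u \<in> P 0 \<Longrightarrow> u \<notin> P 1 \<Longrightarrow> x / u \<in> P N"
  using unit_iff[of u] v_mult'[of x "inverse u"] v_inverse[of u] by (auto simp: P_def divide_inverse)

subsection \<open>Limits\<close>

lemma v_tendsto_iff: "v_tendsto v s l \<longleftrightarrow> (\<forall>N. \<exists>m0. \<forall>m\<ge>m0. s m - l \<in> P N)"
  by (simp add: v_tendsto_def P_def)

lemma increments:
  assumes "\<And>m. s (Suc m) - s m \<in> P (N + int m)" "m \<le> k"
  shows "s k - s m \<in> P (N + int m)"
  using assms(2)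
proof (induction k rule: dec_induct)
  case (step k)
  have "s (Suc k) - s k \<in> P (N + int m)"
    using assms(1)[of k] step.hyps by (auto intro: P_mono)
  then show ?case using step.IH by (rule P_diff_trans)
qed simp

lemma limit_exists:
  assumes "\<And>m. s (Suc m) - s m \<in> P (N + int m)"
  shows "\<exists>l. \<forall>m. s m - l \<in> P (N + int m)"
proof -
  have "v_Cauchy v s"
    unfolding v_Cauchy_def
  proof
    fix M
    have "s m - s k \<in> P M" if "m \<ge> nat (M - N)" "k \<ge> nat (M - N)" for m k
    proof -
      have "s m - s (nat (M - N)) \<in> P (N + int (nat (M - N)))" "s k - s (nat (M - N)) \<in> P (N + int (nat (M - N)))"
        by (rule increments[of s N, OF assms that(1)], rule increments[of s N, OF assms that(2)])
      then have "s m - s k \<in> P (N + int (nat (M - N)))" by (meson P_diff_commute P_diff_trans)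
      then show ?thesis by (rule P_mono) auto
    qed
    then show "\<exists>m0. \<forall>m\<ge>m0. \<forall>k\<ge>m0. s m - s k = 0 \<or> M \<le> v (s m - s k)"
      by (auto simp: P_def)
  qed
  then obtain l where l: "v_tendsto v s l" using complete[of s] by auto
  have "s m - l \<in> P (N + int m)" for m
  proof -
    obtain m0 where m0: "\<forall>k\<ge>m0. s k - l \<in> P (N + int m)" using l by (auto simp: v_tendsto_iff)
    then have "s (max m m0) - l \<in> P (N + int m)" by simp
    moreover have "s (max m m0) - s m \<in> P (N + int m)" using increments[of s N, OF assms] by simp
    ultimately show ?thesis by (meson P_diff_commute P_diff_trans)
  qed
  then show ?thesis by blast
qed

lemma v_tendstoI:
  assumes "\<And>m. s m - l \<in> P (int m + N)"
  shows "v_tendsto v s l"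
  unfolding v_tendsto_iff
proof
  fix M
  have "s m - l \<in> P M" if "m \<ge> nat (M - N)" for m
    by (rule P_mono[OF assms]) (use that in linarith)
  then show "\<exists>m0. \<forall>m\<ge>m0. s m - l \<in> P M" by blast
qed

lemma v_tendsto_unique:
  assumes "v_tendsto v s l" "v_tendsto v s l'"
  shows "l = l'"
proof -
  have "l - l' \<in> P N" for N
  proof -
    obtain m m' where "\<forall>k\<ge>m. s k - l \<in> P N" "\<forall>k\<ge>m'. s k - l' \<in> P N"
      using assms unfolding v_tendsto_iff by meson
    then have "s (max m m') - l \<in> P N" "s (max m m') - l' \<in> P N" by auto
    then show ?thesis by (meson P_diff_commute P_diff_trans)
  qed
  then show ?thesis using P_Inter'[of 0 "l - l'"] by simp
qed

text \<open>
  A self-map of \<open>P N\<close> that agrees with the identity to first order is onto: the iteration \<open>x \<mapsto> x +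
  (z - g x)\<close> converges to a solution of \<open>g x = z\<close>.
\<close>

lemma near_identity_surj:
  assumes g: "\<And>x. x \<in> P N \<Longrightarrow> g x \<in> P N"
    and near: "\<And>x y k. x \<in> P N \<Longrightarrow> y \<in> P N \<Longrightarrow> k \<ge> N \<Longrightarrow> x - y \<in> P k \<Longrightarrow> g x - g y - (x - y) \<in> P (k + 1)"
    and z: "z \<in> P N"
  shows "\<exists>x\<in>P N. g x = z"
proof -
  define s where "s = rec_nat 0 (\<lambda>_ x. x + (z - g x))"
  have s_Suc: "s (Suc k) = s k + (z - g (s k))" for k by (simp add: s_def)
  have s: "s k \<in> P N" for k
    by (induction k) (auto simp: s_Suc s_def intro!: P_add P_diff z g)
  have err: "z - g (s k) \<in> P (N + int k)" for k
  proof (induction k)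
    case 0
    then show ?case using z g[OF s[of 0]] by (auto intro: P_diff)
  next
    case (Suc k)
    have "g (s (Suc k)) - g (s k) - (s (Suc k) - s k) \<in> P (N + int k + 1)"
      by (rule near[OF s s]) (use Suc in \<open>simp_all add: s_Suc\<close>)
    then have "- (g (s (Suc k)) - g (s k) - (s (Suc k) - s k)) \<in> P (N + int (Suc k))" 
      by (simp only: P_minus_iff) (simp add: add.commute add.left_commute)
    then show ?case by (simp add: s_Suc algebra_simps)
  qed
  obtain x where x: "\<And>k. s k - x \<in> P (N + int k)"
    using limit_exists[of s N] err by (auto simp: s_Suc)
  have xN: "x \<in> P N" using x[of 0] P_diff[OF s[of 0], of "s 0 - x"] by simp
  have "z - g x \<in> P (N + int k)" for k
  proof -
    have "g (s k) - g x - (s k - x) \<in> P (N + int k)"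
      by (rule P_mono[OF near[OF s xN _ x]]) auto
    then have "(g (s k) - g x - (s k - x)) + (s k - x) + (z - g (s k)) \<in> P (N + int k)"
      using x err by (intro P_add)
    then show ?thesis by simp
  qed
  then have "z - g x = 0" by (rule P_Inter)
  then show ?thesis using xN by auto
qed

subsection \<open>Automorphisms preserve the valuation\<close>

lemma small_prime_unit: "2 \<notin> P 1 \<or> 3 \<notin> P 1"
proof (rule ccontr)
  assume "\<not> (2 \<notin> P 1 \<or> 3 \<notin> P 1)"
  then have "(3::'a) - 2 \<in> P 1" by (intro P_diff) auto
  then show False by (simp add: P_def v_one)
qed

lemma square_root_exists:
  assumes "2 \<notin> P 1" "x \<in> P 1"
  shows "\<exists>y\<in>P 1. (1 + y) ^ 2 = 1 + x"
proof -
  let ?g = "\<lambda>y::'a. y + y ^ 2 / 2"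
  have "x / 2 \<in> P 1" using P_divide_unit[OF assms(2) P_numeral assms(1)] .
  moreover have "?g y \<in> P 1" if "y \<in> P 1" for y
    using that P_divide_unit[OF _ P_numeral assms(1)] P_power1[of y 2] P_mono by (intro P_add) auto
  moreover have "?g a - ?g b - (a - b) \<in> P (k + 1)" if "a \<in> P 1" "b \<in> P 1" "a - b \<in> P k" for a b k
  proof -
    have "?g a - ?g b - (a - b) = (a - b) * ((a + b) / 2)"
      by (simp add: field_simps power2_eq_square)
    also have "\<dots> \<in> P (k + 1)"
      using that by (intro P_mult P_divide_unit[OF _ P_numeral assms(1)] P_add)
    finally show ?thesis .
  qed
  ultimately obtain y where y: "y \<in> P 1" "?g y = x / 2"
    using near_identity_surj[of 1 ?g "x / 2"] by blast
  have "x = 2 * ?g y" unfolding y(2) by simp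
  then have "(1 + y) ^ 2 = 1 + x" by (simp add: algebra_simps power2_eq_square)
  then show ?thesis using y(1) by blast
qed

lemma cube_root_exists:
  assumes "3 \<notin> P 1" "x \<in> P 1"
  shows "\<exists>y\<in>P 1. (1 + y) ^ 3 = 1 + x"
proof -
  let ?g = "\<lambda>y::'a. y + y ^ 2 + y ^ 3 / 3"
  have "x / 3 \<in> P 1" using P_divide_unit[OF assms(2) P_numeral assms(1)] .
  moreover have "?g y \<in> P 1" if "y \<in> P 1" for y
    using that P_divide_unit[OF _ P_numeral assms(1)] P_mono[OF P_power1[of y 2]] P_mono[OF P_power1[of y 3]]
    by (intro P_add) auto
  moreover have "?g a - ?g b - (a - b) \<in> P (k + 1)" if "a \<in> P 1" "b \<in> P 1" "a - b \<in> P k" for a b k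
  proof -
    have "?g a - ?g b - (a - b) = (a - b) * ((a + b) + (a * a + a * b + b * b) / 3)"
      by (simp add: field_simps power2_eq_square power3_eq_cube)
    also have "\<dots> \<in> P (k + 1)"
      using that by (intro P_mult[of _ k _ 1] P_divide_unit[OF _ P_numeral assms(1)] P_add P_mult_le[of _ 1 _ 1 1]) auto
    finally show ?thesis .
  qed
  ultimately obtain y where y: "y \<in> P 1" "?g y = x / 3"
    using near_identity_surj[of 1 ?g "x / 3"] by blast
  have "x = 3 * ?g y" unfolding y(2) by simp
  then have "(1 + y) ^ 3 = 1 + x" by (simp add: algebra_simps power2_eq_square power3_eq_cube)
  then show ?thesis using y(1) by blast
qed

text \<open>
  A prime \<open>l\<close> that is a unit in the valuation ring, such as 2 or 3, is all that Newton's iteration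
  for the equation \<open>(1 + y) ^ l = 1 + x\<close> requires.
\<close>

lemma iterated_roots:
  obtains l :: nat where "l > 1" "\<And>x k. x \<in> P 1 \<Longrightarrow> \<exists>y\<in>P 1. (1 + y) ^ (l ^ k) = 1 + x"
proof -
  obtain l :: nat where l: "l > 1" "\<And>x. x \<in> P 1 \<Longrightarrow> \<exists>y\<in>P 1. (1 + y) ^ l = 1 + x"
  proof (cases "2 \<in> P 1")
    case True
    then show ?thesis using that[of 3] cube_root_exists small_prime_unit by auto
  next
    case False
    then show ?thesis using that[of 2] square_root_exists by auto
  qed
  have "\<exists>y\<in>P 1. (1 + y) ^ (l ^ k) = 1 + x" if "x \<in> P 1" for x k
    using that
  proof (induction k arbitrary: x)
    case (Suc k)
    then obtain z where z: "z \<in> P 1" "(1 + z) ^ (l ^ k) = 1 + x" by blast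
    obtain y where "y \<in> P 1" "(1 + y) ^ l = 1 + z" using l(2) z(1) by blast
    then show ?case using z(2) by (intro bexI[of _ y]) (simp_all add: power_mult)
  qed auto
  then show ?thesis using that l(1) by blast
qed

end

locale valued_field_automorphism = complete_valued_field +
  fixes \<sigma> :: "'a \<Rightarrow> 'a"
  assumes hom_add: "\<sigma> (x + y) = \<sigma> x + \<sigma> y" and hom_mult: "\<sigma> (x * y) = \<sigma> x * \<sigma> y"
    and bij: "bij \<sigma>"
begin

lemma hom_0 [simp]: "\<sigma> 0 = 0" using hom_add[of 0 0] by simp

lemma hom_eq_0 [simp]: "\<sigma> x = 0 \<longleftrightarrow> x = 0" using bij hom_0 by (metis bij_pointE)

lemma hom_1 [simp]: "\<sigma> 1 = 1" using hom_mult[of 1 1] by simp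

lemma hom_minus: "\<sigma> (- x) = - \<sigma> x" using hom_add[of x "- x"] by (simp add: add_eq_0_iff2)

lemma hom_diff: "\<sigma> (x - y) = \<sigma> x - \<sigma> y" using hom_add[of x "- y"] hom_minus by simp

lemma hom_power: "\<sigma> (x ^ k) = \<sigma> x ^ k" by (induction k) (auto simp: hom_mult)

lemma hom_sum: "\<sigma> (sum f I) = (\<Sum>i\<in>I. \<sigma> (f i))"
  by (induction I rule: infinite_finite_induct) (auto simp: hom_add)

lemma hom_divide: "\<sigma> (x / y) = \<sigma> x / \<sigma> y"
proof (cases "y = 0")
  case False
  then show ?thesis using hom_mult[of "x / y" y] by (simp add: field_simps)
qed simp

text \<open>
  If \<open>x\<close> lies in the maximal ideal then \<open>1 + x\<close> is an \<open>l\<^sup>k\<close>-th power for all \<open>k\<close>, hence so is its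
  image, whose valuation is therefore divisible by all \<open>l\<^sup>k\<close>. This property refers to the field
  structure alone, which is why every automorphism respects the valuation.
\<close>

lemma maximal_ideal_to_ring:
  assumes "x \<in> P 1"
  shows "\<sigma> x \<in> P 0"
proof -
  obtain l :: nat where l: "l > 1" "\<And>x k. x \<in> P 1 \<Longrightarrow> \<exists>y\<in>P 1. (1 + y) ^ (l ^ k) = 1 + x"
    using iterated_roots by blast
  have "1 + \<sigma> x \<in> P 0"
  proof (rule ccontr)
    assume "1 + \<sigma> x \<notin> P 0"
    then have w: "1 + \<sigma> x \<noteq> 0" "v (1 + \<sigma> x) < 0" by (auto simp: P_def)
    have dvd: "int (l ^ k) dvd v (1 + \<sigma> x)" for k
    proof -
      obtain y where y: "(1 + y) ^ (l ^ k) = 1 + x" using l(2) assms by blast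
      then have "\<sigma> (1 + y) ^ (l ^ k) = 1 + \<sigma> x" by (metis hom_power hom_add hom_1)
      moreover have "(0::'a) ^ (l ^ k) = 0" using l(1) by (simp add: power_0_left)
      ultimately show ?thesis using w(1) v_power[of "\<sigma> (1 + y)" "l ^ k"] by fastforce
    qed
    define k where "k = nat (- v (1 + \<sigma> x))"
    have "int k < int (l ^ k)" using l(1) by (simp only: of_nat_less_iff power_gt_expt)
    moreover have "int (l ^ k) \<le> int k"
      using dvd[of k] w(2) zdvd_imp_le[of "int (l ^ k)" "- v (1 + \<sigma> x)"] by (simp add: k_def)
    ultimately show False by simp
  qed
  then show ?thesis using P_diff[of "1 + \<sigma> x" 0 1] by simp
qed

lemma ring_to_ring:
  assumes x: "x \<in> P 0"
  shows "\<sigma> x \<in> P 0"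
proof (rule ccontr)
  assume "\<sigma> x \<notin> P 0"
  then have w: "\<sigma> x \<noteq> 0" "v (\<sigma> x) < 0" by (auto simp: P_def)
  obtain \<pi> where \<pi>: "\<pi> \<noteq> 0" "v \<pi> = 1" using v_normalized by auto
  have "\<pi> * x ^ k \<in> P 1" for k
    using P_mult[of \<pi> 1 "x ^ k" 0] \<pi> P_power0[OF x] by (simp add: P_def)
  then have "\<sigma> (\<pi> * x ^ k) \<in> P 0" for k by (rule maximal_ideal_to_ring)
  then have "v (\<sigma> \<pi>) + int k * v (\<sigma> x) \<ge> 0" for k
    using w(1) \<pi>(1) v_mult'[of "\<sigma> \<pi>" "\<sigma> x ^ k"] v_power[of "\<sigma> x" k]
    unfolding P_def hom_mult hom_power by (metis (mono_tags, lifting) hom_eq_0 mem_Collect_eq mult_eq_0_iff power_not_zero)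
  note bound = this
  define k where "k = nat (v (\<sigma> \<pi>)) + 1"
  have "int k * 1 \<le> int k * (- v (\<sigma> x))" using w(2) by (intro mult_left_mono) auto
  then have "int k \<le> v (\<sigma> \<pi>)" using bound[of k] by simp
  then show False by (simp add: k_def split: if_splits)
qed

end

context valued_field_automorphism
begin

lemma inverse_automorphism: "valued_field_automorphism v (inv_into UNIV \<sigma>)"
proof unfold_locales
  show "inv_into UNIV \<sigma> (x + y) = inv_into UNIV \<sigma> x + inv_into UNIV \<sigma> y" for x y
    using bij by (metis bij_inv_eq_iff hom_add)
  show "inv_into UNIV \<sigma> (x * y) = inv_into UNIV \<sigma> x * inv_into UNIV \<sigma> y" for x y
    using bij by (metis bij_inv_eq_iff hom_mult)
  show "bij (inv_into UNIV \<sigma>)" using bij by (rule bij_imp_bij_inv)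
qed

text \<open>
  Since \<open>\<sigma>\<close> and its inverse map integers to integers, \<open>\<sigma>\<close> preserves units. Hence \<open>v \<circ> \<sigma>\<close> is a
  multiple of \<open>v\<close>, the factor being \<open>v (\<sigma> \<pi>)\<close>; this factor is positive and divides 1.
\<close>

lemma v_invariant: "x \<noteq> 0 \<Longrightarrow> v (\<sigma> x) = v x"
proof -
  assume x: "x \<noteq> 0"
  interpret inv: valued_field_automorphism v "inv_into UNIV \<sigma>" by (rule inverse_automorphism)
  have ring: "\<sigma> y \<in> P 0 \<longleftrightarrow> y \<in> P 0" for y
    using ring_to_ring[of y] inv.ring_to_ring[of "\<sigma> y"] bij by (metis bij_inv_eq_iff)
  have unit: "v (\<sigma> u) = 0" if "u \<noteq> 0" "v u = 0" for u
  proof -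
    have "u \<in> P 0" "inverse u \<in> P 0" using that by (auto simp: P_def v_inverse)
    then have "\<sigma> u \<in> P 0" "\<sigma> (inverse u) \<in> P 0" using ring by auto
    moreover have "\<sigma> u * \<sigma> (inverse u) = 1" using that by (metis hom_mult hom_1 right_inverse)
    then have "v (\<sigma> u) + v (\<sigma> (inverse u)) = 0"
      using v_mult'[of "\<sigma> u" "\<sigma> (inverse u)"] v_one that by simp
    ultimately show ?thesis using that by (auto simp: P_def)
  qed
  obtain \<pi> where \<pi>: "\<pi> \<noteq> 0" "v \<pi> = 1" using v_normalized by auto
  have pos: "v (\<sigma> \<pi>) > 0"
  proof (rule ccontr)
    assume "\<not> v (\<sigma> \<pi>) > 0"
    then have "inverse (\<sigma> \<pi>) \<in> P 0" using \<pi> by (simp add: P_def v_inverse)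
    moreover have "\<sigma> (inverse \<pi>) = inverse (\<sigma> \<pi>)"
      using \<pi> hom_mult[of \<pi> "inverse \<pi>"] by (simp add: inverse_unique)
    ultimately have "inverse \<pi> \<in> P 0" using ring by metis
    then show False using \<pi> by (simp add: P_def v_inverse)
  qed
  have rep: "\<exists>u. u \<noteq> 0 \<and> v u = 0 \<and> y = u * \<pi> powi (v y)" if "y \<noteq> 0" for y
  proof -
    have "v (\<pi> powi k) = k" for k
      using \<pi> by (simp add: power_int_def v_power v_inverse)
    then show ?thesis
      using that \<pi> v_mult'[of y "inverse (\<pi> powi (v y))"] v_inverse[of "\<pi> powi v y"]
      by (intro exI[of _ "y / \<pi> powi (v y)"]) (auto simp: divide_inverse)
  qed
  have hom_powi: "\<sigma> (y powi k) = \<sigma> y powi k" if "y \<noteq> 0" for y k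
  proof -
    have "\<sigma> (inverse y) = inverse (\<sigma> y)"
      using that hom_mult[of y "inverse y"] by (simp add: inverse_unique)
    then show ?thesis by (simp add: power_int_def hom_power)
  qed
  have v_powi: "v (y powi k) = k * v y" if "y \<noteq> 0" for y k
    using that by (simp add: power_int_def v_power v_inverse)
  have scale: "v (\<sigma> y) = v y * v (\<sigma> \<pi>)" if "y \<noteq> 0" for y
  proof -
    obtain u where u: "u \<noteq> 0" "v u = 0" "y = u * \<pi> powi (v y)" using rep[OF \<open>y \<noteq> 0\<close>] by blast
    then have "\<sigma> y = \<sigma> u * \<sigma> \<pi> powi (v y)" by (metis hom_mult hom_powi \<pi>(1))
    then show ?thesis using u(1) \<pi>(1) unit[OF u(1,2)] v_mult'[of "\<sigma> u" "\<sigma> \<pi> powi (v y)"] v_powi[of "\<sigma> \<pi>"] by simp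
  qed
  have "1 = v (inv_into UNIV \<sigma> \<pi>) * v (\<sigma> \<pi>)"
    using scale[of "inv_into UNIV \<sigma> \<pi>"] \<pi> bij by (metis bij_inv_eq_iff hom_eq_0)
  then have "v (\<sigma> \<pi>) = 1" using pos by (metis dvd_triv_right zdvd1_eq abs_of_pos)
  then show ?thesis using scale[OF x] by simp
qed

lemma P_invariant: "\<sigma> x \<in> P N \<longleftrightarrow> x \<in> P N"
  using v_invariant[of x] by (cases "x = 0") (auto simp: P_def)

end

section \<open>The points of a formal group\<close>

lemma sum_triangle: "(\<Sum>i\<le>m. \<Sum>j\<le>m - i. g i j) = (\<Sum>(i, j)\<in>{(i, j). i + j \<le> m}. g i j)" for m :: nat
proof -
  have "{(i, j). i + j \<le> m} = (SIGMA i:{..m}. {..m - i})" by auto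
  then show ?thesis by (simp add: sum.Sigma)
qed

lemma finite_triangle: "finite {(i, j). i + j \<le> (m::nat)}"
  by (rule finite_subset[of _ "{..m} \<times> {..m}"]) auto

text \<open>Series in three variables without monomials of total degree less than \<open>k\<close>.\<close>

definition order_ge :: "nat \<Rightarrow> 'a::comm_ring_1 fps fps fps \<Rightarrow> bool" where
  "order_ge k A \<longleftrightarrow> (\<forall>a b c. a + b + c < k \<longrightarrow> A $ a $ b $ c = 0)"

lemma order_ge_mult:
  assumes "order_ge k A" "order_ge l B"
  shows "order_ge (k + l) (A * B)"
  unfolding order_ge_def
proof (intro allI impI)
  fix a b c assume abc: "a + b + c < k + l"
  have "A $ i $ j $ h * B $ (a - i) $ (b - j) $ (c - h) = 0" if "i \<le> a" "j \<le> b" "h \<le> c" for i j h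
  proof (cases "i + j + h < k")
    case True
    then show ?thesis using assms(1) by (simp add: order_ge_def)
  next
    case False
    then have "(a - i) + (b - j) + (c - h) < l" using abc that by linarith
    then show ?thesis using assms(2) by (simp add: order_ge_def)
  qed
  then show "(A * B) $ a $ b $ c = 0"
    by (simp add: fps_mult_nth fps_sum_nth)
qed

lemma order_ge_power:
  assumes "order_ge 1 A"
  shows "order_ge i (A ^ i)"
proof (induction i)
  case 0
  then show ?case by (simp add: order_ge_def)
next
  case (Suc i)
  then show ?case using order_ge_mult[OF assms Suc] by simp
qed

lemma order_ge_subst2:
  assumes "F $ 0 $ 0 = 0"
  shows "order_ge 1 (fps_subst2 F A B)"
  using assms by (simp add: order_ge_def fps_subst2_def)

text \<open>
  The range of summation can be enlarged at will, because \<open>A ^ i * B ^ j\<close> has no monomials of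
  degree less than \<open>i + j\<close>. With a range that is the same for all coefficients, substitution
  becomes a finite sum of series.
\<close>

lemma fps_subst2_nth:
  assumes "order_ge 1 A" "order_ge 1 B" "a + b + c \<le> m"
  shows "fps_subst2 F A B $ a $ b $ c = (\<Sum>(i, j)\<in>{(i, j). i + j \<le> m}. F $ i $ j * (A ^ i * B ^ j) $ a $ b $ c)"
proof -
  have "order_ge (i + j) (A ^ i * B ^ j)" for i j
    using order_ge_mult order_ge_power assms(1,2) by blast
  then have vanish: "F $ i $ j * (A ^ i * B ^ j) $ a $ b $ c = 0" if "\<not> i + j \<le> a + b + c" for i j
    using that by (simp add: order_ge_def)
  have "(\<Sum>(i, j)\<in>{(i, j). i + j \<le> a + b + c}. F $ i $ j * (A ^ i * B ^ j) $ a $ b $ c)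
    = (\<Sum>(i, j)\<in>{(i, j). i + j \<le> m}. F $ i $ j * (A ^ i * B ^ j) $ a $ b $ c)"
    by (rule sum.mono_neutral_left) (use assms(3) finite_triangle[of m] vanish in \<open>auto split: prod.split\<close>)
  then show ?thesis by (simp add: fps_subst2_def sum_triangle)
qed

context complete_valued_field
begin

text \<open>
  A ring homomorphism up to an error in \<open>P N\<close>, on a subring \<open>S\<close> that plays the role of the
  integral elements.
\<close>

definition approx_hom :: "nat \<Rightarrow> 'r::comm_ring_1 set \<Rightarrow> ('r \<Rightarrow> 'a) \<Rightarrow> bool" where
  "approx_hom N S h \<longleftrightarrow>
     0 \<in> S \<and> 1 \<in> S \<and> (\<forall>a\<in>S. \<forall>b\<in>S. a + b \<in> S \<and> a * b \<in> S \<and> h (a * b) - h a * h b \<in> P (int N)) \<and>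
     (\<forall>a b. h (a + b) = h a + h b) \<and> h 1 = 1 \<and> (\<forall>a\<in>S. h a \<in> P 0)"

lemma approx_hom_zero: "approx_hom N S h \<Longrightarrow> h 0 = 0"
  unfolding approx_hom_def by (metis add_cancel_right_right)

lemma approx_hom_sum:
  assumes "approx_hom N S h"
  shows "h (sum f I) = (\<Sum>i\<in>I. h (f i))" "(\<And>i. i \<in> I \<Longrightarrow> f i \<in> S) \<Longrightarrow> sum f I \<in> S"
  using approx_hom_zero[OF assms] assms 
  by (induction I rule: infinite_finite_induct) (auto simp: approx_hom_def)

lemma approx_hom_mult_cong:
  assumes "approx_hom N S h" "a \<in> S" "b \<in> S" "h a - x \<in> P (int N)" "h b - y \<in> P (int N)" "x \<in> P 0"
  shows "h (a * b) - x * y \<in> P (int N)"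
proof -
  have h: "h (a * b) - h a * h b \<in> P (int N)" "h b \<in> P 0" using assms(1-3) by (auto simp: approx_hom_def)
  have "h (a * b) - x * y = (h (a * b) - h a * h b) + ((h a - x) * h b + x * (h b - y))"
    by (simp add: algebra_simps)
  also have "\<dots> \<in> P (int N)"
    using h assms(4-6) by (intro P_add P_mult0)
  finally show ?thesis .
qed

lemma approx_hom_power:
  assumes "approx_hom N S h" "a \<in> S"
  shows "a ^ i \<in> S" "h (a ^ i) - h a ^ i \<in> P (int N)"
proof -
  have S: "a ^ i \<in> S" for i
    using assms by (induction i) (auto simp: approx_hom_def)
  show "a ^ i \<in> S" by (rule S)
  show "h (a ^ i) - h a ^ i \<in> P (int N)"
  proof (induction i)
    case 0
    then show ?case using assms by (simp add: approx_hom_def)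
  next
    case (Suc i)
    have "h a \<in> P 0" using assms by (simp add: approx_hom_def)
    then show ?case using approx_hom_mult_cong[OF assms(1,2) S _ Suc, of "h a"] by simp
  qed
qed

text \<open>
  Evaluating one variable of a power series at a point of the maximal ideal, by summing the first
  \<open>N\<close> terms, is multiplicative modulo \<open>P N\<close>: the terms that the truncation loses contain a power
  \<open>x\<^sup>N\<close>.
\<close>

lemma approx_hom_fps:
  assumes h: "approx_hom N S h" and N: "N > 0" and x: "x \<in> P 1"
  shows "approx_hom N {f. \<forall>i. f $ i \<in> S} (\<lambda>f. \<Sum>i<N. h (f $ i) * x ^ i)"
proof -
  let ?e = "\<lambda>f. \<Sum>i<N. h (f $ i) * x ^ i"
  have S: "0 \<in> S" "1 \<in> S" "\<And>a b. a \<in> S \<Longrightarrow> b \<in> S \<Longrightarrow> a + b \<in> S" "\<And>a b. a \<in> S \<Longrightarrow> b \<in> S \<Longrightarrow> a * b \<in> S"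
    and add: "\<And>a b. h (a + b) = h a + h b" and h1: "h 1 = 1" and h0: "\<And>a. a \<in> S \<Longrightarrow> h a \<in> P 0"
    and mult: "\<And>a b. a \<in> S \<Longrightarrow> b \<in> S \<Longrightarrow> h (a * b) - h a * h b \<in> P (int N)"
    using h by (auto simp: approx_hom_def)
  have xi: "x ^ i \<in> P (int i)" for i by (rule P_power1[OF x])
  have xi0: "x ^ i \<in> P 0" for i by (rule P_mono[OF xi]) simp
  have "?e 1 = (\<Sum>i<N. if i = 0 then 1 else 0)"
    by (intro sum.cong) (auto simp: h1 approx_hom_zero[OF h])
  then have e1: "?e 1 = 1" using N by simp
  have emult: "?e (f * g) - ?e f * ?e g \<in> P (int N)" if f: "\<forall>i. f $ i \<in> S" and g: "\<forall>i. g $ i \<in> S" for f g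
  proof -
    let ?t = "\<lambda>i j. h (f $ i) * h (g $ j) * x ^ (i + j)"
    have "?e f * ?e g = (\<Sum>(i, j)\<in>{..<N} \<times> {..<N}. ?t i j)"
      by (simp add: sum_product sum.cartesian_product power_add mult_ac)
    also have "\<dots> = (\<Sum>(i, j)\<in>{(i, j). i + j < N}. ?t i j) + (\<Sum>(i, j)\<in>{..<N} \<times> {..<N} - {(i, j). i + j < N}. ?t i j)"
      by (subst sum.subset_diff[of "{(i, j). i + j < N}"]) (auto simp: add.commute)
    also have "(\<Sum>(i, j)\<in>{(i, j). i + j < N}. ?t i j) = (\<Sum>k<N. \<Sum>i\<le>k. ?t i (k - i))"
      by (rule sum.triangle_reindex)
    finally have "?e (f * g) - ?e f * ?e g = (\<Sum>k<N. h ((f * g) $ k) * x ^ k - (\<Sum>i\<le>k. ?t i (k - i)))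
        - (\<Sum>(i, j)\<in>{..<N} \<times> {..<N} - {(i, j). i + j < N}. ?t i j)"
      by (simp add: sum_subtractf)
    also have "\<dots> \<in> P (int N)"
    proof (rule P_diff[OF P_sum P_sum])
      fix k
      have "h ((f * g) $ k) * x ^ k - (\<Sum>i\<le>k. ?t i (k - i))
          = (\<Sum>i\<le>k. (h (f $ i * g $ (k - i)) - h (f $ i) * h (g $ (k - i))) * x ^ k)"
        by (simp add: fps_mult_nth approx_hom_sum(1)[OF h] sum_distrib_right left_diff_distrib 
            sum_subtractf atLeast0AtMost)
      also have "\<dots> \<in> P (int N)"
        using mult f g xi0 by (intro P_sum P_mult0(2)) auto
      finally show "h ((f * g) $ k) * x ^ k - (\<Sum>i\<le>k. ?t i (k - i)) \<in> P (int N)" .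
    next
      fix p assume "p \<in> {..<N} \<times> {..<N} - {(i, j). i + j < N}"
      then obtain i j where p: "p = (i, j)" "N \<le> i + j" by (cases p) auto
      have "h (f $ i) * h (g $ j) \<in> P 0" using h0 f g by (intro P_mult0(1)) auto
      then have "h (f $ i) * h (g $ j) * x ^ (i + j) \<in> P (int (i + j))"
        using xi by (rule P_mult0(1))
      then show "(case p of (i, j) \<Rightarrow> ?t i j) \<in> P (int N)"
        using p by (auto intro: P_mono)
    qed
    finally show ?thesis .
  qed
  have Smult: "(f * g) $ k \<in> S" if "\<forall>i. f $ i \<in> S" "\<forall>i. g $ i \<in> S" for f g k
    unfolding fps_mult_nth by (rule approx_hom_sum(2)[OF h]) (use that S in auto)
  have Sone: "(1::'b fps) $ k \<in> S" for k using S by (cases k) auto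
  have e0: "?e f \<in> P 0" if "\<forall>i. f $ i \<in> S" for f
    using that h0 xi0 by (intro P_sum P_mult0(1)) auto
  have eadd: "?e (f + g) = ?e f + ?e g" for f g
    by (simp add: add sum.distrib distrib_right)
  show ?thesis
    unfolding approx_hom_def using S e1 emult Smult Sone e0 eadd by auto
qed

end

locale formal_group_over_ring = complete_valued_field +
  fixes F :: "'a fps fps"
  assumes law: "formal_group_law (P 0) F"
begin

lemma coeff: "F $ i $ j \<in> P 0" and coeff_00: "F $ 0 $ 0 = 0" and coeff_10: "F $ Suc 0 $ 0 = 1"
  and coeff_sym: "F $ i $ j = F $ j $ i"
  using law by (auto simp: formal_group_law_def Let_def)

definition partial_sum :: "nat \<Rightarrow> 'a \<Rightarrow> 'a \<Rightarrow> 'a" where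
  "partial_sum m x y = (\<Sum>(i, j)\<in>{(i, j). i + j \<le> m}. F $ i $ j * x ^ i * y ^ j)"

abbreviation fadd :: "'a \<Rightarrow> 'a \<Rightarrow> 'a" where "fadd \<equiv> fps_eval2 v F"

lemma term_bound:
  assumes "x \<in> P 1" "y \<in> P 1"
  shows "F $ i $ j * x ^ i * y ^ j \<in> P (int (i + j))"
proof -
  have "x ^ i * y ^ j \<in> P (int i + int j)"
    using P_power1 assms by (intro P_mult)
  then have "F $ i $ j * (x ^ i * y ^ j) \<in> P (int i + int j)"
    by (rule P_mult0(1)[OF coeff])
  then show ?thesis by (simp add: mult.assoc)
qed

lemma partial_sum_step:
  assumes "x \<in> P 1" "y \<in> P 1"
  shows "partial_sum (Suc m) x y - partial_sum m x y \<in> P (int m + 1)"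
proof -
  let ?t = "\<lambda>(i, j). F $ i $ j * x ^ i * y ^ j"
  have "partial_sum (Suc m) x y - partial_sum m x y = sum ?t ({(i, j). i + j \<le> Suc m} - {(i, j). i + j \<le> m})"
    unfolding partial_sum_def by (rule sum_diff[symmetric]) (use finite_triangle[of "Suc m"] in auto)
  also have "\<dots> \<in> P (int m + 1)"
  proof (rule P_sum)
    fix p assume "p \<in> {(i, j). i + j \<le> Suc m} - {(i, j). i + j \<le> m}"
    then show "?t p \<in> P (int m + 1)"
      by (auto intro!: P_mono[OF term_bound[OF assms]])
  qed
  finally show ?thesis .
qed

lemma partial_sum_approx:
  assumes "x \<in> P 1" "y \<in> P 1"
  shows "partial_sum m x y - fadd x y \<in> P (int m + 1)"
proof -
  obtain l where l: "\<And>m. partial_sum m x y - l \<in> P (1 + int m)"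
    using limit_exists[of "\<lambda>m. partial_sum m x y" 1] partial_sum_step[OF assms] by (auto simp: add.commute)
  have "v_tendsto v (\<lambda>m. partial_sum m x y) l"
    by (rule v_tendstoI[of _ _ 1]) (use l in \<open>simp add: add.commute\<close>)
  then have "fadd x y = l"
    unfolding fps_eval2_def partial_sum_def sum_triangle
    by (intro the_equality) (auto intro: v_tendsto_unique)
  then show ?thesis using l by (simp add: add.commute)
qed

lemma fadd_commute:
  assumes "x \<in> P 1" "y \<in> P 1"
  shows "fadd x y = fadd y x"
proof -
  have "partial_sum m x y = (\<Sum>(i, j)\<in>{(i, j). i + j \<le> m}. F $ j $ i * x ^ i * y ^ j)" for m
    unfolding partial_sum_def by (intro sum.cong refl) (simp add: case_prod_unfold coeff_sym)
  also have "\<dots> m = partial_sum m y x" for m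
    unfolding partial_sum_def
    by (rule sum.reindex_bij_witness[of _ prod.swap prod.swap]) (auto simp: mult_ac)
  finally have "partial_sum m x y = partial_sum m y x" for m .
  then have "fadd x y - fadd y x \<in> P (1 + int m)" for m
    using partial_sum_approx[of x y m] partial_sum_approx[of y x m] assms
    by (metis P_diff_commute P_diff_trans add.commute)
  then show ?thesis using P_Inter[of "fadd x y - fadd y x" 1] by simp
qed

text \<open>
  To first order the formal sum is the sum: in a term of degree at least 2 the difference \<open>x ^ i -
  x' ^ i\<close> contributes the factor \<open>x - x'\<close>, and a further factor from the maximal ideal remains.
\<close>

lemma partial_sum_near:
  assumes x: "x \<in> P 1" "x' \<in> P 1" and y: "y \<in> P 1" and d: "x - x' \<in> P k" and m: "m \<ge> 1"
  shows "partial_sum m x y - partial_sum m x' y - (x - x') \<in> P (k + 1)"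
proof -
  let ?D = "{(i, j). i + j \<le> m}"
  define e where "e = (\<lambda>p :: nat \<times> nat. if p = (1, 0) then x - x' else 0)"
  define t where "t = (\<lambda>(u :: 'a) (p :: nat \<times> nat). case p of (i, j) \<Rightarrow> F $ i $ j * u ^ i * y ^ j)"
  have "sum e ?D = x - x'"
    unfolding e_def using m finite_triangle by (subst sum.delta) auto
  then have "partial_sum m x y - partial_sum m x' y - (x - x') = (\<Sum>p\<in>?D. t x p - t x' p - e p)"
    by (simp add: partial_sum_def t_def sum_subtractf)
  also have "\<dots> \<in> P (k + 1)"
  proof (rule P_sum)
    fix p :: "nat \<times> nat"
    obtain i j where p: "p = (i, j)" by (cases p)
    have yj: "y ^ j \<in> P (int j)" by (rule P_power1[OF y])
    have "F $ i $ j * (x ^ i - x' ^ i) * y ^ j - (if (i, j) = (1, 0) then x - x' else 0) \<in> P (k + 1)"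
    proof (cases "i \<le> 1")
      case True
      have "F $ 1 $ j * (x - x') * y ^ j \<in> P (k + 1)" if "j \<noteq> 0"
        using coeff d P_mono[OF yj, of 1] that by (intro P_mult P_mult0(1)) auto
      then show ?thesis using True coeff_10 by (cases i) (auto simp: le_Suc_eq)
    next
      case False
      have "x ^ i - x' ^ i = (x - x') * (\<Sum>l<i. x' ^ (i - Suc l) * x ^ l)"
        by (rule power_diff_sumr2)
      also have "\<dots> \<in> P (k + 1)"
      proof (intro P_mult d P_sum)
        fix l assume l: "l \<in> {..<i}"
        have "x' ^ (i - Suc l) * x ^ l \<in> P (int (i - Suc l) + int l)"
          using x by (intro P_mult P_power1)
        then show "x' ^ (i - Suc l) * x ^ l \<in> P 1" by (rule P_mono) (use l False in auto)
      qed
      finally have "F $ i $ j * (x ^ i - x' ^ i) * y ^ j \<in> P (k + 1)"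
        using coeff P_mono[OF yj, of 0] by (intro P_mult0) auto
      then show ?thesis using False by simp
    qed
    then show "t x p - t x' p - e p \<in> P (k + 1)"
      by (simp add: p t_def e_def algebra_simps)
  qed
  finally show ?thesis .
qed

lemma fadd_near:
  assumes "x \<in> P 1" "x' \<in> P 1" "y \<in> P 1" "x - x' \<in> P k"
  shows "fadd x y - fadd x' y - (x - x') \<in> P (k + 1)"
proof -
  define m where "m = nat k + 1"
  have m: "partial_sum m x y - fadd x y \<in> P (k + 1)" "partial_sum m x' y - fadd x' y \<in> P (k + 1)"
    using assms by (auto simp: m_def intro: P_mono[OF partial_sum_approx])
  have "partial_sum m x y - partial_sum m x' y - (x - x') \<in> P (k + 1)"
    using assms by (intro partial_sum_near) (auto simp: m_def)
  from P_add[OF P_diff[OF this m(1)] m(2)] show ?thesis by (simp add: algebra_simps)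
qed

lemma fadd_P1:
  assumes "x \<in> P 1" "y \<in> P 1"
  shows "fadd x y \<in> P 1"
proof -
  have "partial_sum 0 x y = 0" by (simp add: partial_sum_def coeff_00)
  then show ?thesis using partial_sum_approx[OF assms, of 0] by simp
qed

subsection \<open>Associativity\<close>

definition integral3 :: "'a fps fps fps set" where
  "integral3 = {A. \<forall>a b c. A $ a $ b $ c \<in> P 0}"

definition truncated_eval3 :: "nat \<Rightarrow> 'a \<Rightarrow> 'a \<Rightarrow> 'a \<Rightarrow> 'a fps fps fps \<Rightarrow> 'a" where
  "truncated_eval3 N x y z A = (\<Sum>a<N. (\<Sum>b<N. (\<Sum>c<N. A $ a $ b $ c * z ^ c) * y ^ b) * x ^ a)"

lemma approx_hom_eval3:
  assumes "N > 0" "x \<in> P 1" "y \<in> P 1" "z \<in> P 1"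
  shows "approx_hom N integral3 (truncated_eval3 N x y z)"
proof -
  have "approx_hom N (P 0) (\<lambda>a. a)"
    using P_mult[of _ 0 _ 0] by (auto simp: approx_hom_def intro: P_add)
  from approx_hom_fps[OF approx_hom_fps[OF approx_hom_fps[OF this assms(1,4)] assms(1,3)] assms(1,2)]
  show ?thesis by (simp add: integral3_def truncated_eval3_def[abs_def])
qed

lemma sum_single:
  fixes N :: nat
  assumes "k < N" "\<And>i. i \<noteq> k \<Longrightarrow> g i = 0"
  shows "(\<Sum>i<N. g i) = (g k :: 'a)"
  using assms sum.mono_neutral_right[of "{..<N}" "{k}" g] by simp

lemma truncated_eval3_monomial:
  assumes "p < N" "q < N" "r < N" "\<And>a b c. A $ a $ b $ c = (if a = p \<and> b = q \<and> c = r then w else 0)"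
  shows "truncated_eval3 N x y z A = w * z ^ r * y ^ q * x ^ p"
proof -
  have 1: "(\<Sum>c<N. A $ a $ b $ c * z ^ c) = (if a = p \<and> b = q then w * z ^ r else 0)" for a b
    by (subst sum_single[OF assms(3)]) (auto simp: assms(4))
  have 2: "(\<Sum>b<N. (\<Sum>c<N. A $ a $ b $ c * z ^ c) * y ^ b) = (if a = p then w * z ^ r * y ^ q else 0)" for a
    unfolding 1 by (subst sum_single[OF assms(2)]) auto
  show ?thesis
    unfolding truncated_eval3_def 2 by (subst sum_single[OF assms(1)]) auto
qed

text \<open>
  Evaluation turns substitution of power series into application of the formal sum, up to an error
  in \<open>P N\<close>. This transports the identity of series that expresses associativity to the points.
\<close>

lemma eval3_subst2:
  assumes N: "N > 0" and xyz: "x \<in> P 1" "y \<in> P 1" "z \<in> P 1"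
    and A: "A \<in> integral3" "order_ge 1 A" "truncated_eval3 N x y z A - \<alpha> \<in> P (int N)" "\<alpha> \<in> P 1"
    and B: "B \<in> integral3" "order_ge 1 B" "truncated_eval3 N x y z B - \<beta> \<in> P (int N)" "\<beta> \<in> P 1"
  shows "fps_subst2 F A B \<in> integral3"
    and "truncated_eval3 N x y z (fps_subst2 F A B) - fadd \<alpha> \<beta> \<in> P (int N)"
proof -
  let ?E = "truncated_eval3 N x y z"
  note hom = approx_hom_eval3[OF N xyz]
  have const: "fps_const (fps_const (fps_const c)) \<in> integral3" if "c \<in> P 0" for c
    using that by (auto simp: integral3_def)
  have E_const: "?E (fps_const (fps_const (fps_const c))) = c" for c
    using truncated_eval3_monomial[OF N N N, of "fps_const (fps_const (fps_const c))" c] by simp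
  have int: "A ^ i * B ^ j \<in> integral3" for i j
    using approx_hom_power(1)[OF hom] A(1) B(1) hom by (auto simp: approx_hom_def)
  show "fps_subst2 F A B \<in> integral3"
    using int coeff by (auto simp: integral3_def fps_subst2_def intro!: P_sum P_mult0(1))
  \<comment> \<open>The truncation involves exponents below \<open>N\<close> only, hence total degrees below \<open>3 * N\<close>.\<close>
  define m where "m = 3 * N"
  let ?D = "{(i, j). i + j \<le> m}"
  define S where "S = (\<Sum>(i, j)\<in>?D. fps_const (fps_const (fps_const (F $ i $ j))) * (A ^ i * B ^ j))"
  have "S $ a $ b $ c = fps_subst2 F A B $ a $ b $ c" if "a < N" "b < N" "c < N" for a b c
    using that by (simp add: S_def fps_subst2_nth[OF A(2) B(2), of _ _ _ m] m_def fps_sum_nth case_prod_unfold)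
  then have "?E (fps_subst2 F A B) = ?E S"
    by (simp add: truncated_eval3_def)
  also have "\<dots> = (\<Sum>(i, j)\<in>?D. ?E (fps_const (fps_const (fps_const (F $ i $ j))) * (A ^ i * B ^ j)))"
    by (simp add: S_def approx_hom_sum(1)[OF hom] case_prod_unfold)
  finally have "?E (fps_subst2 F A B) - partial_sum m \<alpha> \<beta> 
    = (\<Sum>(i, j)\<in>?D. ?E (fps_const (fps_const (fps_const (F $ i $ j))) * (A ^ i * B ^ j)) - F $ i $ j * (\<alpha> ^ i * \<beta> ^ j))"
    by (simp add: partial_sum_def sum_subtractf case_prod_unfold mult.assoc)
  also have "\<dots> \<in> P (int N)"
  proof (rule P_sum)
    fix p assume "p \<in> ?D"
    obtain i j where p: "p = (i, j)" by (cases p)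
    have pow: "?E (C ^ i) - \<gamma> ^ i \<in> P (int N)" 
      if "C \<in> integral3" "?E C - \<gamma> \<in> P (int N)" "\<gamma> \<in> P 1" for C \<gamma> i
    proof (induction i)
      case 0
      then show ?case using hom by (simp add: approx_hom_def)
    next
      case (Suc i)
      show ?case
        using approx_hom_mult_cong[OF hom that(1) approx_hom_power(1)[OF hom that(1)] that(2) Suc P_mono[OF that(3)]]
        by simp
    qed
    have "\<alpha> ^ i \<in> P 0" using P_power1[OF A(4)] by (rule P_mono) simp
    then have "?E (A ^ i * B ^ j) - \<alpha> ^ i * \<beta> ^ j \<in> P (int N)"
      using approx_hom_power(1)[OF hom] A B pow by (intro approx_hom_mult_cong[OF hom]) auto
    then have "?E (fps_const (fps_const (fps_const (F $ i $ j))) * (A ^ i * B ^ j)) - F $ i $ j * (\<alpha> ^ i * \<beta> ^ j) \<in> P (int N)"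
      by (intro approx_hom_mult_cong[OF hom const[OF coeff] int]) (simp_all add: E_const coeff)
    then show "(case p of (i, j) \<Rightarrow> ?E (fps_const (fps_const (fps_const (F $ i $ j))) * (A ^ i * B ^ j))
        - F $ i $ j * (\<alpha> ^ i * \<beta> ^ j)) \<in> P (int N)"
      by (simp add: p)
  qed
  finally have "?E (fps_subst2 F A B) - partial_sum m \<alpha> \<beta> \<in> P (int N)" .
  moreover have "partial_sum m \<alpha> \<beta> - fadd \<alpha> \<beta> \<in> P (int N)"
    by (rule P_mono[OF partial_sum_approx[OF A(4) B(4)]]) (simp add: m_def)
  ultimately show "?E (fps_subst2 F A B) - fadd \<alpha> \<beta> \<in> P (int N)" by (rule P_diff_trans)
qed

lemma fadd_assoc:
  assumes xyz: "x \<in> P 1" "y \<in> P 1" "z \<in> P 1"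
  shows "fadd x (fadd y z) = fadd (fadd x y) z"
proof -
  define tx ty tz :: "'a fps fps fps" where "tx = fps_X" and "ty = fps_const fps_X" and "tz = fps_const (fps_const fps_X)"
  have assoc: "fps_subst2 F tx (fps_subst2 F ty tz) = fps_subst2 F (fps_subst2 F tx ty) tz"
    using law by (simp add: formal_group_law_def Let_def tx_def ty_def tz_def)
  have int: "tx \<in> integral3" "ty \<in> integral3" "tz \<in> integral3"
    by (auto simp: integral3_def tx_def ty_def tz_def fps_X_def)
  have ord: "order_ge 1 tx" "order_ge 1 ty" "order_ge 1 tz"
    by (auto simp: order_ge_def tx_def ty_def tz_def fps_X_def)
  have "fadd x (fadd y z) - fadd (fadd x y) z \<in> P (2 + int k)" for k
  proof -
    define N where "N = k + 2"
    have N: "N > 0" by (simp add: N_def)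
    let ?E = "truncated_eval3 N x y z"
    have E: "?E tx - x \<in> P (int N)" "?E ty - y \<in> P (int N)" "?E tz - z \<in> P (int N)"
      using truncated_eval3_monomial[of 1 N 0 0 tx 1] truncated_eval3_monomial[of 0 N 1 0 ty 1]
        truncated_eval3_monomial[of 0 N 0 1 tz 1]
      by (simp_all add: tx_def ty_def tz_def fps_X_def N_def)
    note sub = eval3_subst2[OF N xyz]
    note yz = sub[OF int(2) ord(2) E(2) xyz(2) int(3) ord(3) E(3) xyz(3)]
    note xy = sub[OF int(1) ord(1) E(1) xyz(1) int(2) ord(2) E(2) xyz(2)]
    have "?E (fps_subst2 F tx (fps_subst2 F ty tz)) - fadd x (fadd y z) \<in> P (int N)"
      by (rule sub(2)[OF int(1) ord(1) E(1) xyz(1) yz(1) order_ge_subst2[where F=F, OF coeff_00] yz(2) fadd_P1[OF xyz(2,3)]])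
    moreover have "?E (fps_subst2 F (fps_subst2 F tx ty) tz) - fadd (fadd x y) z \<in> P (int N)"
      by (rule sub(2)[OF xy(1) order_ge_subst2[where F=F, OF coeff_00] xy(2) fadd_P1[OF xyz(1,2)] int(3) ord(3) E(3) xyz(3)])
    ultimately have "fadd x (fadd y z) - fadd (fadd x y) z \<in> P (int N)"
      unfolding assoc by (meson P_diff_commute P_diff_trans)
    then show ?thesis by (simp add: N_def add.commute)
  qed
  then show ?thesis using P_Inter[of "fadd x (fadd y z) - fadd (fadd x y) z" 2] by simp
qed

subsection \<open>The group structure\<close>

lemma fadd_0_0: "fadd 0 0 = 0"
proof -
  have "partial_sum m 0 0 = 0" for m
    unfolding partial_sum_def
    by (intro sum.neutral) (auto simp: power_0_left coeff_00)
  then have "fadd 0 0 \<in> P (1 + int m)" for m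
    using partial_sum_approx[of 0 0 m] by (simp add: add.commute)
  then show ?thesis by (rule P_Inter)
qed

text \<open>
  The neutral element is obtained from associativity: \<open>e x = x +\<^sub>F 0\<close> satisfies \<open>e (e x) = e x\<close>,
  and \<open>e\<close> is injective because it is the identity to first order.
\<close>

lemma fadd_0:
  assumes x: "x \<in> P 1"
  shows "fadd x 0 = x"
proof (rule ccontr)
  let ?e = "fadd x 0"
  assume "?e \<noteq> x"
  then have d: "?e - x \<noteq> 0" by simp
  have e: "?e \<in> P 1" using fadd_P1[OF x] by simp
  have "fadd ?e 0 = ?e" using fadd_assoc[OF x, of 0 0] by (simp add: fadd_0_0)
  then have "?e - ?e - (?e - x) \<in> P (v (?e - x) + 1)"
    using fadd_near[OF e x, of 0 "v (?e - x)"] by (simp add: P_def)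
  then have "?e - x \<in> P (v (?e - x) + 1)" by (metis P_minus_iff diff_self diff_0)
  then show False using d by (simp add: P_def)
qed

lemma fadd_approx:
  assumes "x \<in> P 1" "y \<in> P 1" "x \<in> P k"
  shows "fadd x y - (x + y) \<in> P (k + 1)"
  using fadd_near[OF assms(1) _ assms(2), of 0 k] assms(3) fadd_0[OF assms(2)] fadd_commute[of 0 y] assms(2)
  by (simp add: algebra_simps)

lemma fadd_closed:
  assumes "n \<ge> 1" "x \<in> P n" "y \<in> P n"
  shows "fadd x y \<in> P n"
proof -
  have "fadd x y - (x + y) \<in> P n"
    using assms by (intro P_mono[OF fadd_approx[of x y n]]) (auto intro: P_mono)
  then have "fadd x y - (x + y) + (x + y) \<in> P n" using assms by (intro P_add)
  then show ?thesis by simp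
qed

lemma fadd_inverse_exists:
  assumes n: "n \<ge> 1" and y: "y \<in> P n"
  shows "\<exists>x\<in>P n. fadd x y = 0"
proof (rule near_identity_surj[of n "\<lambda>x. fadd x y"])
  show "fadd a y - fadd b y - (a - b) \<in> P (k + 1)" if "a \<in> P n" "b \<in> P n" "k \<ge> n" "a - b \<in> P k" for a b k
    using that y n by (intro fadd_near) (auto intro: P_mono)
qed (use fadd_closed n y in auto)

lemma comm_group_points:
  assumes n: "n \<ge> 1"
  shows "comm_group (formal_group_points F v n)"
proof -
  have carrier: "carrier (formal_group_points F v n) = P (int n)"
    by (simp add: formal_group_points_def maximal_ideal_power_def P_def)
  have P1: "x \<in> P 1" if "x \<in> P (int n)" for x using that n by (auto intro: P_mono)
  have n': "int n \<ge> 1" using n by simp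
  have mult: "x \<otimes>\<^bsub>formal_group_points F v n\<^esub> y = fadd x y" and one: "\<one>\<^bsub>formal_group_points F v n\<^esub> = 0" for x y
    by (simp_all add: formal_group_points_def)
  show ?thesis
  proof (rule comm_groupI, unfold carrier mult one)
    show "fadd x y \<in> P (int n)" if "x \<in> P (int n)" "y \<in> P (int n)" for x y
      using that by (rule fadd_closed[OF n'])
    show "fadd (fadd x y) z = fadd x (fadd y z)" if "x \<in> P (int n)" "y \<in> P (int n)" "z \<in> P (int n)" for x y z
      by (rule fadd_assoc[OF P1[OF that(1)] P1[OF that(2)] P1[OF that(3)], symmetric])
    show comm: "fadd x y = fadd y x" if "x \<in> P (int n)" "y \<in> P (int n)" for x y
      by (rule fadd_commute[OF P1[OF that(1)] P1[OF that(2)]])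
    show "fadd 0 x = x" if "x \<in> P (int n)" for x
      using comm[of 0 x] fadd_0[OF P1[OF that]] that by simp
    show "\<exists>y\<in>P (int n). fadd y x = 0" if "x \<in> P (int n)" for x
      using fadd_inverse_exists[OF n' that] .
  qed simp
qed

end

text \<open>The points of higher level form a filtration on which both group structures can be compared.\<close>

locale formal_group_level = formal_group_over_ring +
  fixes n :: nat
  assumes n: "n \<ge> 1"
begin

abbreviation "M \<equiv> formal_group_points F v n"

sublocale M: comm_group M by (rule comm_group_points[OF n])

lemma carrier_M: "carrier M = P (int n)"
  by (simp add: formal_group_points_def maximal_ideal_power_def P_def)

lemma mult_M: "x \<otimes>\<^bsub>M\<^esub> y = fadd x y" and one_M: "\<one>\<^bsub>M\<^esub> = 0"
  by (simp_all add: formal_group_points_def)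

lemma P1: "x \<in> P k \<Longrightarrow> k \<ge> int n \<Longrightarrow> x \<in> P 1"
  using n by (elim P_mono) simp

lemma level_carrier: "x \<in> P k \<Longrightarrow> k \<ge> int n \<Longrightarrow> x \<in> carrier M"
  unfolding carrier_M by (rule P_mono)

lemma inv_closed_level:
  assumes "x \<in> P k" "k \<ge> int n"
  shows "inv\<^bsub>M\<^esub> x \<in> P k"
proof -
  obtain y where y: "y \<in> P k" "fadd y x = 0"
    using fadd_inverse_exists[of k x] assms n by auto
  then have "inv\<^bsub>M\<^esub> x = y"
    using assms by (intro M.inv_equality) (auto simp: mult_M one_M level_carrier)
  then show ?thesis using y by simp
qed

lemma subgroup_level: "k \<ge> int n \<Longrightarrow> subgroup (P k) M"
proof
  assume k: "k \<ge> int n"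
  show "P k \<subseteq> carrier M" using k level_carrier by blast
  show "x \<otimes>\<^bsub>M\<^esub> y \<in> P k" if "x \<in> P k" "y \<in> P k" for x y
    using that fadd_closed[of k x y] k n by (simp add: mult_M)
  show "\<one>\<^bsub>M\<^esub> \<in> P k" by (simp add: one_M)
  show "inv\<^bsub>M\<^esub> x \<in> P k" if "x \<in> P k" for x using inv_closed_level[OF that k] .
qed

lemma mult_approx:
  assumes "x \<in> P k" "y \<in> P k" "k \<ge> int n"
  shows "x \<otimes>\<^bsub>M\<^esub> y - (x + y) \<in> P (k + 1)"
  unfolding mult_M by (rule fadd_approx[OF P1[OF assms(1,3)] P1[OF assms(2,3)] assms(1)])

lemma inv_approx:
  assumes "x \<in> P k" "k \<ge> int n"
  shows "inv\<^bsub>M\<^esub> x + x \<in> P (k + 1)"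
proof -
  have "x \<in> carrier M" using assms by (auto intro: level_carrier)
  then have "inv\<^bsub>M\<^esub> x \<otimes>\<^bsub>M\<^esub> x = 0" by (simp add: one_M[symmetric])
  then have "0 - (inv\<^bsub>M\<^esub> x + x) \<in> P (k + 1)"
    using mult_approx[OF inv_closed_level[OF assms] assms] by simp
  then show ?thesis by (metis diff_0 P_minus_iff)
qed

text \<open>
  If \<open>d\<close> is the formal difference of \<open>x\<close> and \<open>y\<close>, then \<open>x = d +\<^sub>F y\<close> is \<open>d + y\<close> up to an error
  that is small compared with \<open>d\<close>; so \<open>d\<close> and \<open>x - y\<close> have the same valuation. Thus congruences
  modulo the subgroup \<open>P k\<close> mean the same for both group structures.
\<close>

lemma difference_level:
  assumes xy: "x \<in> carrier M" "y \<in> carrier M" and k: "k \<ge> int n"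
  shows "x \<otimes>\<^bsub>M\<^esub> inv\<^bsub>M\<^esub> y \<in> P k \<longleftrightarrow> x - y \<in> P k"
proof -
  define d where "d = x \<otimes>\<^bsub>M\<^esub> inv\<^bsub>M\<^esub> y"
  have d: "d \<in> carrier M" "d \<otimes>\<^bsub>M\<^esub> y = x" using xy by (simp_all add: d_def M.m_assoc)
  have near: "x - y - d \<in> P (j + 1)" if "d \<in> P j" for j
    using fadd_approx[of d y j] d xy that P1[of _ "int n"] by (simp add: mult_M carrier_M diff_diff_add add.commute)
  show ?thesis
    unfolding d_def[symmetric]
  proof
    assume "d \<in> P k"
    then have "(x - y - d) + d \<in> P k" using P_mono[OF near[of k], of k] by (intro P_add) auto
    then show "x - y \<in> P k" by simp
  next
    assume xy: "x - y \<in> P k"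
    show "d \<in> P k"
    proof (rule ccontr)
      assume "d \<notin> P k"
      then have vd: "d \<noteq> 0" "v d < k" by (auto simp: P_def)
      then have "x - y - d \<in> P (v d + 1)" using near[of "v d"] by (simp add: P_def)
      moreover have "x - y \<in> P (v d + 1)" using vd by (intro P_mono[OF xy]) simp
      ultimately have "(x - y) - (x - y - d) \<in> P (v d + 1)" using P_diff by blast
      then show False using vd by (simp add: P_def)
    qed
  qed
qed

lemma finprod_approx:
  assumes "\<And>i. i \<in> I \<Longrightarrow> c i \<in> P k" "k \<ge> int n"
  shows "finprod M c I - sum c I \<in> P (k + 1)" and "finprod M c I \<in> P k"
proof -
  have "finprod M c I \<in> P k \<and> finprod M c I - sum c I \<in> P (k + 1)"
    using assms(1)
  proof (induction I rule: infinite_finite_induct)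
    case (insert i I)
    have cM: "c \<in> I \<rightarrow> carrier M" "c i \<in> carrier M"
      using insert.prems assms(2) by (auto intro: level_carrier)
    have ci: "c i \<in> P k" using insert.prems by auto
    have IH: "finprod M c I \<in> P k" "finprod M c I - sum c I \<in> P (k + 1)" using insert by auto
    have eq: "finprod M c (insert i I) = c i \<otimes>\<^bsub>M\<^esub> finprod M c I" using insert.hyps cM by simp
    have "(c i \<otimes>\<^bsub>M\<^esub> finprod M c I - (c i + finprod M c I)) + (finprod M c I - sum c I) \<in> P (k + 1)"
      using mult_approx[OF ci IH(1) assms(2)] IH(2) by (rule P_add)
    then show ?case
      using subgroup.m_closed[OF subgroup_level[OF assms(2)] ci IH(1)] insert.hyps 
      by (simp add: eq algebra_simps)
  qed (auto simp: one_M)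
  then show "finprod M c I - sum c I \<in> P (k + 1)" "finprod M c I \<in> P k" by auto
qed

lemma finprod_approx_cong:
  assumes "\<And>i. i \<in> I \<Longrightarrow> c i \<in> P k" "\<And>i. i \<in> I \<Longrightarrow> c i - c' i \<in> P (k + 1)" "k \<ge> int n"
  shows "finprod M c I - sum c' I \<in> P (k + 1)"
proof -
  have "sum c I - sum c' I \<in> P (k + 1)"
    using P_sum[of I "\<lambda>i. c i - c' i" "k + 1"] assms(2) by (simp add: sum_subtractf)
  with finprod_approx(1)[OF assms(1,3)] show ?thesis by (rule P_diff_trans)
qed

lemma sign_approx:
  assumes "x \<in> P k" "k \<ge> int n"
  shows "x [^]\<^bsub>M\<^esub> ((- 1) ^ i :: int) - (- 1) ^ i * x \<in> P (k + 1)" and "x [^]\<^bsub>M\<^esub> ((- 1) ^ i :: int) \<in> P k"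
proof -
  have "x \<in> carrier M" using assms by (auto intro: level_carrier)
  then show "x [^]\<^bsub>M\<^esub> ((- 1) ^ i :: int) - (- 1) ^ i * x \<in> P (k + 1)" "x [^]\<^bsub>M\<^esub> ((- 1) ^ i :: int) \<in> P k"
    using inv_approx[OF assms] inv_closed_level[OF assms] assms(1)
    by (cases "even i"; simp add: M.int_pow_neg)+
qed

end

section \<open>Tame groups of automorphisms\<close>

context complete_valued_field
begin

text \<open>This is how the finiteness of the residue field is used: among infinitely many integers two are congruent.\<close>

lemma residue_pigeonhole:
  fixes s :: "nat \<Rightarrow> 'a"
  assumes "\<And>i. s i \<in> P 0"
  shows "\<exists>i j. i < j \<and> s i - s j \<in> P 1"
proof -
  let ?O = "ring_of_type_algebra\<lparr>carrier := valuation_ring UNIV v\<rparr>"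
  let ?c = "\<lambda>x. maximal_ideal_power UNIV v 1 +>\<^bsub>?O\<^esub> x"
  have I: "maximal_ideal_power UNIV v 1 = P 1" by (auto simp: maximal_ideal_power_def P_def)
  have c: "?c x = {h + x |h. h \<in> P 1}" for x
    unfolding I by (auto simp: a_r_coset_def r_coset_def ring_of_type_algebra_def)
  have "?c ` range s \<subseteq> carrier (?O Quot maximal_ideal_power UNIV v 1)"
    using assms by (auto simp: FactRing_def A_RCOSETS_def RCOSETS_def a_r_coset_def valuation_ring_def P_def)
  then have "finite (?c ` range s)"
    using finite_residue_field finite_subset by blast
  then have "finite (range (\<lambda>i. ?c (s i)))" by (simp add: image_comp comp_def)
  then have "\<not> inj (\<lambda>i. ?c (s i))" using finite_imageD[of _ "UNIV :: nat set"] by auto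
  then obtain i j where ij: "i \<noteq> j" "?c (s i) = ?c (s j)" by (auto simp: inj_def)
  have "s k \<in> ?c (s l)" if "?c (s k) = ?c (s l)" for k l
    using that c[of "s k"] by (metis (mono_tags, lifting) P_zero add_0 mem_Collect_eq)
  then have "s i \<in> ?c (s j)" "s j \<in> ?c (s i)" using ij(2) by simp_all
  then have "s i - s j \<in> P 1" "s j - s i \<in> P 1" unfolding c by auto
  then show ?thesis using ij(1) by (metis nat_neq_iff)
qed

lemma P_power_cong:
  assumes "x \<in> P 0" "y \<in> P 0" "x - y \<in> P N"
  shows "x ^ k - y ^ k \<in> P N"
proof (induction k)
  case (Suc k)
  have "x ^ Suc k - y ^ Suc k = (x - y) * x ^ k + y * (x ^ k - y ^ k)"
    by (simp add: algebra_simps)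
  also have "\<dots> \<in> P N"
    using assms Suc P_power0 by (intro P_add P_mult0)
  finally show ?case .
qed simp

lemma frobenius_diff:
  assumes p: "Factorial_Ring.prime p" "of_nat p \<in> P 1" and xy: "x \<in> P 0" "y \<in> P 0"
  shows "(x - y) ^ p - (x ^ p - y ^ p) \<in> P 1"
proof -
  define z where "z = x - y"
  have z: "z \<in> P 0" using xy by (auto simp: z_def intro: P_diff)
  have p0: "p > 0" using p(1) prime_gt_0_nat by blast
  have "x ^ p = (z + y) ^ p" by (simp add: z_def)
  also have "\<dots> = (\<Sum>k\<le>p. of_nat (p choose k) * z ^ k * y ^ (p - k))" by (rule binomial_ring)
  also have "\<dots> = (\<Sum>k\<in>{0<..<p}. of_nat (p choose k) * z ^ k * y ^ (p - k)) + (y ^ p + z ^ p)"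
  proof -
    have "{..p} = insert 0 (insert p {0<..<p})" using p0 by auto
    then show ?thesis using p0 by (simp add: add_ac)
  qed
  finally have "z ^ p - (x ^ p - y ^ p) = - (\<Sum>k\<in>{0<..<p}. of_nat (p choose k) * z ^ k * y ^ (p - k))"
    by (simp add: algebra_simps)
  also have "\<dots> \<in> P 1"
  proof (intro P_minus P_sum)
    fix k assume k: "k \<in> {0<..<p}"
    then have "p dvd (p choose k)" using p(1) by (intro dvd_choose_prime) auto
    then obtain m where "p choose k = p * m" by blast
    then have "of_nat (p choose k) = of_nat p * (of_nat m :: 'a)" by simp
    then have "(of_nat (p choose k) :: 'a) \<in> P 1" using p(2) P_of_nat P_mult0(2) by metis
    then show "of_nat (p choose k) * z ^ k * y ^ (p - k) \<in> P 1"
      using z xy P_power0 by (intro P_mult0(2))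
  qed
  finally show ?thesis by (simp add: z_def)
qed

lemma frobenius_power_diff:
  assumes p: "Factorial_Ring.prime p" "of_nat p \<in> P 1" and xy: "x \<in> P 0" "y \<in> P 0"
  shows "(x - y) ^ (p ^ k) - (x ^ (p ^ k) - y ^ (p ^ k)) \<in> P 1"
proof (induction k)
  case (Suc k)
  let ?x = "x ^ (p ^ k)" and ?y = "y ^ (p ^ k)"
  have P0: "?x \<in> P 0" "?y \<in> P 0" "(x - y) ^ (p ^ k) \<in> P 0"
    using xy by (auto intro: P_power0 P_diff)
  have "((x - y) ^ (p ^ k)) ^ p - (?x - ?y) ^ p \<in> P 1"
    using P0 by (intro P_power_cong Suc P_diff)
  moreover have "(?x - ?y) ^ p - (?x ^ p - ?y ^ p) \<in> P 1"
    by (rule frobenius_diff[OF p P0(1,2)])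
  ultimately show ?case
    by (metis P_diff_trans power_Suc2 power_mult)
qed simp

text \<open>The residue field is perfect: in the sequence \<open>x\<^bsup>p\<^sup>i\<^esup>\<close> two residues agree, and Frobenius is injective.\<close>

lemma residue_root_exists:
  assumes p: "Factorial_Ring.prime p" "of_nat p \<in> P 1" and x: "x \<in> P 0"
  shows "\<exists>y\<in>P 0. x - y ^ p \<in> P 1"
proof -
  obtain i j where ij: "i < j" "x ^ (p ^ i) - x ^ (p ^ j) \<in> P 1"
    using residue_pigeonhole[of "\<lambda>i. x ^ (p ^ i)"] P_power0[OF x] by blast
  \<comment> \<open>If \<open>x\<close> agrees with \<open>x ^ (p ^ (d + 1))\<close>, then \<open>x ^ (p ^ d)\<close> is a \<open>p\<close>-th root of it.\<close>
  define d where "d = j - i - 1"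
  have j: "j = Suc d + i" using ij(1) by (simp add: d_def)
  let ?y = "x ^ (p ^ d)"
  have y: "?y \<in> P 0" by (rule P_power0[OF x])
  have eq: "(?y ^ p) ^ (p ^ i) = x ^ (p ^ j)"
    by (simp add: j power_mult[symmetric] power_add mult_ac)
  have "(x - ?y ^ p) ^ (p ^ i) - (x ^ (p ^ i) - (?y ^ p) ^ (p ^ i)) \<in> P 1"
    by (rule frobenius_power_diff[OF p x P_power0[OF y]])
  then have "(x - ?y ^ p) ^ (p ^ i) - (x ^ (p ^ i) - x ^ (p ^ j)) + (x ^ (p ^ i) - x ^ (p ^ j)) \<in> P 1"
    unfolding eq by (rule P_add[OF _ ij(2)])
  then have "(x - ?y ^ p) ^ (p ^ i) \<in> P 1" by simp
  then have "x - ?y ^ p \<in> P 1"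
    using x y by (intro P1_power[of "x - ?y ^ p"] P_diff P_power0)
  then show ?thesis using y by blast
qed

lemma prime_divisor_in_P1:
  assumes "m > 0" "of_nat m \<in> P 1"
  shows "\<exists>p. Factorial_Ring.prime p \<and> p dvd m \<and> of_nat p \<in> P 1"
  using assms
proof (induction m rule: less_induct)
  case (less m)
  have "m \<noteq> 1" using less.prems by (auto simp: P_def v_one)
  then obtain p where p: "Factorial_Ring.prime p" "p dvd m" using prime_factor_nat by blast
  then obtain k where k: "m = p * k" by blast
  have "of_nat p * of_nat k \<in> P 1" using less.prems k by simp
  then consider "of_nat p \<in> P 1" | "of_nat k \<in> P 1" using P1_prime P_of_nat by blast
  then show ?case
  proof cases
    case 1
    then show ?thesis using p by blast
  next
    case 2
    have "k < m" "k > 0" using k p(1) less.prems(1) prime_gt_1_nat[OF p(1)] by auto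
    then show ?thesis using less.IH[OF _ _ 2] k by auto
  qed
qed

text \<open>
  Dedekind's independence of characters, for the automorphisms that the elements of \<open>S\<close> induce on
  the residue field. Multiplying a relation by \<open>\<tau> y\<close> and subtracting it from the relation at \<open>y *
  x\<close> eliminates \<open>\<tau>\<close>, and the new coefficients \<open>c \<sigma> * (\<sigma> y - \<tau> y)\<close> are residually zero only if the
  \<open>c \<sigma>\<close> are, when \<open>\<sigma>\<close> and \<open>\<tau>\<close> differ at \<open>y\<close>.
\<close>

lemma residual_independence:
  assumes "finite S" "\<And>\<sigma>. \<sigma> \<in> S \<Longrightarrow> valued_field_automorphism v \<sigma>"
    and "\<And>\<sigma> \<tau>. \<sigma> \<in> S \<Longrightarrow> \<tau> \<in> S \<Longrightarrow> \<sigma> \<noteq> \<tau> \<Longrightarrow> \<exists>x\<in>P 0. \<sigma> x - \<tau> x \<notin> P 1"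
    and "\<And>\<sigma>. \<sigma> \<in> S \<Longrightarrow> c \<sigma> \<in> P 0"
    and "\<And>x. x \<in> P 0 \<Longrightarrow> (\<Sum>\<sigma>\<in>S. c \<sigma> * \<sigma> x) \<in> P 1"
    and "\<sigma> \<in> S"
  shows "c \<sigma> \<in> P 1"
  using assms
proof (induction S arbitrary: c \<sigma> rule: finite_induct)
  case (insert \<tau> S)
  have aut: "\<rho> x \<in> P 0 \<longleftrightarrow> x \<in> P 0" "\<rho> (x * y) = \<rho> x * \<rho> y" "\<rho> 1 = 1" if "\<rho> \<in> insert \<tau> S" for \<rho> x y
    by (rule valued_field_automorphism.P_invariant[OF insert.prems(1)[OF that]]
        valued_field_automorphism.hom_mult[OF insert.prems(1)[OF that]]
        valued_field_automorphism.hom_1[OF insert.prems(1)[OF that]])+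
  have S: "c \<rho> \<in> P 1" if \<rho>: "\<rho> \<in> S" for \<rho>
  proof -
    obtain y where y: "y \<in> P 0" "\<rho> y - \<tau> y \<notin> P 1"
      using insert.prems(2)[of \<rho> \<tau>] \<rho> insert.hyps by auto
    have P0: "\<rho>' y - \<tau> y \<in> P 0" if "\<rho>' \<in> S" for \<rho>'
      using that y aut(1) by (intro P_diff) auto
    have "(\<Sum>\<sigma>\<in>S. c \<sigma> * (\<sigma> y - \<tau> y) * \<sigma> x) \<in> P 1" if x: "x \<in> P 0" for x
    proof -
      have "(\<Sum>\<sigma>\<in>insert \<tau> S. c \<sigma> * \<sigma> (y * x)) - \<tau> y * (\<Sum>\<sigma>\<in>insert \<tau> S. c \<sigma> * \<sigma> x)
        = (\<Sum>\<sigma>\<in>insert \<tau> S. c \<sigma> * \<sigma> (y * x) - \<tau> y * (c \<sigma> * \<sigma> x))"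
        by (simp only: sum_subtractf sum_distrib_left)
      also have "\<dots> = (\<Sum>\<sigma>\<in>insert \<tau> S. c \<sigma> * (\<sigma> y - \<tau> y) * \<sigma> x)"
        by (intro sum.cong refl) (simp only: aut(2), simp add: algebra_simps)
      also have "\<dots> = (\<Sum>\<sigma>\<in>S. c \<sigma> * (\<sigma> y - \<tau> y) * \<sigma> x)"
        using insert.hyps by simp
      finally have eq: "(\<Sum>\<sigma>\<in>insert \<tau> S. c \<sigma> * \<sigma> (y * x)) - \<tau> y * (\<Sum>\<sigma>\<in>insert \<tau> S. c \<sigma> * \<sigma> x)
        = (\<Sum>\<sigma>\<in>S. c \<sigma> * (\<sigma> y - \<tau> y) * \<sigma> x)" .
      have "\<tau> y \<in> P 0" using y(1) aut(1)[of \<tau> y] by blast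
      then show ?thesis
        using P_diff[OF insert.prems(4)[OF P_mult0(1)[OF y(1) x]] P_mult0(1)[OF _ insert.prems(4)[OF x]]]
        unfolding eq[symmetric] by blast
    qed
    note relation = this
    have "c \<rho> * (\<rho> y - \<tau> y) \<in> P 1"
    proof (rule insert.IH[of "\<lambda>\<sigma>. c \<sigma> * (\<sigma> y - \<tau> y)" \<rho>, OF _ _ _ relation \<rho>])
      show "c \<sigma> * (\<sigma> y - \<tau> y) \<in> P 0" if "\<sigma> \<in> S" for \<sigma>
        using insert.prems(3)[of \<sigma>] P0 that by (intro P_mult0(1)) auto
    qed (use insert.prems(1,2) in auto)
    then show ?thesis using P1_prime[of "c \<rho>"] insert.prems(3) P0 y(2) \<rho> by auto
  qed
  have "c \<tau> * \<tau> 1 + (\<Sum>\<sigma>\<in>S. c \<sigma> * \<sigma> 1) \<in> P 1"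
    using insert.prems(4)[of 1] insert.hyps by simp
  moreover have "(\<Sum>\<sigma>\<in>S. c \<sigma> * \<sigma> 1) \<in> P 1"
  proof (rule P_sum)
    fix \<sigma> assume "\<sigma> \<in> S"
    then show "c \<sigma> * \<sigma> 1 \<in> P 1" using S[of \<sigma>] aut(3)[of \<sigma>] by simp
  qed
  ultimately have "c \<tau> \<in> P 1"
    using P_diff[of "c \<tau> * \<tau> 1 + (\<Sum>\<sigma>\<in>S. c \<sigma> * \<sigma> 1)" 1 "\<Sum>\<sigma>\<in>S. c \<sigma> * \<sigma> 1"] aut(3)[of \<tau>] by simp
  then show ?case using S insert.prems(5) by auto
qed simp

end

text \<open>
  The last assumption says that the first ramification group is trivial. Like the others it passes
  to subgroups, so that one argument covers all subgroups of the Galois group.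
\<close>

locale tame_automorphism_group = complete_valued_field +
  fixes U :: "('a \<Rightarrow> 'a) set"
  assumes finite_U: "finite U"
    and automorphisms: "\<sigma> \<in> U \<Longrightarrow> valued_field_automorphism v \<sigma>"
    and id_U: "id \<in> U" and comp_U: "\<sigma> \<in> U \<Longrightarrow> \<tau> \<in> U \<Longrightarrow> \<sigma> \<circ> \<tau> \<in> U"
    and inverse_U: "\<sigma> \<in> U \<Longrightarrow> \<exists>\<tau>\<in>U. \<tau> \<circ> \<sigma> = id"
    and tame: "\<sigma> \<in> U \<Longrightarrow> (\<And>x. x \<in> P 0 \<Longrightarrow> \<sigma> x - x \<in> P 2) \<Longrightarrow> \<sigma> = id"
begin

lemma U_P: "\<sigma> \<in> U \<Longrightarrow> \<sigma> x \<in> P N \<longleftrightarrow> x \<in> P N"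
  using valued_field_automorphism.P_invariant[OF automorphisms] .

definition inertia :: "('a \<Rightarrow> 'a) set" where
  "inertia = {\<sigma> \<in> U. \<forall>x\<in>P 0. \<sigma> x - x \<in> P 1}"

lemma inertia_group: "group \<lparr>carrier = inertia, monoid.mult = (\<circ>), one = id\<rparr>"
proof (rule groupI)
  fix \<sigma> \<tau> assume \<sigma>\<tau>: "\<sigma> \<in> carrier \<lparr>carrier = inertia, monoid.mult = (\<circ>), one = id\<rparr>"
    "\<tau> \<in> carrier \<lparr>carrier = inertia, monoid.mult = (\<circ>), one = id\<rparr>"
  then have "\<sigma> (\<tau> x) - x \<in> P 1" if "x \<in> P 0" for x
    using that P_diff_trans[of "\<sigma> (\<tau> x)" "\<tau> x" 1 x] U_P by (auto simp: inertia_def)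
  then show "\<sigma> \<otimes>\<^bsub>\<lparr>carrier = inertia, monoid.mult = (\<circ>), one = id\<rparr>\<^esub> \<tau>
      \<in> carrier \<lparr>carrier = inertia, monoid.mult = (\<circ>), one = id\<rparr>"
    using \<sigma>\<tau> comp_U by (auto simp: inertia_def)
next
  fix \<sigma> assume "\<sigma> \<in> carrier \<lparr>carrier = inertia, monoid.mult = (\<circ>), one = id\<rparr>"
  then have \<sigma>: "\<sigma> \<in> U" "\<And>x. x \<in> P 0 \<Longrightarrow> \<sigma> x - x \<in> P 1" by (auto simp: inertia_def)
  obtain \<tau> where \<tau>: "\<tau> \<in> U" "\<tau> \<circ> \<sigma> = id" using inverse_U \<sigma>(1) by blast
  have "\<tau> x - x \<in> P 1" if "x \<in> P 0" for x
  proof -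
    have "\<tau> (\<sigma> x - x) \<in> P 1" using \<sigma>(2)[OF that] U_P[OF \<tau>(1)] by simp
    moreover have "\<tau> (\<sigma> x - x) = x - \<tau> x"
      using valued_field_automorphism.hom_diff[OF automorphisms[OF \<tau>(1)]] \<tau>(2) by (simp add: pointfree_idE)
    ultimately show ?thesis using P_diff_commute by simp
  qed
  then show "\<exists>\<tau>\<in>carrier \<lparr>carrier = inertia, monoid.mult = (\<circ>), one = id\<rparr>.
      \<tau> \<otimes>\<^bsub>\<lparr>carrier = inertia, monoid.mult = (\<circ>), one = id\<rparr>\<^esub> \<sigma>
      = \<one>\<^bsub>\<lparr>carrier = inertia, monoid.mult = (\<circ>), one = id\<rparr>\<^esub>"
    using \<tau> by (auto simp: inertia_def)
qed (use id_U in \<open>auto simp: inertia_def comp_assoc\<close>)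

text \<open>
  For \<open>\<sigma>\<close> in the inertia group, \<open>x \<mapsto> \<sigma> x - x\<close> is a derivation modulo the square of the maximal
  ideal. If it vanishes at a uniformizer then it vanishes on the maximal ideal; since it also
  vanishes on \<open>p\<close>-th powers, and the residue field is perfect, it vanishes altogether.
\<close>

lemma inertia_trivialI:
  assumes \<sigma>: "\<sigma> \<in> inertia" and \<pi>: "\<pi> \<noteq> 0" "v \<pi> = 1" "\<sigma> \<pi> - \<pi> \<in> P 2"
    and p: "Factorial_Ring.prime p" "of_nat p \<in> P 1"
  shows "\<sigma> = id"
proof (rule tame)
  show U: "\<sigma> \<in> U" using \<sigma> by (simp add: inertia_def)
  interpret valued_field_automorphism v \<sigma> by (rule automorphisms[OF U])
  have res: "\<sigma> x - x \<in> P 1" if "x \<in> P 0" for x using \<sigma> that by (simp add: inertia_def)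
  have ideal: "\<sigma> t - t \<in> P 2" if "t \<in> P 1" for t
  proof -
    define s where "s = t / \<pi>"
    have s: "s \<in> P 0" "t = \<pi> * s"
      using that \<pi>(1,2) v_mult'[of t "inverse \<pi>"] v_inverse[OF \<pi>(1)] by (auto simp: s_def P_def divide_inverse)
    have "\<sigma> t - t = (\<sigma> \<pi> - \<pi>) * \<sigma> s + \<pi> * (\<sigma> s - s)"
      by (simp add: s(2) hom_mult algebra_simps)
    also have "\<dots> \<in> P 2"
    proof (rule P_add)
      show "(\<sigma> \<pi> - \<pi>) * \<sigma> s \<in> P 2" using \<pi>(3) s(1) P_invariant by (intro P_mult0(2)) auto
      have "\<pi> \<in> P 1" using \<pi> by (simp add: P_def)
      then show "\<pi> * (\<sigma> s - s) \<in> P 2" using res[OF s(1)] by (rule P_mult_le) simp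
    qed
    finally show ?thesis .
  qed
  have power: "\<sigma> (y ^ p) - y ^ p \<in> P 2" if y: "y \<in> P 0" for y
  proof -
    define d where "d = \<sigma> y - y"
    have d: "d \<in> P 1" using res[OF y] by (simp add: d_def)
    have step: "(y + d) ^ k - y ^ k - of_nat k * y ^ (k - 1) * d \<in> P 2" for k
    proof (induction k)
      case (Suc k)
      have yd: "y + d \<in> P 0" using y d by (intro P_add) (auto intro: P_mono)
      have "of_nat k * y ^ (k - 1) * y = of_nat k * y ^ k" by (cases k) auto
      then have "(y + d) ^ Suc k - y ^ Suc k - of_nat (Suc k) * y ^ (Suc k - 1) * d
        = (y + d) * ((y + d) ^ k - y ^ k - of_nat k * y ^ (k - 1) * d) + of_nat k * y ^ (k - 1) * (d * d)"
        by (simp add: algebra_simps)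
      also have "\<dots> \<in> P 2"
      proof (intro P_add)
        show "(y + d) * ((y + d) ^ k - y ^ k - of_nat k * y ^ (k - 1) * d) \<in> P 2"
          using yd Suc by (rule P_mult0(1))
        have "of_nat k * y ^ (k - 1) \<in> P 0" by (rule P_mult0(1)[OF P_of_nat P_power0[OF y]])
        moreover have "d * d \<in> P 2" by (rule P_mult_le[OF d d]) simp
        ultimately show "of_nat k * y ^ (k - 1) * (d * d) \<in> P 2" by (rule P_mult0(1))
      qed
      finally show ?case .
    qed simp
    have "of_nat p * y ^ (p - 1) \<in> P 1" using p(2) P_power0[OF y] by (intro P_mult0(2))
    then have "of_nat p * y ^ (p - 1) * d \<in> P 2" using d by (rule P_mult_le) simp
    then have "(y + d) ^ p - y ^ p - of_nat p * y ^ (p - 1) * d + of_nat p * y ^ (p - 1) * d \<in> P 2"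
      by (rule P_add[OF step])
    then show ?thesis by (simp add: hom_power d_def)
  qed
  fix x assume "x \<in> P 0"
  then obtain y where y: "y \<in> P 0" "x - y ^ p \<in> P 1" using residue_root_exists[OF p] by blast
  have "(\<sigma> (y ^ p) - y ^ p) + (\<sigma> (x - y ^ p) - (x - y ^ p)) \<in> P 2"
    using power[OF y(1)] ideal[OF y(2)] by (rule P_add)
  then show "\<sigma> x - x \<in> P 2" by (simp add: hom_diff)
qed

text \<open>
  An inertia element of order \<open>p\<close> multiplies a uniformizer by a unit \<open>u\<close> with \<open>u\<^sup>p \<equiv> 1\<close>, hence \<open>u
  \<equiv> 1\<close>, modulo the maximal ideal, and is therefore the identity; so by Sylow's theorem \<open>p\<close> does
  not divide the order of the inertia group.
\<close>

lemma card_inertia_unit: "of_nat (card inertia) \<notin> P 1"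
proof
  assume "of_nat (card inertia) \<in> P 1"
  let ?I = "\<lparr>carrier = inertia, monoid.mult = (\<circ>), one = id\<rparr>"
  interpret I: group ?I by (rule inertia_group)
  have fin: "finite inertia" using finite_U by (simp add: inertia_def)
  have "card inertia > 0" using fin I.one_closed by (auto simp: card_gt_0_iff)
  then obtain p where p: "Factorial_Ring.prime p" "p dvd card inertia" "of_nat p \<in> P 1"
    using prime_divisor_in_P1 \<open>of_nat (card inertia) \<in> P 1\<close> by blast
  then obtain m where "Coset.order ?I = p ^ 1 * m" by (auto simp: Coset.order_def)
  then obtain H where H: "subgroup H ?I" "card H = p"
    using sylow_thm[OF p(1) inertia_group, of 1 m] fin by auto
  interpret H: group "?I\<lparr>carrier := H\<rparr>" by (rule I.subgroup_imp_group[OF H(1)])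
  have "H \<noteq> {id}" using H(2) p(1) prime_gt_1_nat by fastforce
  then obtain \<sigma> where \<sigma>: "\<sigma> \<in> H" "\<sigma> \<noteq> id" using H.one_closed by auto
  have \<sigma>I: "\<sigma> \<in> inertia" using subgroup.subset[OF H(1)] \<sigma>(1) by auto
  then have U: "\<sigma> \<in> U" by (simp add: inertia_def)
  have pow: "\<sigma> [^]\<^bsub>?I\<lparr>carrier := H\<rparr>\<^esub> k = \<sigma> ^^ k" for k :: nat
    by (induction k) (auto simp: nat_pow_def funpow_Suc_right simp del: funpow.simps)
  have "\<sigma> ^^ p = id"
    using H.pow_order_eq_1[of \<sigma>] \<sigma>(1) H(2) pow[of p] by (simp add: Coset.order_def)
  interpret valued_field_automorphism v \<sigma> by (rule automorphisms[OF U])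
  obtain \<pi> where \<pi>: "\<pi> \<noteq> 0" "v \<pi> = 1" using v_normalized by auto
  define u where "u = \<sigma> \<pi> / \<pi>"
  have u: "\<sigma> \<pi> = u * \<pi>" "u \<noteq> 0" using \<pi> by (auto simp: u_def)
  then have "v u = 0" using v_mult'[of u \<pi>] v_invariant[of \<pi>] \<pi> by simp
  then have u0: "u \<in> P 0" by (simp add: P_def)
  have \<pi>1: "\<pi> \<in> P 1" using \<pi> by (simp add: P_def)
  have "(\<sigma> ^^ k) \<pi> - u ^ k * \<pi> \<in> P 2" for k
  proof (induction k)
    case (Suc k)
    have "\<sigma> ((\<sigma> ^^ k) \<pi> - u ^ k * \<pi>) \<in> P 2" using Suc P_invariant by simp
    then have "(\<sigma> ^^ Suc k) \<pi> - \<sigma> u ^ k * (u * \<pi>) \<in> P 2" by (simp add: hom_diff hom_mult hom_power u(1))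
    moreover have "(\<sigma> u ^ k - u ^ k) * (u * \<pi>) \<in> P 2"
    proof (rule P_mult_le)
      show "\<sigma> u ^ k - u ^ k \<in> P 1"
        using \<sigma>I u0 P_invariant by (intro P_power_cong) (auto simp: inertia_def)
      show "u * \<pi> \<in> P 1" using u0 \<pi>1 by (rule P_mult0(1))
    qed simp
    ultimately have "(\<sigma> ^^ Suc k) \<pi> - \<sigma> u ^ k * (u * \<pi>) + (\<sigma> u ^ k - u ^ k) * (u * \<pi>) \<in> P 2"
      by (rule P_add)
    then show ?case by (simp add: algebra_simps)
  qed simp
  from this[of p] have "(1 - u ^ p) * \<pi> \<in> P 2"
    using \<open>\<sigma> ^^ p = id\<close> by (simp add: algebra_simps)
  then have "1 - u ^ p \<in> P 1"
    using \<pi> v_mult'[of "1 - u ^ p" \<pi>] by (auto simp: P_def)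
  then have "(1 - u) ^ p - (1 ^ p - u ^ p) + (1 - u ^ p) \<in> P 1"
    by (rule P_add[OF frobenius_diff[OF p(1,3) P_one u0]])
  then have "(1 - u) ^ p \<in> P 1" by simp
  then have "1 - u \<in> P 1" using u0 by (intro P1_power[of "1 - u"] P_diff) auto
  then have "(u - 1) * \<pi> \<in> P 2" using P_mult_le[of "u - 1" 1 \<pi> 1 2] \<pi>1 P_diff_commute by simp
  then have "\<sigma> \<pi> - \<pi> \<in> P 2" by (simp add: u(1) algebra_simps)
  then have "\<sigma> = id" by (rule inertia_trivialI[OF \<sigma>I \<pi> _ p(1,3)])
  then show False using \<sigma>(2) by simp
qed

text \<open>
  Modulo the maximal ideal the trace is a combination of distinct residual automorphisms, the
  identity having the coefficient \<open>card inertia\<close>.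
\<close>

lemma unit_trace_exists: "\<exists>x\<in>P 0. (\<Sum>\<sigma>\<in>U. \<sigma> x) \<notin> P 1"
proof (rule ccontr)
  assume "\<not> ?thesis"
  then have trace: "(\<Sum>\<sigma>\<in>U. \<sigma> x) \<in> P 1" if "x \<in> P 0" for x using that by blast
  define cl where "cl = (\<lambda>\<sigma>. {\<tau> \<in> U. \<forall>x\<in>P 0. \<sigma> x - \<tau> x \<in> P 1})"
  define r where "r = (\<lambda>\<sigma>. SOME \<tau>. \<tau> \<in> cl \<sigma>)"
  have r: "r \<sigma> \<in> U" "\<And>x. x \<in> P 0 \<Longrightarrow> \<sigma> x - r \<sigma> x \<in> P 1" if "\<sigma> \<in> U" for \<sigma>
  proof -
    have "\<sigma> \<in> cl \<sigma>" using that by (simp add: cl_def)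
    then have "r \<sigma> \<in> cl \<sigma>" unfolding r_def by (rule someI[of "\<lambda>\<tau>. \<tau> \<in> cl \<sigma>"])
    then show "r \<sigma> \<in> U" "\<And>x. x \<in> P 0 \<Longrightarrow> \<sigma> x - r \<sigma> x \<in> P 1" by (auto simp: cl_def)
  qed
  have r_eq: "r \<sigma> = r \<tau>" if "\<And>x. x \<in> P 0 \<Longrightarrow> \<sigma> x - \<tau> x \<in> P 1" for \<sigma> \<tau>
  proof -
    have "cl \<sigma> = cl \<tau>"
      using that unfolding cl_def by (blast intro: P_diff_trans P_diff_commute)
    then show ?thesis by (simp add: r_def)
  qed
  define c where "c = (\<lambda>\<rho>. of_nat (card {\<sigma> \<in> U. r \<sigma> = \<rho>}) :: 'a)"
  have "c (r id) \<in> P 1"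
  proof (rule residual_independence[of "r ` U" c "r id"])
    show "\<exists>x\<in>P 0. \<sigma> x - \<tau> x \<notin> P 1" if \<sigma>\<tau>': "\<sigma> \<in> r ` U" "\<tau> \<in> r ` U" "\<sigma> \<noteq> \<tau>" for \<sigma> \<tau>
    proof (rule ccontr)
      assume "\<not> ?thesis"
      then have eq: "\<sigma> x - \<tau> x \<in> P 1" if "x \<in> P 0" for x using that by blast
      obtain \<sigma>' \<tau>' where \<sigma>\<tau>: "\<sigma> = r \<sigma>'" "\<tau> = r \<tau>'" "\<sigma>' \<in> U" "\<tau>' \<in> U" using \<sigma>\<tau>' by auto
      have "\<sigma>' x - \<tau>' x \<in> P 1" if x: "x \<in> P 0" for x
        using r(2)[OF \<sigma>\<tau>(3) x] r(2)[OF \<sigma>\<tau>(4) x] eq[OF x] P_diff_trans P_diff_commute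
        unfolding \<sigma>\<tau>(1,2) by metis
      then show False using r_eq \<sigma>\<tau>'(3) \<sigma>\<tau>(1,2) by metis
    qed
    show "(\<Sum>\<rho>\<in>r ` U. c \<rho> * \<rho> x) \<in> P 1" if x: "x \<in> P 0" for x
    proof -
      have "(\<Sum>\<sigma>\<in>U. \<sigma> x - r \<sigma> x) \<in> P 1" using r(2) x by (intro P_sum) auto
      then have "(\<Sum>\<sigma>\<in>U. \<sigma> x) - (\<Sum>\<sigma>\<in>U. \<sigma> x - r \<sigma> x) \<in> P 1" by (rule P_diff[OF trace[OF x]])
      then have "(\<Sum>\<sigma>\<in>U. r \<sigma> x) \<in> P 1" by (simp add: sum_subtractf)
      then show ?thesis
        using sum_fun_comp[OF finite_U, of "r ` U" r "\<lambda>\<rho>. \<rho> x"] finite_U by (simp add: c_def)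
    qed
  qed (use finite_U r(1) automorphisms id_U in \<open>auto simp: c_def P_of_nat\<close>)
  moreover have "{\<sigma> \<in> U. r \<sigma> = r id} = inertia"
  proof (intro equalityI subsetI)
    fix \<sigma> assume "\<sigma> \<in> {\<sigma> \<in> U. r \<sigma> = r id}"
    then have \<sigma>: "\<sigma> \<in> U" "r \<sigma> = r id" by auto
    have "\<sigma> x - id x \<in> P 1" if x: "x \<in> P 0" for x
      using r(2)[OF \<sigma>(1) x] r(2)[OF id_U x] P_diff_trans P_diff_commute unfolding \<sigma>(2) by blast
    then show "\<sigma> \<in> inertia" using \<sigma>(1) by (simp add: inertia_def)
  next
    fix \<sigma> assume "\<sigma> \<in> inertia"
    then show "\<sigma> \<in> {\<sigma> \<in> U. r \<sigma> = r id}" using r_eq[of \<sigma> id] by (auto simp: inertia_def)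
  qed
  ultimately show False using card_inertia_unit by (simp add: c_def)
qed

text \<open>An element of unit trace, divided by its trace, has trace one because the trace is invariant under \<open>U\<close>.\<close>

lemma trace_one_exists: "\<exists>a\<in>P 0. (\<Sum>\<sigma>\<in>U. \<sigma> a) = 1"
proof -
  obtain x where x: "x \<in> P 0" "(\<Sum>\<sigma>\<in>U. \<sigma> x) \<notin> P 1" using unit_trace_exists by blast
  define t where "t = (\<Sum>\<sigma>\<in>U. \<sigma> x)"
  have t: "t \<in> P 0" "t \<notin> P 1" using x U_P by (auto simp: t_def intro!: P_sum)
  have t0: "t \<noteq> 0" using t(2) by auto
  have invariant: "\<tau> t = t" if \<tau>: "\<tau> \<in> U" for \<tau>
  proof -
    obtain \<rho> where \<rho>: "\<rho> \<in> U" "\<rho> \<circ> \<tau> = id" using inverse_U \<tau> by blast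
    have bij: "\<tau> (\<rho> x) = x" "\<rho> (\<tau> x) = x" for x
      using \<rho>(2) valued_field_automorphism.bij[OF automorphisms[OF \<tau>]] 
      by (metis bij_inv_eq_iff comp_apply id_apply)+
    have "\<tau> t = (\<Sum>\<sigma>\<in>U. (\<tau> \<circ> \<sigma>) x)"
      by (simp add: t_def valued_field_automorphism.hom_sum[OF automorphisms[OF \<tau>]])
    also have "\<dots> = (\<Sum>\<sigma>\<in>U. \<sigma> x)"
      by (rule sum.reindex_bij_witness[of _ "\<lambda>\<sigma>. \<rho> \<circ> \<sigma>" "\<lambda>\<sigma>. \<tau> \<circ> \<sigma>"])
        (use \<tau> \<rho>(1) comp_U in \<open>auto simp: fun_eq_iff bij\<close>)
    finally show ?thesis by (simp add: t_def)
  qed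
  have "(\<Sum>\<sigma>\<in>U. \<sigma> (x / t)) = (\<Sum>\<sigma>\<in>U. \<sigma> x / t)"
  proof (intro sum.cong refl)
    fix \<sigma> assume "\<sigma> \<in> U"
    then show "\<sigma> (x / t) = \<sigma> x / t"
      using valued_field_automorphism.hom_divide[OF automorphisms, of \<sigma> x t] invariant by simp
  qed
  also have "\<dots> = 1" using t0 by (simp add: sum_divide_distrib[symmetric] t_def)
  finally show ?thesis using P_divide_unit[OF x(1) t] by blast
qed

end

section \<open>Tate cohomology of a finite group\<close>

text \<open>
  The coboundary of degree \<open>- 1\<close> is the norm. Read as the insertion of a group element into the
  empty tuple, it has the same shape as the coboundaries of lower degree; with this reading all
  negative degrees can be treated at once.
\<close>

definition insertion_base :: "int \<Rightarrow> 'a list \<Rightarrow> 'a list" where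
  "insertion_base q gs = (if q = - 1 then [] else gs)"

locale finite_G_module = G_module +
  assumes finite_G: "finite (carrier G)"

sublocale finite_G_module \<subseteq> G: group G by (rule group_G)
sublocale finite_G_module \<subseteq> M: comm_group M by (rule comm_group_M)

context finite_G_module
begin

lemma act_closed: "g \<in> carrier G \<Longrightarrow> x \<in> carrier M \<Longrightarrow> \<phi> g x \<in> carrier M"
  using action_hom by (auto simp: hom_def)

lemma act_hom: "g \<in> carrier G \<Longrightarrow> group_hom M M (\<phi> g)"
  by (simp add: action_hom M.is_group group_hom_def group_hom_axioms_def)

lemma act_finprod:
  assumes "g \<in> carrier G" "c \<in> I \<rightarrow> carrier M"
  shows "\<phi> g (finprod M c I) = finprod M (\<lambda>i. \<phi> g (c i)) I"
proof -
  interpret h: group_hom M M "\<phi> g" by (rule act_hom[OF assms(1)])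
  show ?thesis using assms(2)
  proof (induction I rule: infinite_finite_induct)
    case (insert i I)
    then show ?case by (simp add: Pi_iff)
  qed auto
qed

lemma act_int_pow:
  assumes "g \<in> carrier G" "x \<in> carrier M"
  shows "\<phi> g (x [^]\<^bsub>M\<^esub> (k::int)) = \<phi> g x [^]\<^bsub>M\<^esub> k"
  using group_hom.hom_int_pow[OF act_hom[OF assms(1)]] assms(2) by simp

lemma finprod_translate:
  assumes "g \<in> carrier G" "c \<in> carrier G \<rightarrow> carrier M"
  shows "finprod M (\<lambda>\<tau>. c (g \<otimes>\<^bsub>G\<^esub> \<tau>)) (carrier G) = finprod M c (carrier G)"
proof -
  have inj: "inj_on (\<lambda>\<tau>. g \<otimes>\<^bsub>G\<^esub> \<tau>) (carrier G)"
    using assms(1) by (simp add: inj_on_def)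
  have im: "(\<lambda>\<tau>. g \<otimes>\<^bsub>G\<^esub> \<tau>) ` carrier G = carrier G"
    by (simp add: assms(1) G.surj_const_mult)
  show ?thesis
    using M.finprod_reindex[of c "\<lambda>\<tau>. g \<otimes>\<^bsub>G\<^esub> \<tau>" "carrier G", unfolded im, OF _ inj] assms(2) by simp
qed

lemma tuples_translate:
  "g \<in> carrier G \<Longrightarrow> gs \<in> tate_tuples G q \<Longrightarrow> map (\<lambda>h. g \<otimes>\<^bsub>G\<^esub> h) gs \<in> tate_tuples G q"
  by (auto simp: tate_tuples_def)

lemma cochain_closed: "f \<in> carrier (tate_cochains G M \<phi> q) \<Longrightarrow> gs \<in> tate_tuples G q \<Longrightarrow> f gs \<in> carrier M"
  by (auto simp: tate_cochains_def)

lemma cochain_equivariant: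
  "f \<in> carrier (tate_cochains G M \<phi> q) \<Longrightarrow> g \<in> carrier G \<Longrightarrow> gs \<in> tate_tuples G q
    \<Longrightarrow> f (map (\<lambda>h. g \<otimes>\<^bsub>G\<^esub> h) gs) = \<phi> g (f gs)"
  by (auto simp: tate_cochains_def)

lemma cochain_outside: "f \<in> carrier (tate_cochains G M \<phi> q) \<Longrightarrow> gs \<notin> tate_tuples G q \<Longrightarrow> f gs = undefined"
  by (auto simp: tate_cochains_def)

lemma cochainI:
  assumes "\<And>gs. gs \<in> tate_tuples G q \<Longrightarrow> f gs \<in> carrier M"
    and "\<And>g gs. g \<in> carrier G \<Longrightarrow> gs \<in> tate_tuples G q \<Longrightarrow> f (map (\<lambda>h. g \<otimes>\<^bsub>G\<^esub> h) gs) = \<phi> g (f gs)"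
  shows "restrict f (tate_tuples G q) \<in> carrier (tate_cochains G M \<phi> q)"
  using assms tuples_translate by (auto simp: tate_cochains_def)

lemma cochain_eqI:
  assumes "f \<in> carrier (tate_cochains G M \<phi> q)" "f' \<in> carrier (tate_cochains G M \<phi> q)"
    and "\<And>gs. gs \<in> tate_tuples G q \<Longrightarrow> f gs = f' gs"
  shows "f = f'"
  using assms cochain_outside by (metis ext)

lemma comm_group_cochains: "comm_group (tate_cochains G M \<phi> q)" (is "comm_group ?C")
proof (rule comm_groupI)
  show "\<one>\<^bsub>?C\<^esub> \<in> carrier ?C"
    using cochainI[of q "\<lambda>_. \<one>\<^bsub>M\<^esub>"] group_hom.hom_one[OF act_hom] by (simp add: tate_cochains_def)
next
  fix f f' assume f: "f \<in> carrier ?C" "f' \<in> carrier ?C"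
  show "f \<otimes>\<^bsub>?C\<^esub> f' \<in> carrier ?C"
    using cochainI[of q "\<lambda>gs. f gs \<otimes>\<^bsub>M\<^esub> f' gs"] f cochain_closed cochain_equivariant
      group_hom.hom_mult[OF act_hom] by (auto simp: tate_cochains_def)
  show "f \<otimes>\<^bsub>?C\<^esub> f' = f' \<otimes>\<^bsub>?C\<^esub> f"
    using f by (auto simp: tate_cochains_def fun_eq_iff intro!: M.m_comm)
next
  fix f f' f'' assume f: "f \<in> carrier ?C" "f' \<in> carrier ?C" "f'' \<in> carrier ?C"
  show "f \<otimes>\<^bsub>?C\<^esub> f' \<otimes>\<^bsub>?C\<^esub> f'' = f \<otimes>\<^bsub>?C\<^esub> (f' \<otimes>\<^bsub>?C\<^esub> f'')"
    using f by (auto simp: tate_cochains_def fun_eq_iff PiE_iff M.m_assoc)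
next
  fix f assume f: "f \<in> carrier ?C"
  show "\<one>\<^bsub>?C\<^esub> \<otimes>\<^bsub>?C\<^esub> f = f"
    using f by (auto simp: tate_cochains_def fun_eq_iff PiE_iff extensional_def)
  let ?f' = "\<lambda>gs\<in>tate_tuples G q. inv\<^bsub>M\<^esub> (f gs)"
  have "?f' \<in> carrier ?C"
    using f cochain_closed cochain_equivariant group_hom.hom_inv[OF act_hom]
    by (intro cochainI) auto
  moreover have "?f' \<otimes>\<^bsub>?C\<^esub> f = \<one>\<^bsub>?C\<^esub>"
    using cochain_closed[OF f] by (auto simp: tate_cochains_def fun_eq_iff)
  ultimately show "\<exists>y\<in>carrier ?C. y \<otimes>\<^bsub>?C\<^esub> f = \<one>\<^bsub>?C\<^esub>" by blast
qed

lemma cochain_mult: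
  "gs \<in> tate_tuples G q \<Longrightarrow> (f \<otimes>\<^bsub>tate_cochains G M \<phi> q\<^esub> f') gs = f gs \<otimes>\<^bsub>M\<^esub> f' gs"
  by (simp add: tate_cochains_def)

lemma cochain_one: "gs \<in> tate_tuples G q \<Longrightarrow> \<one>\<^bsub>tate_cochains G M \<phi> q\<^esub> gs = \<one>\<^bsub>M\<^esub>"
  by (simp add: tate_cochains_def)

lemma cochain_inv:
  assumes "f \<in> carrier (tate_cochains G M \<phi> q)" "gs \<in> tate_tuples G q"
  shows "(inv\<^bsub>tate_cochains G M \<phi> q\<^esub> f) gs = inv\<^bsub>M\<^esub> (f gs)"
proof -
  interpret C: comm_group "tate_cochains G M \<phi> q" by (rule comm_group_cochains)
  have "(inv\<^bsub>tate_cochains G M \<phi> q\<^esub> f \<otimes>\<^bsub>tate_cochains G M \<phi> q\<^esub> f) gs = \<one>\<^bsub>M\<^esub>"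
    using assms cochain_one by simp
  then show ?thesis
    using assms cochain_mult cochain_closed by (metis C.inv_closed M.inv_equality)
qed

lemma sign_pow:
  "x \<in> carrier M \<Longrightarrow> x [^]\<^bsub>M\<^esub> ((- 1) ^ i :: int) = (if even i then x else inv\<^bsub>M\<^esub> x)"
  by (simp add: M.int_pow_neg)

lemma finprod_inv:
  assumes "c \<in> I \<rightarrow> carrier M"
  shows "inv\<^bsub>M\<^esub> (finprod M c I) = finprod M (\<lambda>i. inv\<^bsub>M\<^esub> (c i)) I"
  using assms
proof (induction I rule: infinite_finite_induct)
  case (insert i I)
  then show ?case by (simp add: Pi_iff M.inv_mult)
qed auto

lemma finprod_int_pow:
  assumes "c \<in> I \<rightarrow> carrier M"
  shows "(finprod M c I) [^]\<^bsub>M\<^esub> (k::int) = finprod M (\<lambda>i. c i [^]\<^bsub>M\<^esub> k) I"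
  using assms
proof (induction I rule: infinite_finite_induct)
  case (insert i I)
  then show ?case by (simp add: Pi_iff M.int_pow_distrib)
qed auto

lemma finprod_product:
  assumes "finite A" "finite B" "\<And>a b. a \<in> A \<Longrightarrow> b \<in> B \<Longrightarrow> c a b \<in> carrier M"
  shows "finprod M (\<lambda>a. finprod M (c a) B) A = finprod M (\<lambda>(a, b). c a b) (A \<times> B)"
  using assms(1,3)
proof (induction A rule: finite_induct)
  case (insert a A)
  have "insert a A \<times> B = (Pair a ` B) \<union> (A \<times> B)" by auto
  moreover have "finprod M (\<lambda>(a, b). c a b) (Pair a ` B) = finprod M (c a) B"
    using insert.prems by (subst M.finprod_reindex) (auto simp: inj_on_def)
  moreover have "(Pair a ` B) \<inter> (A \<times> B) = {}" using insert.hyps by auto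
  ultimately show ?case
    using insert assms(2) by (subst M.finprod_insert) (auto simp: M.finprod_Un_disjoint Pi_iff)
qed simp

lemma finprod_swap:
  assumes "finite A" "finite B" "\<And>a b. a \<in> A \<Longrightarrow> b \<in> B \<Longrightarrow> c a b \<in> carrier M"
  shows "finprod M (\<lambda>a. finprod M (c a) B) A = finprod M (\<lambda>b. finprod M (\<lambda>a. c a b) A) B"
proof -
  have "finprod M (\<lambda>(a, b). c a b) (A \<times> B) = finprod M (\<lambda>(b, a). c a b) (B \<times> A)"
    using M.finprod_reindex[of "\<lambda>(b, a). c a b" prod.swap "A \<times> B"] assms(3)
    by (simp add: product_swap case_prod_unfold Pi_iff)
  then show ?thesis using assms by (simp add: finprod_product)
qed

text \<open>
  The reason why consecutive coboundaries compose to zero: the terms of the double product cancel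
  in pairs, the pair \<open>(i, j)\<close> with \<open>i \<le> j\<close> against the pair \<open>(j + 1, i)\<close>, whose sign is opposite.
\<close>

lemma alternating_double_product:
  assumes closed: "\<And>i j. i \<le> n \<Longrightarrow> j < n \<Longrightarrow> c i j \<in> carrier M"
    and sym: "\<And>i j. i \<le> j \<Longrightarrow> j < n \<Longrightarrow> c i j = c (Suc j) i"
  shows "finprod M (\<lambda>i. finprod M (\<lambda>j. c i j [^]\<^bsub>M\<^esub> ((- 1) ^ (i + j) :: int)) {..<n}) {..<Suc n} = \<one>\<^bsub>M\<^esub>"
proof -
  let ?t = "\<lambda>(i, j). c i j [^]\<^bsub>M\<^esub> ((- 1) ^ (i + j) :: int)"
  define A where "A = {(i, j). i \<le> j \<and> j < n}"
  let ?s = "\<lambda>(i, j). (Suc j, i)"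
  have split: "{..<Suc n} \<times> {..<n} = A \<union> ?s ` A"
  proof (intro equalityI subsetI)
    fix p assume "p \<in> {..<Suc n} \<times> {..<n}"
    then obtain i j where p: "p = (i, j)" "i \<le> n" "j < n" by auto
    show "p \<in> A \<union> ?s ` A"
    proof (cases "i \<le> j")
      case True then show ?thesis using p by (simp add: A_def)
    next
      case False
      then have "p = ?s (j, i - 1)" "(j, i - 1) \<in> A" using p by (auto simp: A_def)
      then show ?thesis by blast
    qed
  qed (auto simp: A_def)
  have fin: "finite A" by (rule finite_subset[of _ "{..<Suc n} \<times> {..<n}"]) (auto simp: A_def)
  have disj: "A \<inter> ?s ` A = {}" by (auto simp: A_def)
  have inj: "inj_on ?s A" by (auto simp: inj_on_def)
  have closedA: "?t \<in> A \<rightarrow> carrier M" "?t \<in> ?s ` A \<rightarrow> carrier M"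
    using closed by (auto simp: A_def)
  have "finprod M ?t (?s ` A) = finprod M (\<lambda>p. ?t (?s p)) A"
    by (rule M.finprod_reindex[OF closedA(2) inj])
  also have "\<dots> = finprod M (\<lambda>p. inv\<^bsub>M\<^esub> (?t p)) A"
  proof (rule M.finprod_cong')
    fix p assume "p \<in> A"
    then obtain i j where p: "p = (i, j)" "i \<le> j" "j < n" by (auto simp: A_def)
    have "c i j \<in> carrier M" using closed p by auto
    then show "?t (?s p) = inv\<^bsub>M\<^esub> (?t p)"
      using sym[OF p(2,3)] by (simp add: p(1) M.int_pow_neg add.commute)
  qed (use closedA(1) in \<open>simp_all add: Pi_iff\<close>)
  also have "\<dots> = inv\<^bsub>M\<^esub> (finprod M ?t A)"
    by (rule finprod_inv[symmetric, OF closedA(1)])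
  finally have "finprod M ?t (A \<union> ?s ` A) = \<one>\<^bsub>M\<^esub>"
    using closedA fin disj by (simp add: M.finprod_Un_disjoint)
  then show ?thesis
    using closed by (subst finprod_product) (auto simp: split)
qed

subsection \<open>The coboundary maps\<close>

lemma coboundary_nonneg:
  assumes "q \<ge> 0" "gs \<in> tate_tuples G (q + 1)"
  shows "tate_coboundary G M q f gs =
    finprod M (\<lambda>i. f (take i gs @ drop (Suc i) gs) [^]\<^bsub>M\<^esub> ((- 1) ^ i :: int)) {..<length gs}"
  using assms by (simp add: tate_coboundary_def tate_tuples_def)

lemma omission_in_tuples:
  assumes "q \<ge> 0" "gs \<in> tate_tuples G (q + 1)" "i < length gs"
  shows "take i gs @ drop (Suc i) gs \<in> tate_tuples G q"
  using assms by (auto simp: tate_tuples_def tate_arity_def dest: in_set_takeD in_set_dropD)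

lemma insertion_base_tuple:
  assumes "q < 0" "gs \<in> tate_tuples G (q + 1)"
  shows "set (insertion_base q gs) \<subseteq> carrier G" "Suc (length (insertion_base q gs)) = tate_arity q"
  using assms by (auto simp: tate_tuples_def tate_arity_def insertion_base_def)

lemma coboundary_neg:
  assumes "q < 0" "gs \<in> tate_tuples G (q + 1)" "f \<in> tate_tuples G q \<rightarrow> carrier M"
  shows "tate_coboundary G M q f gs =
    finprod M (\<lambda>\<tau>. finprod M (\<lambda>i. f (take i (insertion_base q gs) @ \<tau> # drop i (insertion_base q gs))
        [^]\<^bsub>M\<^esub> ((- 1) ^ i :: int)) {..<tate_arity q}) (carrier G)"
proof (cases "q = - 1")
  case True
  have "f [\<tau>] \<in> carrier M" if "\<tau> \<in> carrier G" for \<tau>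
    using assms(3) that True by (auto simp: tate_tuples_def tate_arity_def)
  then show ?thesis
    using True assms(2) 
    by (auto simp: tate_coboundary_def insertion_base_def tate_arity_def lessThan_Suc intro!: M.finprod_cong')
next
  case False
  then show ?thesis
    using assms by (auto simp: tate_coboundary_def insertion_base_def)
qed

lemma insertion_in_tuples:
  assumes "q < 0" "gs \<in> tate_tuples G (q + 1)" "\<tau> \<in> carrier G"
  shows "take i (insertion_base q gs) @ \<tau> # drop i (insertion_base q gs) \<in> tate_tuples G q"
  using insertion_base_tuple[OF assms(1,2)] assms(3)
  by (auto simp: tate_tuples_def dest: in_set_takeD in_set_dropD)

lemma finprod_in_subgroup:
  assumes "subgroup S M" "\<And>i. i \<in> I \<Longrightarrow> c i \<in> S"
  shows "finprod M c I \<in> S"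
  using assms(2)
proof (induction I rule: infinite_finite_induct)
  case (insert i I)
  then have "c i \<in> S" "finprod M c I \<in> S" by auto
  moreover have "c \<in> I \<rightarrow> carrier M" "c i \<in> carrier M"
    using insert.prems subgroup.subset[OF assms(1)] by auto
  ultimately show ?case
    using insert.hyps subgroup.m_closed[OF assms(1)] by simp
qed (use subgroup.one_closed[OF assms(1)] in auto)

text \<open>Besides closedness this provides the compatibility of the coboundary with filtrations of the module.\<close>

lemma coboundary_in_subgroup:
  assumes S: "subgroup S M" and f: "\<And>gs. gs \<in> tate_tuples G q \<Longrightarrow> f gs \<in> S"
    and gs: "gs \<in> tate_tuples G (q + 1)"
  shows "tate_coboundary G M q f gs \<in> S"
proof -
  have pow: "x [^]\<^bsub>M\<^esub> ((- 1) ^ i :: int) \<in> S" if "x \<in> S" for x i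
    using that subgroup.mem_carrier[OF S that] subgroup.m_inv_closed[OF S that] by (auto simp: sign_pow)
  have fM: "f \<in> tate_tuples G q \<rightarrow> carrier M"
    using f subgroup.subset[OF S] by auto
  show ?thesis
  proof (cases "q \<ge> 0")
    case True
    then show ?thesis
      using gs omission_in_tuples by (auto simp: coboundary_nonneg intro!: finprod_in_subgroup[OF S] pow f)
  next
    case False
    then show ?thesis
      using gs insertion_in_tuples fM
      by (auto simp: coboundary_neg intro!: finprod_in_subgroup[OF S] pow f)
  qed
qed

lemma coboundary_closed:
  "f \<in> carrier (tate_cochains G M \<phi> q) \<Longrightarrow> gs \<in> tate_tuples G (q + 1)
    \<Longrightarrow> tate_coboundary G M q f gs \<in> carrier M"
  by (rule coboundary_in_subgroup[OF M.subgroup_self]) (auto intro: cochain_closed)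

lemma coboundary_outside: 
  "gs \<notin> tate_tuples G (q + 1) \<Longrightarrow> tate_coboundary G M q f gs = undefined"
  by (simp add: tate_coboundary_def)

lemma coboundary_equivariant:
  assumes f: "f \<in> carrier (tate_cochains G M \<phi> q)" and g: "g \<in> carrier G" and gs: "gs \<in> tate_tuples G (q + 1)"
  shows "tate_coboundary G M q f (map (\<lambda>h. g \<otimes>\<^bsub>G\<^esub> h) gs) = \<phi> g (tate_coboundary G M q f gs)"
proof -
  let ?m = "map (\<lambda>h. g \<otimes>\<^bsub>G\<^esub> h)"
  have gs': "?m gs \<in> tate_tuples G (q + 1)" by (rule tuples_translate[OF g gs])
  show ?thesis
  proof (cases "q \<ge> 0")
    case True
    have f': "f (take i gs @ drop (Suc i) gs) \<in> carrier M" if "i < length gs" for i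
      using omission_in_tuples[OF True gs that] cochain_closed[OF f] by simp
    have "f (take i (?m gs) @ drop (Suc i) (?m gs)) = \<phi> g (f (take i gs @ drop (Suc i) gs))"
      if "i < length gs" for i
      using cochain_equivariant[OF f g omission_in_tuples[OF True gs that]] by (simp add: take_map drop_map)
    then show ?thesis
      using True gs gs' f' act_closed[OF g]
      by (auto simp: coboundary_nonneg act_finprod[OF g] act_int_pow[OF g] Pi_iff intro!: M.finprod_cong')
  next
    case False
    let ?b = "insertion_base q gs" and ?I = "{..<tate_arity q}"
    have q: "q < 0" using False by simp
    have fM: "f \<in> tate_tuples G q \<rightarrow> carrier M" using cochain_closed[OF f] by auto
    have b': "insertion_base q (?m gs) = ?m ?b" by (simp add: insertion_base_def)
    have tup: "take i ?b @ \<tau> # drop i ?b \<in> tate_tuples G q" if "\<tau> \<in> carrier G" for i \<tau>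
      by (rule insertion_in_tuples[OF q gs that])
    have tup': "take i (?m ?b) @ \<tau> # drop i (?m ?b) \<in> tate_tuples G q" if "\<tau> \<in> carrier G" for i \<tau>
      using insertion_in_tuples[OF q gs' that] by (simp add: b')
    note closed = cochain_closed[OF f tup] cochain_closed[OF f tup']
    have eq: "f (take i (?m ?b) @ (g \<otimes>\<^bsub>G\<^esub> \<tau>) # drop i (?m ?b)) = \<phi> g (f (take i ?b @ \<tau> # drop i ?b))"
      if "\<tau> \<in> carrier G" for i \<tau>
      using cochain_equivariant[OF f g tup[OF that, of i]] by (simp add: take_map drop_map)
    have "tate_coboundary G M q f (?m gs) =
        finprod M (\<lambda>\<tau>. finprod M (\<lambda>i. f (take i (?m ?b) @ \<tau> # drop i (?m ?b))
          [^]\<^bsub>M\<^esub> ((- 1) ^ i :: int)) ?I) (carrier G)"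
      using coboundary_neg[OF q gs' fM] by (simp add: b')
    also have "\<dots> = finprod M (\<lambda>\<tau>. finprod M (\<lambda>i. f (take i (?m ?b) @ (g \<otimes>\<^bsub>G\<^esub> \<tau>) # drop i (?m ?b))
          [^]\<^bsub>M\<^esub> ((- 1) ^ i :: int)) ?I) (carrier G)"
      using closed by (intro finprod_translate[OF g, symmetric]) (auto intro!: M.finprod_closed)
    also have "\<dots> = finprod M (\<lambda>\<tau>. \<phi> g (finprod M (\<lambda>i. f (take i ?b @ \<tau> # drop i ?b)
          [^]\<^bsub>M\<^esub> ((- 1) ^ i :: int)) ?I)) (carrier G)"
    proof (rule M.finprod_cong')
      fix \<tau> assume \<tau>: "\<tau> \<in> carrier G"
      have "\<phi> g (finprod M (\<lambda>i. f (take i ?b @ \<tau> # drop i ?b) [^]\<^bsub>M\<^esub> ((- 1) ^ i :: int)) ?I)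
         = finprod M (\<lambda>i. \<phi> g (f (take i ?b @ \<tau> # drop i ?b) [^]\<^bsub>M\<^esub> ((- 1) ^ i :: int))) ?I"
        using closed \<tau> by (intro act_finprod[OF g]) auto
      then show "finprod M (\<lambda>i. f (take i (?m ?b) @ (g \<otimes>\<^bsub>G\<^esub> \<tau>) # drop i (?m ?b))
          [^]\<^bsub>M\<^esub> ((- 1) ^ i :: int)) ?I
        = \<phi> g (finprod M (\<lambda>i. f (take i ?b @ \<tau> # drop i ?b) [^]\<^bsub>M\<^esub> ((- 1) ^ i :: int)) ?I)"
        by (simp add: eq[OF \<tau>] act_int_pow[OF g] closed \<tau>)
    qed (use closed act_closed[OF g] in \<open>auto intro!: M.finprod_closed\<close>)
    also have "\<dots> = \<phi> g (tate_coboundary G M q f gs)"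
      using closed by (subst act_finprod[OF g, symmetric]) 
        (auto simp: coboundary_neg[OF q gs fM] intro!: M.finprod_closed)
    finally show ?thesis .
  qed
qed

lemma coboundary_cochain:
  assumes f: "f \<in> carrier (tate_cochains G M \<phi> q)"
  shows "tate_coboundary G M q f \<in> carrier (tate_cochains G M \<phi> (q + 1))"
proof -
  have "restrict (tate_coboundary G M q f) (tate_tuples G (q + 1)) = tate_coboundary G M q f"
    by (simp add: tate_coboundary_def)
  then show ?thesis
    using cochainI[of "q + 1" "tate_coboundary G M q f"] coboundary_closed[OF f] coboundary_equivariant[OF f]
    by simp
qed

lemma coboundary_mult:
  assumes f: "f \<in> carrier (tate_cochains G M \<phi> q)" "f' \<in> carrier (tate_cochains G M \<phi> q)"
    and gs: "gs \<in> tate_tuples G (q + 1)"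
  shows "tate_coboundary G M q (f \<otimes>\<^bsub>tate_cochains G M \<phi> q\<^esub> f') gs
    = tate_coboundary G M q f gs \<otimes>\<^bsub>M\<^esub> tate_coboundary G M q f' gs"
proof -
  interpret C: comm_group "tate_cochains G M \<phi> q" by (rule comm_group_cochains)
  note closed = cochain_closed[OF f(1)] cochain_closed[OF f(2)]
  have fM: "h \<in> tate_tuples G q \<rightarrow> carrier M" if "h \<in> carrier (tate_cochains G M \<phi> q)" for h 
    using cochain_closed[OF that] by auto
  show ?thesis
  proof (cases "q \<ge> 0")
    case True
    have "finprod M (\<lambda>i. (f \<otimes>\<^bsub>tate_cochains G M \<phi> q\<^esub> f') (take i gs @ drop (Suc i) gs)
          [^]\<^bsub>M\<^esub> ((- 1) ^ i :: int)) {..<length gs}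
      = finprod M (\<lambda>i. f (take i gs @ drop (Suc i) gs) [^]\<^bsub>M\<^esub> ((- 1) ^ i :: int)
          \<otimes>\<^bsub>M\<^esub> f' (take i gs @ drop (Suc i) gs) [^]\<^bsub>M\<^esub> ((- 1) ^ i :: int)) {..<length gs}"
      using omission_in_tuples[OF True gs]
      by (intro M.finprod_cong') (auto simp: cochain_mult closed M.int_pow_distrib)
    then show ?thesis
      using omission_in_tuples[OF True gs]
      by (simp add: coboundary_nonneg[OF True gs] M.finprod_multf closed Pi_iff)
  next
    case False
    then have q: "q < 0" by simp
    let ?b = "insertion_base q gs" and ?I = "{..<tate_arity q}"
    note tup = insertion_in_tuples[OF q gs]
    let ?t = "\<lambda>h \<tau> i. h (take i ?b @ \<tau> # drop i ?b) [^]\<^bsub>M\<^esub> ((- 1) ^ i :: int)"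
    have t: "?t h \<tau> i \<in> carrier M" if "h \<in> carrier (tate_cochains G M \<phi> q)" "\<tau> \<in> carrier G" for h \<tau> i
      using cochain_closed[OF that(1) tup[OF that(2)]] by simp
    have inner: "finprod M (?t (f \<otimes>\<^bsub>tate_cochains G M \<phi> q\<^esub> f') \<tau>) ?I
      = finprod M (?t f \<tau>) ?I \<otimes>\<^bsub>M\<^esub> finprod M (?t f' \<tau>) ?I" if \<tau>: "\<tau> \<in> carrier G" for \<tau>
    proof -
      have "?t (f \<otimes>\<^bsub>tate_cochains G M \<phi> q\<^esub> f') \<tau> i = ?t f \<tau> i \<otimes>\<^bsub>M\<^esub> ?t f' \<tau> i" for i
        using tup[OF \<tau>] by (simp add: cochain_mult closed M.int_pow_distrib)
      then show ?thesis using t f \<tau> by (simp add: M.finprod_multf)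
    qed
    have "finprod M (\<lambda>\<tau>. finprod M (?t (f \<otimes>\<^bsub>tate_cochains G M \<phi> q\<^esub> f') \<tau>) ?I) (carrier G)
      = finprod M (\<lambda>\<tau>. finprod M (?t f \<tau>) ?I \<otimes>\<^bsub>M\<^esub> finprod M (?t f' \<tau>) ?I) (carrier G)"
      using inner t f by (intro M.finprod_cong') auto
    also have "\<dots> = finprod M (\<lambda>\<tau>. finprod M (?t f \<tau>) ?I) (carrier G)
        \<otimes>\<^bsub>M\<^esub> finprod M (\<lambda>\<tau>. finprod M (?t f' \<tau>) ?I) (carrier G)"
      using t f by (intro M.finprod_multf) (auto intro!: M.finprod_closed)
    finally show ?thesis
      using f by (simp add: coboundary_neg[OF q gs fM])
  qed
qed

lemma coboundary_hom:
  "tate_coboundary G M q \<in> hom (tate_cochains G M \<phi> q) (tate_cochains G M \<phi> (q + 1))"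
proof (rule homI)
  interpret C: comm_group "tate_cochains G M \<phi> q" by (rule comm_group_cochains)
  interpret C': comm_group "tate_cochains G M \<phi> (q + 1)" by (rule comm_group_cochains)
  fix f f' assume f: "f \<in> carrier (tate_cochains G M \<phi> q)" "f' \<in> carrier (tate_cochains G M \<phi> q)"
  show "tate_coboundary G M q (f \<otimes>\<^bsub>tate_cochains G M \<phi> q\<^esub> f')
    = tate_coboundary G M q f \<otimes>\<^bsub>tate_cochains G M \<phi> (q + 1)\<^esub> tate_coboundary G M q f'"
    using f by (intro cochain_eqI[of _ "q + 1"]) 
      (auto simp: coboundary_mult cochain_mult intro!: coboundary_cochain C'.m_closed)
qed (rule coboundary_cochain)

subsection \<open>Consecutive coboundaries compose to zero\<close>

lemma coboundary_coboundary_nonneg: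
  assumes q: "q \<ge> 0" and f: "f \<in> carrier (tate_cochains G M \<phi> q)" and gs: "gs \<in> tate_tuples G (q + 1 + 1)"
  shows "tate_coboundary G M (q + 1) (tate_coboundary G M q f) gs = \<one>\<^bsub>M\<^esub>"
proof -
  define om where "om = (\<lambda>i (xs :: 'a list). take i xs @ drop (Suc i) xs)"
  define n where "n = nat q + 1"
  have len: "length gs = Suc (Suc (nat q + 1))" 
    using gs q by (simp add: tate_tuples_def tate_arity_def nat_add_distrib)
  have om1: "om i gs \<in> tate_tuples G (q + 1)" if "i < length gs" for i
    using omission_in_tuples[of "q + 1" gs i] gs q that by (simp add: om_def)
  have om2: "om j (om i gs) \<in> tate_tuples G q" "length (om i gs) = Suc n" if "i \<le> Suc n" "j < Suc n" for i j
    using omission_in_tuples[OF q om1[of i], of j] that len by (auto simp: om_def n_def)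
  have om_om: "om j (om i gs) = om i (om (Suc j) gs)" if "i \<le> j" "j < Suc n" for i j
    using that len by (auto simp: om_def n_def list_eq_iff_nth_eq nth_append min_def)
  let ?c = "\<lambda>i j. f (om j (om i gs))"
  have c: "?c i j \<in> carrier M" if "i \<le> Suc n" "j < Suc n" for i j
    using cochain_closed[OF f om2(1)[OF that]] .
  have "tate_coboundary G M (q + 1) (tate_coboundary G M q f) gs
      = finprod M (\<lambda>i. tate_coboundary G M q f (om i gs) [^]\<^bsub>M\<^esub> ((- 1) ^ i :: int)) {..<Suc (Suc n)}"
    using coboundary_nonneg[of "q + 1" gs] q gs len by (simp add: om_def n_def)
  also have "\<dots> = finprod M (\<lambda>i. finprod M (\<lambda>j. ?c i j [^]\<^bsub>M\<^esub> ((- 1) ^ (i + j) :: int)) {..<Suc n}) {..<Suc (Suc n)}"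
  proof (rule M.finprod_cong')
    fix i assume i: "i \<in> {..<Suc (Suc n)}"
    have "tate_coboundary G M q f (om i gs) = finprod M (\<lambda>j. ?c i j [^]\<^bsub>M\<^esub> ((- 1) ^ j :: int)) {..<Suc n}"
      using coboundary_nonneg[OF q om1[of i]] om2(2)[of i 0] i len by (simp add: om_def n_def)
    also have "\<dots> [^]\<^bsub>M\<^esub> ((- 1) ^ i :: int) 
        = finprod M (\<lambda>j. (?c i j [^]\<^bsub>M\<^esub> ((- 1) ^ j :: int)) [^]\<^bsub>M\<^esub> ((- 1) ^ i :: int)) {..<Suc n}"
      using c i by (intro finprod_int_pow) auto
    also have "\<dots> = finprod M (\<lambda>j. ?c i j [^]\<^bsub>M\<^esub> ((- 1) ^ (i + j) :: int)) {..<Suc n}"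
      using c i by (intro M.finprod_cong') (auto simp: M.int_pow_pow power_add mult.commute)
    finally show "tate_coboundary G M q f (om i gs) [^]\<^bsub>M\<^esub> ((- 1) ^ i :: int) = \<dots>" .
  qed (use c in \<open>auto intro!: M.finprod_closed\<close>)
  also have "\<dots> = \<one>\<^bsub>M\<^esub>"
    by (rule alternating_double_product[of "Suc n" ?c]) (use c om_om in auto)
  finally show ?thesis .
qed

lemma coboundary_coboundary_norm:
  assumes f: "f \<in> carrier (tate_cochains G M \<phi> (- 1))" and gs: "gs \<in> tate_tuples G 1"
  shows "tate_coboundary G M 0 (tate_coboundary G M (- 1) f) gs = \<one>\<^bsub>M\<^esub>"
proof -
  obtain a b where ab: "gs = [a, b]" "a \<in> carrier G" "b \<in> carrier G"
    using gs by (auto simp: tate_tuples_def tate_arity_def length_Suc_conv numeral_2_eq_2)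
  have single: "[g] \<in> tate_tuples G 0" if "g \<in> carrier G" for g
    using that by (simp add: tate_tuples_def tate_arity_def)
  have eq: "tate_coboundary G M (- 1) f [a] = tate_coboundary G M (- 1) f [b]"
    using single ab by (simp add: tate_coboundary_def)
  have "tate_coboundary G M (- 1) f [b] \<in> carrier M"
    using coboundary_closed[OF f, of "[b]"] single ab by simp
  then show ?thesis
    using gs ab by (simp add: coboundary_nonneg lessThan_Suc eq M.int_pow_neg numeral_2_eq_2)
qed

lemma coboundary_coboundary_neg:
  assumes q: "q < - 1" and f: "f \<in> carrier (tate_cochains G M \<phi> q)" and gs: "gs \<in> tate_tuples G (q + 1 + 1)"
  shows "tate_coboundary G M (q + 1) (tate_coboundary G M q f) gs = \<one>\<^bsub>M\<^esub>"
proof -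
  define ins where "ins = (\<lambda>i \<tau> (xs :: 'a list). take i xs @ \<tau> # drop i xs)"
  define b where "b = insertion_base (q + 1) gs"
  define n where "n = Suc (length b)"
  have q': "q < 0" "q + 1 < 0" using q by auto
  have arity: "tate_arity (q + 1) = n" "tate_arity q = Suc n"
    using insertion_base_tuple(2)[OF q'(2) gs] q by (auto simp: b_def n_def tate_arity_def)
  have fM: "f \<in> tate_tuples G q \<rightarrow> carrier M" using cochain_closed[OF f] by auto
  have dM: "tate_coboundary G M q f \<in> tate_tuples G (q + 1) \<rightarrow> carrier M" 
    using coboundary_closed[OF f] by auto
  have ins1: "ins i \<sigma> b \<in> tate_tuples G (q + 1)" if "\<sigma> \<in> carrier G" for i \<sigma>
    using insertion_in_tuples[OF q'(2) gs that] by (simp add: ins_def b_def)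
  have base: "insertion_base q xs = xs" for xs :: "'a list"
    using q by (simp add: insertion_base_def)
  have ins2: "ins j \<tau> (ins i \<sigma> b) \<in> tate_tuples G q" if "\<sigma> \<in> carrier G" "\<tau> \<in> carrier G" for i j \<sigma> \<tau>
    using insertion_in_tuples[OF q'(1) ins1[OF that(1)] that(2)] by (simp add: ins_def base)
  have ins_ins: "ins j \<tau> (ins i \<sigma> b) = ins (Suc i) \<sigma> (ins j \<tau> b)" if "j \<le> i" "i < n" for i j \<sigma> \<tau>
  proof -
    define x y z where "x = take j b" and "y = drop j (take i b)" and "z = drop i b"
    have len: "length x = j" "length y = i - j" using that by (auto simp: x_def y_def n_def)
    have "take i b = x @ y"
      using that by (metis append_take_drop_id min.absorb1 take_take x_def y_def)
    then have "b = x @ y @ z" by (metis append.assoc append_take_drop_id z_def)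
    then show ?thesis using len that by (simp add: ins_def Suc_diff_le)
  qed
  let ?G = "carrier G"
  let ?f = "\<lambda>\<sigma> \<tau> i j. f (ins j \<tau> (ins i \<sigma> b))"
  let ?t = "\<lambda>\<sigma> \<tau> i j. ?f \<sigma> \<tau> i j [^]\<^bsub>M\<^esub> ((- 1) ^ (i + j) :: int)"
  have c: "?f \<sigma> \<tau> i j \<in> carrier M" if "\<sigma> \<in> ?G" "\<tau> \<in> ?G" for \<sigma> \<tau> i j
    using cochain_closed[OF f ins2[OF that]] .
  let ?C = "\<lambda>j i. finprod M (\<lambda>\<sigma>. finprod M (\<lambda>\<tau>. ?f \<sigma> \<tau> i j) ?G) ?G"
  have C: "?C j i \<in> carrier M" for i j
    using c by (auto intro!: M.finprod_closed)
  have "tate_coboundary G M (q + 1) (tate_coboundary G M q f) gs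
      = finprod M (\<lambda>\<sigma>. finprod M (\<lambda>i. tate_coboundary G M q f (ins i \<sigma> b) [^]\<^bsub>M\<^esub> ((- 1) ^ i :: int)) {..<n}) ?G"
    using coboundary_neg[OF q'(2) gs dM] by (simp add: ins_def b_def arity)
  also have "\<dots> = finprod M (\<lambda>\<sigma>. finprod M (\<lambda>i. finprod M (\<lambda>\<tau>. finprod M (\<lambda>j. ?t \<sigma> \<tau> i j) {..<Suc n}) ?G) {..<n}) ?G"
  proof (intro M.finprod_cong')
    fix \<sigma> i assume \<sigma>: "\<sigma> \<in> ?G" and i: "i \<in> {..<n}"
    have "tate_coboundary G M q f (ins i \<sigma> b) [^]\<^bsub>M\<^esub> ((- 1) ^ i :: int)
      = finprod M (\<lambda>\<tau>. finprod M (\<lambda>j. ?f \<sigma> \<tau> i j [^]\<^bsub>M\<^esub> ((- 1) ^ j :: int)) {..<Suc n}) ?G [^]\<^bsub>M\<^esub> ((- 1) ^ i :: int)"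
      using coboundary_neg[OF q'(1) ins1[OF \<sigma>] fM] by (simp add: ins_def base arity)
    also have "\<dots> = finprod M (\<lambda>\<tau>. finprod M (\<lambda>j. ?f \<sigma> \<tau> i j [^]\<^bsub>M\<^esub> ((- 1) ^ j :: int)) {..<Suc n} [^]\<^bsub>M\<^esub> ((- 1) ^ i :: int)) ?G"
      using c \<sigma> by (intro finprod_int_pow) (auto intro!: M.finprod_closed)
    also have "\<dots> = finprod M (\<lambda>\<tau>. finprod M (\<lambda>j. (?f \<sigma> \<tau> i j [^]\<^bsub>M\<^esub> ((- 1) ^ j :: int)) [^]\<^bsub>M\<^esub> ((- 1) ^ i :: int)) {..<Suc n}) ?G"
      using c \<sigma> by (intro M.finprod_cong' finprod_int_pow refl) (auto intro!: M.finprod_closed)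
    also have "\<dots> = finprod M (\<lambda>\<tau>. finprod M (\<lambda>j. ?t \<sigma> \<tau> i j) {..<Suc n}) ?G"
      using c \<sigma> by (intro M.finprod_cong' refl) 
        (auto simp: M.int_pow_pow power_add mult.commute intro!: M.finprod_closed)
    finally show "tate_coboundary G M q f (ins i \<sigma> b) [^]\<^bsub>M\<^esub> ((- 1) ^ i :: int) = \<dots>" .
  qed (use c in \<open>auto intro!: M.finprod_closed\<close>)
  also have "\<dots> = finprod M (\<lambda>\<sigma>. finprod M (\<lambda>\<tau>. finprod M (\<lambda>i. finprod M (\<lambda>j. ?t \<sigma> \<tau> i j) {..<Suc n}) {..<n}) ?G) ?G"
    using c by (intro M.finprod_cong' finprod_swap refl finite_G) (auto intro!: M.finprod_closed)
  also have "\<dots> = finprod M (\<lambda>\<sigma>. finprod M (\<lambda>\<tau>. finprod M (\<lambda>j. finprod M (\<lambda>i. ?t \<sigma> \<tau> i j) {..<n}) {..<Suc n}) ?G) ?G"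
    using c by (intro M.finprod_cong' finprod_swap refl finite_G) (auto intro!: M.finprod_closed)
  also have "\<dots> = finprod M (\<lambda>\<sigma>. finprod M (\<lambda>j. finprod M (\<lambda>\<tau>. finprod M (\<lambda>i. ?t \<sigma> \<tau> i j) {..<n}) ?G) {..<Suc n}) ?G"
    using c by (intro M.finprod_cong' finprod_swap refl finite_G) (auto intro!: M.finprod_closed)
  also have "\<dots> = finprod M (\<lambda>\<sigma>. finprod M (\<lambda>j. finprod M (\<lambda>i. finprod M (\<lambda>\<tau>. ?t \<sigma> \<tau> i j) ?G) {..<n}) {..<Suc n}) ?G"
    using c by (intro M.finprod_cong' finprod_swap refl finite_G) (auto intro!: M.finprod_closed)
  also have "\<dots> = finprod M (\<lambda>j. finprod M (\<lambda>\<sigma>. finprod M (\<lambda>i. finprod M (\<lambda>\<tau>. ?t \<sigma> \<tau> i j) ?G) {..<n}) ?G) {..<Suc n}"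
    using c by (intro finprod_swap finite_G) (auto intro!: M.finprod_closed)
  also have "\<dots> = finprod M (\<lambda>j. finprod M (\<lambda>i. finprod M (\<lambda>\<sigma>. finprod M (\<lambda>\<tau>. ?t \<sigma> \<tau> i j) ?G) ?G) {..<n}) {..<Suc n}"
    using c by (intro M.finprod_cong' finprod_swap refl finite_G) (auto intro!: M.finprod_closed)
  also have "\<dots> = finprod M (\<lambda>j. finprod M (\<lambda>i. ?C j i [^]\<^bsub>M\<^esub> ((- 1) ^ (j + i) :: int)) {..<n}) {..<Suc n}"
  proof (intro M.finprod_cong' refl)
    fix i j
    have "?C j i [^]\<^bsub>M\<^esub> ((- 1) ^ (j + i) :: int) = finprod M (\<lambda>\<sigma>. finprod M (\<lambda>\<tau>. ?f \<sigma> \<tau> i j) ?G [^]\<^bsub>M\<^esub> ((- 1) ^ (j + i) :: int)) ?G"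
      using c by (intro finprod_int_pow) (auto intro!: M.finprod_closed)
    also have "\<dots> = finprod M (\<lambda>\<sigma>. finprod M (\<lambda>\<tau>. ?f \<sigma> \<tau> i j [^]\<^bsub>M\<^esub> ((- 1) ^ (j + i) :: int)) ?G) ?G"
      using c by (intro M.finprod_cong' finprod_int_pow refl) (auto intro!: M.finprod_closed)
    finally show "finprod M (\<lambda>\<sigma>. finprod M (\<lambda>\<tau>. ?t \<sigma> \<tau> i j) ?G) ?G = ?C j i [^]\<^bsub>M\<^esub> ((- 1) ^ (j + i) :: int)"
      by (simp add: add.commute)
  qed (use C in \<open>auto intro!: M.finprod_closed M.int_pow_closed\<close>)
  also have "\<dots> = \<one>\<^bsub>M\<^esub>"
  proof (rule alternating_double_product[of n ?C])
    fix j i assume ij: "j \<le> i" "i < n"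
    \<comment> \<open>Exchanging the two insertions exchanges the roles of the two group elements summed over.\<close>
    have "?C j i = finprod M (\<lambda>\<sigma>. finprod M (\<lambda>\<tau>. ?f \<tau> \<sigma> j (Suc i)) ?G) ?G"
      using ins_ins[OF ij] by simp
    also have "\<dots> = ?C (Suc i) j"
      using c by (intro finprod_swap finite_G) auto
    finally show "?C j i = ?C (Suc i) j" .
  qed (use C in auto)
  finally show ?thesis .
qed

lemma coboundary_coboundary:
  assumes "f \<in> carrier (tate_cochains G M \<phi> q)"
  shows "tate_coboundary G M (q + 1) (tate_coboundary G M q f) = \<one>\<^bsub>tate_cochains G M \<phi> (q + 1 + 1)\<^esub>"
proof (rule ext)
  fix gs
  show "tate_coboundary G M (q + 1) (tate_coboundary G M q f) gs = \<one>\<^bsub>tate_cochains G M \<phi> (q + 1 + 1)\<^esub> gs"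
  proof (cases "gs \<in> tate_tuples G (q + 1 + 1)")
    case True
    consider "q \<ge> 0" | "q = - 1" | "q < - 1" by linarith
    then have "tate_coboundary G M (q + 1) (tate_coboundary G M q f) gs = \<one>\<^bsub>M\<^esub>"
    proof cases
      case 1 then show ?thesis using coboundary_coboundary_nonneg assms True by blast
    next
      case 2 then show ?thesis using coboundary_coboundary_norm[of f gs] assms True by simp
    next
      case 3 then show ?thesis using coboundary_coboundary_neg assms True by blast
    qed
    then show ?thesis using True by (simp add: cochain_one)
  next
    case False
    then show ?thesis by (simp add: coboundary_outside tate_cochains_def)
  qed
qed

lemma group_hom_coboundary:
  "group_hom (tate_cochains G M \<phi> q) (tate_cochains G M \<phi> (q + 1)) (tate_coboundary G M q)"
  using comm_group_cochains coboundary_hom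
  by (simp add: group_hom_def group_hom_axioms_def comm_group_def)

text \<open>Coboundaries being cocycles, the hypothesis makes the cohomology group the quotient of a group by itself.\<close>

lemma trivial_cohomologyI:
  assumes "\<And>f. f \<in> carrier (tate_cochains G M \<phi> q) \<Longrightarrow>
      tate_coboundary G M q f = \<one>\<^bsub>tate_cochains G M \<phi> (q + 1)\<^esub> \<Longrightarrow>
      \<exists>b\<in>carrier (tate_cochains G M \<phi> (q - 1)). f = tate_coboundary G M (q - 1) b"
  shows "trivial_group (tate_cohomology G M \<phi> q)"
proof -
  let ?C = "tate_cochains G M \<phi>" and ?d = "tate_coboundary G M"
  interpret d: group_hom "?C q" "?C (q + 1)" "?d q" by (rule group_hom_coboundary)
  let ?Z = "kernel (?C q) (?C (q + 1)) (?d q)"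
  let ?A = "?C q\<lparr>carrier := ?Z\<rparr>"
  have "?d (q - 1) ` carrier (?C (q - 1)) = ?Z"
  proof (intro equalityI subsetI)
    fix f assume "f \<in> ?d (q - 1) ` carrier (?C (q - 1))"
    then show "f \<in> ?Z"
      using coboundary_cochain[of _ "q - 1"] coboundary_coboundary[of _ "q - 1"] by (auto simp: kernel_def)
  qed (use assms in \<open>auto simp: kernel_def\<close>)
  then have eq: "tate_cohomology G M \<phi> q = ?A Mod carrier ?A"
    by (simp add: tate_cohomology_def)
  interpret A: group ?A
    by (rule d.G.subgroup_imp_group[OF d.subgroup_kernel])
  have "(\<lambda>Y. the_elem ((\<lambda>x. \<one>\<^bsub>?A\<^esub>) ` Y)) \<in> iso (?A Mod carrier ?A) (?A\<lparr>carrier := {\<one>\<^bsub>?A\<^esub>}\<rparr>)"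
    by (rule A.self_factor_iso)
  then have "?A Mod carrier ?A \<cong> ?A\<lparr>carrier := {\<one>\<^bsub>?A\<^esub>}\<rparr>"
    by (rule is_isoI)
  moreover have "trivial_group (?A\<lparr>carrier := {\<one>\<^bsub>?A\<^esub>}\<rparr>)"
    using A.subgroup_imp_group[OF A.triv_subgroup] by (simp add: trivial_group_def)
  moreover have "group (?A Mod carrier ?A)"
    by (intro normal.factorgroup_is_group A.normal_invI A.subgroup_self A.m_closed A.inv_closed)
  ultimately show ?thesis
    unfolding eq using isomorphic_group_triviality by (metis trivial_group_def)
qed

text \<open>
  Successive approximation: in a module that is complete for a filtration by submodules, a cocycle
  is a coboundary as soon as every cocycle with values in a step of the filtration agrees, up to
  the next step, with the coboundary of a cochain with values in the same step. The corrections
  converge because they lie in smaller and smaller steps.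
\<close>

lemma trivial_cohomology_by_approximation:
  fixes Fil :: "nat \<Rightarrow> 'c set"
  assumes sub: "\<And>k. subgroup (Fil k) M"
    and Fil0: "Fil 0 = carrier M"
    and stable: "\<And>g k x. g \<in> carrier G \<Longrightarrow> x \<in> Fil k \<Longrightarrow> \<phi> g x \<in> Fil k"
    and separated: "\<And>x. (\<And>k. x \<in> Fil k) \<Longrightarrow> x = \<one>\<^bsub>M\<^esub>"
    and complete: "\<And>s. (\<And>k. s k \<in> carrier M) \<Longrightarrow> (\<And>k. s (Suc k) \<otimes>\<^bsub>M\<^esub> inv\<^bsub>M\<^esub> s k \<in> Fil k)
      \<Longrightarrow> \<exists>x\<in>carrier M. \<forall>k. x \<otimes>\<^bsub>M\<^esub> inv\<^bsub>M\<^esub> s k \<in> Fil k"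
    and approx: "\<And>k f. f \<in> carrier (tate_cochains G M \<phi> q) \<Longrightarrow>
      tate_coboundary G M q f = \<one>\<^bsub>tate_cochains G M \<phi> (q + 1)\<^esub> \<Longrightarrow>
      (\<And>gs. gs \<in> tate_tuples G q \<Longrightarrow> f gs \<in> Fil k) \<Longrightarrow>
      \<exists>b\<in>carrier (tate_cochains G M \<phi> (q - 1)). (\<forall>gs\<in>tate_tuples G (q - 1). b gs \<in> Fil k) \<and>
        (\<forall>gs\<in>tate_tuples G q. f gs \<otimes>\<^bsub>M\<^esub> inv\<^bsub>M\<^esub> tate_coboundary G M (q - 1) b gs \<in> Fil (Suc k))"
  shows "trivial_group (tate_cohomology G M \<phi> q)"
proof (rule trivial_cohomologyI)
  let ?C = "tate_cochains G M \<phi>" and ?d = "tate_coboundary G M" and ?T = "tate_tuples G"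
  fix f assume f: "f \<in> carrier (?C q)" and cocycle: "?d q f = \<one>\<^bsub>?C (q + 1)\<^esub>"
  interpret d: group_hom "?C q" "?C (q + 1)" "?d q" by (rule group_hom_coboundary)
  interpret d': group_hom "?C (q - 1)" "?C q" "?d (q - 1)" 
    using group_hom_coboundary[of "q - 1"] by simp
  have FilM: "x \<in> carrier M" if "x \<in> Fil k" for x k
    using that subgroup.subset[OF sub] by auto
  define P where "P = (\<lambda>k B. B \<in> carrier (?C (q - 1)) \<and> (\<forall>gs\<in>?T q. f gs \<otimes>\<^bsub>M\<^esub> inv\<^bsub>M\<^esub> ?d (q - 1) B gs \<in> Fil k))"
  define Q where "Q = (\<lambda>k B B'. \<forall>gs\<in>?T (q - 1). B' gs \<otimes>\<^bsub>M\<^esub> inv\<^bsub>M\<^esub> B gs \<in> Fil k)"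
  have dM: "?d (q - 1) B gs \<in> carrier M" if "B \<in> carrier (?C (q - 1))" "gs \<in> ?T q" for B gs
    using coboundary_closed[OF that(1), of gs] that(2) by simp
  have "\<exists>B. \<forall>k. P k (B k) \<and> Q k (B k) (B (Suc k))"
  proof (rule dependent_nat_choice)
    have "\<one>\<^bsub>?C (q - 1)\<^esub> \<in> carrier (?C (q - 1))" by simp
    moreover have "f gs \<otimes>\<^bsub>M\<^esub> inv\<^bsub>M\<^esub> ?d (q - 1) \<one>\<^bsub>?C (q - 1)\<^esub> gs \<in> carrier M" if "gs \<in> ?T q" for gs
      using dM[OF calculation that] cochain_closed[OF f that] by simp
    ultimately show "\<exists>B. P 0 B"
      unfolding P_def Fil0 by blast
  next
    fix B k assume B: "P k B"
    then have B': "B \<in> carrier (?C (q - 1))" by (simp add: P_def)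
    define r where "r = f \<otimes>\<^bsub>?C q\<^esub> inv\<^bsub>?C q\<^esub> ?d (q - 1) B"
    have dB: "?d (q - 1) B \<in> carrier (?C q)" using B' by simp
    have r: "r \<in> carrier (?C q)" using f dB by (simp add: r_def)
    have "?d q (?d (q - 1) B) = \<one>\<^bsub>?C (q + 1)\<^esub>"
      using coboundary_coboundary[OF B'] by simp
    then have "?d q r = \<one>\<^bsub>?C (q + 1)\<^esub>"
      using f dB cocycle by (simp add: r_def)
    moreover have r_eq: "r gs = f gs \<otimes>\<^bsub>M\<^esub> inv\<^bsub>M\<^esub> ?d (q - 1) B gs" if "gs \<in> ?T q" for gs
      using that dB by (simp add: r_def cochain_mult cochain_inv)
    ultimately obtain b where b: "b \<in> carrier (?C (q - 1))" "\<forall>gs\<in>?T (q - 1). b gs \<in> Fil k"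
      "\<forall>gs\<in>?T q. r gs \<otimes>\<^bsub>M\<^esub> inv\<^bsub>M\<^esub> ?d (q - 1) b gs \<in> Fil (Suc k)"
      using approx[OF r, of k] B by (auto simp: P_def)
    have "P (Suc k) (b \<otimes>\<^bsub>?C (q - 1)\<^esub> B)"
    proof -
      have "f gs \<otimes>\<^bsub>M\<^esub> inv\<^bsub>M\<^esub> ?d (q - 1) (b \<otimes>\<^bsub>?C (q - 1)\<^esub> B) gs \<in> Fil (Suc k)" if gs: "gs \<in> ?T q" for gs
      proof -
        have "f gs \<otimes>\<^bsub>M\<^esub> inv\<^bsub>M\<^esub> ?d (q - 1) (b \<otimes>\<^bsub>?C (q - 1)\<^esub> B) gs
          = r gs \<otimes>\<^bsub>M\<^esub> inv\<^bsub>M\<^esub> ?d (q - 1) b gs"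
          using coboundary_mult[OF b(1) B', of gs] gs dM[OF b(1) gs] dM[OF B' gs] cochain_closed[OF f gs]
          by (simp add: r_eq M.inv_mult M.m_ac)
        then show ?thesis using b(3) gs by simp
      qed
      then show ?thesis using b(1) B' by (simp add: P_def)
    qed
    moreover have "Q k B (b \<otimes>\<^bsub>?C (q - 1)\<^esub> B)"
      using b(1,2) B' cochain_closed by (auto simp: Q_def cochain_mult M.m_assoc)
    ultimately show "\<exists>B'. P (Suc k) B' \<and> Q k B B'" by blast
  qed
  then obtain B where B: "\<And>k. B k \<in> carrier (?C (q - 1))"
    and fB: "\<And>k gs. gs \<in> ?T q \<Longrightarrow> f gs \<otimes>\<^bsub>M\<^esub> inv\<^bsub>M\<^esub> ?d (q - 1) (B k) gs \<in> Fil k"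
    and BB: "\<And>k gs. gs \<in> ?T (q - 1) \<Longrightarrow> B (Suc k) gs \<otimes>\<^bsub>M\<^esub> inv\<^bsub>M\<^esub> B k gs \<in> Fil k"
    unfolding P_def Q_def by metis
  have "\<exists>x\<in>carrier M. \<forall>k. x \<otimes>\<^bsub>M\<^esub> inv\<^bsub>M\<^esub> B k gs \<in> Fil k" if "gs \<in> ?T (q - 1)" for gs
    using complete[of "\<lambda>k. B k gs"] cochain_closed[OF B] BB that by blast
  then obtain b0 where b0: "\<And>gs. gs \<in> ?T (q - 1) \<Longrightarrow> b0 gs \<in> carrier M"
    "\<And>gs k. gs \<in> ?T (q - 1) \<Longrightarrow> b0 gs \<otimes>\<^bsub>M\<^esub> inv\<^bsub>M\<^esub> B k gs \<in> Fil k"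
    by metis
  have unique: "x = y" if "x \<in> carrier M" "y \<in> carrier M" "\<And>k. z k \<in> carrier M"
    "\<And>k. x \<otimes>\<^bsub>M\<^esub> inv\<^bsub>M\<^esub> z k \<in> Fil k" "\<And>k. y \<otimes>\<^bsub>M\<^esub> inv\<^bsub>M\<^esub> z k \<in> Fil k" for x y z
  proof -
    have "x \<otimes>\<^bsub>M\<^esub> inv\<^bsub>M\<^esub> y \<in> Fil k" for k
    proof -
      have "(x \<otimes>\<^bsub>M\<^esub> inv\<^bsub>M\<^esub> z k) \<otimes>\<^bsub>M\<^esub> inv\<^bsub>M\<^esub> (y \<otimes>\<^bsub>M\<^esub> inv\<^bsub>M\<^esub> z k) \<in> Fil k"
        using that subgroup.m_closed[OF sub] subgroup.m_inv_closed[OF sub] by blast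
      also have "(x \<otimes>\<^bsub>M\<^esub> inv\<^bsub>M\<^esub> z k) \<otimes>\<^bsub>M\<^esub> inv\<^bsub>M\<^esub> (y \<otimes>\<^bsub>M\<^esub> inv\<^bsub>M\<^esub> z k) = x \<otimes>\<^bsub>M\<^esub> inv\<^bsub>M\<^esub> y"
        using that(1-3) by (simp add: M.inv_mult_group M.m_assoc M.inv_solve_left')
      finally show ?thesis .
    qed
    then have "x \<otimes>\<^bsub>M\<^esub> inv\<^bsub>M\<^esub> y = \<one>\<^bsub>M\<^esub>" by (rule separated)
    then show ?thesis
      using that(1,2) by (metis M.inv_equality M.inv_inv M.inv_closed)
  qed
  define b where "b = restrict b0 (?T (q - 1))"
  have b: "b \<in> carrier (?C (q - 1))"
    unfolding b_def
  proof (rule cochainI)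
    fix g gs assume g: "g \<in> carrier G" and gs: "gs \<in> ?T (q - 1)"
    let ?gs = "map (\<lambda>h. g \<otimes>\<^bsub>G\<^esub> h) gs"
    have gs': "?gs \<in> ?T (q - 1)" by (rule tuples_translate[OF g gs])
    interpret a: group_hom M M "\<phi> g" by (rule act_hom[OF g])
    show "b0 ?gs = \<phi> g (b0 gs)"
    proof (rule unique[of _ _ "\<lambda>k. B k ?gs"])
      fix k
      have "\<phi> g (b0 gs \<otimes>\<^bsub>M\<^esub> inv\<^bsub>M\<^esub> B k gs) \<in> Fil k" using stable g b0(2) gs by blast
      then show "\<phi> g (b0 gs) \<otimes>\<^bsub>M\<^esub> inv\<^bsub>M\<^esub> B k ?gs \<in> Fil k"
        using b0(1) gs cochain_closed[OF B gs] cochain_equivariant[OF B g gs] by simp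
    qed (use b0 gs gs' cochain_closed[OF B] in auto)
  qed (rule b0(1))
  show "\<exists>b\<in>carrier (?C (q - 1)). f = ?d (q - 1) b"
  proof (intro bexI[OF _ b] cochain_eqI[OF f])
    fix gs assume gs: "gs \<in> ?T q"
    show "f gs = ?d (q - 1) b gs"
    proof (rule unique[of _ _ "\<lambda>k. ?d (q - 1) (B k) gs"])
      fix k
      define e where "e = b \<otimes>\<^bsub>?C (q - 1)\<^esub> inv\<^bsub>?C (q - 1)\<^esub> B k"
      have e: "e \<in> carrier (?C (q - 1))" using b B by (simp add: e_def)
      have "e xs \<in> Fil k" if "xs \<in> ?T (q - 1)" for xs
        using b0(2) that B by (simp add: e_def b_def cochain_mult cochain_inv)
      then have "?d (q - 1) e gs \<in> Fil k"
        using coboundary_in_subgroup[OF sub, of "q - 1" e] gs by simp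
      moreover have "?d (q - 1) e = ?d (q - 1) b \<otimes>\<^bsub>?C q\<^esub> inv\<^bsub>?C q\<^esub> ?d (q - 1) (B k)"
        using b B by (simp add: e_def)
      ultimately show "?d (q - 1) b gs \<otimes>\<^bsub>M\<^esub> inv\<^bsub>M\<^esub> ?d (q - 1) (B k) gs \<in> Fil k"
        using gs b B by (simp add: cochain_mult cochain_inv)
    qed (use gs f B b fB dM cochain_closed in auto)
  qed (use b in simp)
qed

end

section \<open>The Galois group\<close>

context finite_galois_extension_of_local_fields
begin

sublocale complete_valued_field vL
  by (intro complete_valued_field.intro top.local_field_axioms)

lemma Gal_iff:
  "\<sigma> \<in> carrier (Gal K) \<longleftrightarrow> (\<forall>x y. \<sigma> (x + y) = \<sigma> x + \<sigma> y) \<and> (\<forall>x y. \<sigma> (x * y) = \<sigma> x * \<sigma> y) \<and> \<sigma> 1 = 1 \<and>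
     bij \<sigma> \<and> (\<forall>x\<in>K. \<sigma> x = x)"
  by (auto simp: Gal_def ring_iso_def ring_hom_def ring_of_type_algebra_def)

lemma Gal_automorphism: "\<sigma> \<in> carrier (Gal K) \<Longrightarrow> valued_field_automorphism vL \<sigma>"
  by unfold_locales (auto simp: Gal_iff)

lemma Gal_fixes: "\<sigma> \<in> carrier (Gal K) \<Longrightarrow> x \<in> K \<Longrightarrow> \<sigma> x = x"
  by (simp add: Gal_iff)

lemma Gal_mult: "\<sigma> \<otimes>\<^bsub>Gal K\<^esub> \<tau> = \<sigma> \<circ> \<tau>" and Gal_one: "\<one>\<^bsub>Gal K\<^esub> = id"
  by (simp_all add: Gal_def)

lemma group_Gal: "group (Gal K)"
proof (rule groupI, unfold Gal_mult Gal_one)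
  fix \<sigma> assume \<sigma>: "\<sigma> \<in> carrier (Gal K)"
  interpret \<sigma>: valued_field_automorphism vL \<sigma> by (rule Gal_automorphism[OF \<sigma>])
  interpret inv: valued_field_automorphism vL "inv_into UNIV \<sigma>" by (rule \<sigma>.inverse_automorphism)
  have "inv_into UNIV \<sigma> x = x" if "x \<in> K" for x
    using \<sigma>.bij Gal_fixes[OF \<sigma> that] by (metis bij_inv_eq_iff)
  then have "inv_into UNIV \<sigma> \<in> carrier (Gal K)"
    using inv.hom_add inv.hom_mult inv.hom_1 inv.bij by (simp add: Gal_iff)
  moreover have "inv_into UNIV \<sigma> \<circ> \<sigma> = id" using \<sigma>.bij by (simp add: bij_is_inj)
  ultimately show "\<exists>\<tau>\<in>carrier (Gal K). \<tau> \<circ> \<sigma> = id" by blast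
qed (auto simp: Gal_iff bij_comp comp_assoc)

text \<open>
  An automorphism is determined by its values on a basis, and each basis vector, being algebraic,
  has finitely many conjugates.
\<close>

lemma finite_Gal: "finite (carrier (Gal K))"
proof -
  let ?R = "ring_of_type_algebra :: 'a ring"
  interpret R: field ?R by (rule field_from_type_algebra)
  have carrier: "carrier ?R = UNIV" by (simp add: ring_of_type_algebra_def)
  have K: "subfield K ?R" by (rule base.subfield)
  obtain d where "R.dimension d K (UNIV :: 'a set)"
    using galois by (auto simp: finite_galois_def R.finite_dimension_def)
  then obtain us where us: "R.Span K us = UNIV"
    using R.exists_base[OF K] by blast
  have hom: "\<sigma> (x \<otimes>\<^bsub>?R\<^esub> y) = \<sigma> x \<otimes>\<^bsub>?R\<^esub> \<sigma> y" "\<sigma> (x \<oplus>\<^bsub>?R\<^esub> y) = \<sigma> x \<oplus>\<^bsub>?R\<^esub> \<sigma> y" 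
    "\<sigma> \<zero>\<^bsub>?R\<^esub> = \<zero>\<^bsub>?R\<^esub>" "\<sigma> (x [^]\<^bsub>?R\<^esub> (m::nat)) = \<sigma> x [^]\<^bsub>?R\<^esub> m" if "\<sigma> \<in> carrier (Gal K)" for \<sigma> x y m
  proof -
    interpret valued_field_automorphism vL \<sigma> by (rule Gal_automorphism[OF that])
    show mult: "\<sigma> (x \<otimes>\<^bsub>?R\<^esub> y) = \<sigma> x \<otimes>\<^bsub>?R\<^esub> \<sigma> y" for x y
      by (simp add: ring_of_type_algebra_def hom_mult)
    show "\<sigma> (x \<oplus>\<^bsub>?R\<^esub> y) = \<sigma> x \<oplus>\<^bsub>?R\<^esub> \<sigma> y" "\<sigma> \<zero>\<^bsub>?R\<^esub> = \<zero>\<^bsub>?R\<^esub>"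
      by (simp_all add: ring_of_type_algebra_def hom_add)
    have one: "\<sigma> \<one>\<^bsub>?R\<^esub> = \<one>\<^bsub>?R\<^esub>" by (simp add: ring_of_type_algebra_def)
    show "\<sigma> (x [^]\<^bsub>?R\<^esub> (m::nat)) = \<sigma> x [^]\<^bsub>?R\<^esub> m"
      by (induction m) (simp_all add: one mult)
  qed
  have eval: "\<sigma> (R.eval p x) = R.eval p (\<sigma> x)" if \<sigma>: "\<sigma> \<in> carrier (Gal K)" and "set p \<subseteq> K" for \<sigma> p x
    using that(2)
  proof (induction p)
    case (Cons a p)
    then show ?case using hom[OF \<sigma>] Gal_fixes[OF \<sigma>] by simp
  qed (simp add: hom(3)[OF \<sigma>])
  have combine: "\<sigma> (R.combine ks xs) = R.combine ks (map \<sigma> xs)" if \<sigma>: "\<sigma> \<in> carrier (Gal K)" and "set ks \<subseteq> K" for \<sigma> ks xs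
    using that(2)
  proof (induction ks xs rule: R.combine.induct)
    case (1 k ks u us)
    then show ?case using hom[OF \<sigma>] Gal_fixes[OF \<sigma>] by simp
  qed (simp_all add: hom(3)[OF \<sigma>])
  have "\<exists>p. p \<in> carrier (univ_poly ?R K) \<and> p \<noteq> [] \<and> R.eval p u = \<zero>\<^bsub>?R\<^esub>" for u
  proof -
    have alg: "(R.algebraic over K) u"
      by (rule R.finite_dimension_imp_algebraic[OF K R.carrier_is_subring]) 
        (use galois in \<open>simp_all add: carrier finite_galois_def\<close>)
    show ?thesis
      by (rule R.algebraicE[OF subfieldE(1)[OF K] _ alg]) (auto simp: carrier)
  qed
  then obtain p where p: "\<And>u. p u \<in> carrier (univ_poly ?R K)" "\<And>u. p u \<noteq> []" "\<And>u. R.eval (p u) u = \<zero>\<^bsub>?R\<^esub>"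
    by metis
  have poly: "polynomial\<^bsub>?R\<^esub> K (p u)" for u
    using p(1)[of u] by (simp add: univ_poly_def)
  have pK: "set (p u) \<subseteq> K" for u
    using poly[of u] p(2)[of u] by (auto simp: polynomial_def)
  have fin: "finite {x. R.is_root (p u) x}" for u
    by (rule R.finite_number_of_roots) (use poly[of u] in \<open>auto simp: univ_poly_def polynomial_def carrier\<close>)
  define A where "A = (\<Union>u\<in>set us. {x. R.is_root (p u) x})"
  have "map \<sigma> us \<in> {xs. set xs \<subseteq> A \<and> length xs = length us}" if \<sigma>: "\<sigma> \<in> carrier (Gal K)" for \<sigma>
  proof -
    have "R.is_root (p u) (\<sigma> u)" for u
      using eval[OF \<sigma> pK[of u], of u] p(2,3)[of u] hom(3)[OF \<sigma>] by (simp add: R.is_root_def carrier)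
    then show ?thesis by (auto simp: A_def)
  qed
  then have "(\<lambda>\<sigma>. map \<sigma> us) ` carrier (Gal K) \<subseteq> {xs. set xs \<subseteq> A \<and> length xs = length us}" by blast
  moreover have "finite A" using fin by (simp add: A_def)
  ultimately have "finite ((\<lambda>\<sigma>. map \<sigma> us) ` carrier (Gal K))"
    using finite_lists_length_eq finite_subset by blast
  moreover have "inj_on (\<lambda>\<sigma>. map \<sigma> us) (carrier (Gal K))"
  proof (rule inj_onI, rule ext)
    fix \<sigma> \<tau> x assume \<sigma>\<tau>: "\<sigma> \<in> carrier (Gal K)" "\<tau> \<in> carrier (Gal K)" "map \<sigma> us = map \<tau> us"
    have "x \<in> R.Span K us" unfolding us by simp
    then have "x \<in> {R.combine ks us |ks. set ks \<subseteq> K}"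
      using R.Span_eq_combine_set[OF K, of us] by (simp only: carrier subset_UNIV)
    then obtain ks where "x = R.combine ks us" "set ks \<subseteq> K" by blast
    then show "\<sigma> x = \<tau> x" using combine[OF \<sigma>\<tau>(1)] combine[OF \<sigma>\<tau>(2)] \<sigma>\<tau>(3) by metis
  qed
  ultimately show ?thesis by (rule finite_imageD)
qed

lemma tame_trace_one:
  assumes "tamely_ramified K vL" and U: "subgroup U (Gal K)"
  shows "\<exists>a\<in>P 0. (\<Sum>\<sigma>\<in>U. \<sigma> a) = 1"
proof -
  interpret Gal: group "Gal K" by (rule group_Gal)
  interpret U: group "Gal K\<lparr>carrier := U\<rparr>" by (rule Gal.subgroup_imp_group[OF U])
  have sub: "\<sigma> \<in> carrier (Gal K)" if "\<sigma> \<in> U" for \<sigma>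
    using subgroup.subset[OF U] that by auto
  have "tame_automorphism_group vL U"
  proof (intro tame_automorphism_group.intro tame_automorphism_group_axioms.intro complete_valued_field_axioms)
    show "finite U" using finite_Gal subgroup.subset[OF U] by (rule rev_finite_subset)
    show "valued_field_automorphism vL \<sigma>" if "\<sigma> \<in> U" for \<sigma> using Gal_automorphism sub that by blast
    show "id \<in> U" using subgroup.one_closed[OF U] by (simp add: Gal_one)
    show "\<sigma> \<circ> \<tau> \<in> U" if "\<sigma> \<in> U" "\<tau> \<in> U" for \<sigma> \<tau>
      using subgroup.m_closed[OF U that] by (simp add: Gal_mult)
    show "\<exists>\<tau>\<in>U. \<tau> \<circ> \<sigma> = id" if "\<sigma> \<in> U" for \<sigma>
      using U.l_inv_ex[of \<sigma>] that by (simp add: Gal_mult Gal_one)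
    show "\<sigma> = id" if "\<sigma> \<in> U" "\<And>x. x \<in> P 0 \<Longrightarrow> \<sigma> x - x \<in> P 2" for \<sigma>
    proof -
      have "\<sigma> \<in> first_ramification_group K vL"
        using sub[OF that(1)] that(2) valued_field_automorphism.hom_0[OF Gal_automorphism[OF sub[OF that(1)]]]
        by (auto simp: first_ramification_group_def valuation_ring_def P_def)
      then show ?thesis using assms(1) by (simp add: tamely_ramified_def Gal_one)
    qed
  qed
  then show ?thesis by (rule tame_automorphism_group.trace_one_exists)
qed

end

section \<open>A contracting homotopy\<close>

text \<open>
  The formula of the Tate coboundary for the additive group of the field, with the values of \<open>f\<close>
  not restricted to a submodule.
\<close>

definition additive_coboundary :: "('a::comm_ring_1 \<Rightarrow> 'a) set \<Rightarrow> int \<Rightarrow> (('a \<Rightarrow> 'a) list \<Rightarrow> 'a) \<Rightarrow> ('a \<Rightarrow> 'a) list \<Rightarrow> 'a" where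
  "additive_coboundary U q f gs =
     (if q \<ge> 0 then \<Sum>i<length gs. (- 1) ^ i * f (take i gs @ drop (Suc i) gs)
      else \<Sum>\<tau>\<in>U. \<Sum>i<tate_arity q. (- 1) ^ i * f (take i (insertion_base q gs) @ \<tau> # drop i (insertion_base q gs)))"

text \<open>
  As complexes of abelian groups both halves of the standard complex have a contraction, which
  prepends an entry in degrees \<open>q > 0\<close> and removes the first entry in degrees \<open>q < 0\<close>. It is not
  equivariant; weighting its translates by the conjugates of \<open>a\<close> and adding them up makes it so.
  In negative degrees, and in degree 0 where the two halves meet, only one translate contributes
  to each value.
\<close>

definition homotopy :: "('a::comm_ring_1 \<Rightarrow> 'a) set \<Rightarrow> 'a \<Rightarrow> int \<Rightarrow> (('a \<Rightarrow> 'a) list \<Rightarrow> 'a) \<Rightarrow> ('a \<Rightarrow> 'a) list \<Rightarrow> 'a" where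
  "homotopy U a q f gs =
     (if q > 0 then \<Sum>\<tau>\<in>U. \<tau> a * f (\<tau> # gs)
      else if q = 0 then hd gs a * f gs
      else hd gs a * f (tl gs))"

text \<open>
  The single term of \<open>homotopy U a (q + 1) (additive_coboundary U q f)\<close>, for \<open>q \<ge> 0\<close>, in which the
  prepended entry is omitted again, respectively, for \<open>q < 0\<close>, the term of the other composite in
  which an entry inserted in front is removed again, yields the trace of \<open>a\<close> times \<open>f gs\<close>. All
  other terms cancel.
\<close>

lemma homotopy_identity:
  assumes trace: "(\<Sum>\<tau>\<in>U. \<tau> a) = 1" and len: "length gs = tate_arity q"
  shows "additive_coboundary U (q - 1) (homotopy U a q f) gs + homotopy U a (q + 1) (additive_coboundary U q f) gs = f gs"
proof -
  have f_gs: "(\<Sum>\<tau>\<in>U. \<tau> a * f gs) = f gs" by (simp add: sum_distrib_right[symmetric] trace)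
  consider "q > 0" | "q = 0" | "q < 0" by linarith
  then show ?thesis
  proof cases
    case 1
    have "homotopy U a (q + 1) (additive_coboundary U q f) gs
      = (\<Sum>\<tau>\<in>U. \<tau> a * f gs - (\<Sum>i<length gs. (- 1) ^ i * (\<tau> a * f (\<tau> # take i gs @ drop (Suc i) gs))))"
      using 1 by (simp add: homotopy_def additive_coboundary_def sum.lessThan_Suc_shift sum_negf
          right_diff_distrib sum_distrib_left mult_ac del: sum.lessThan_Suc)
    moreover have "additive_coboundary U (q - 1) (homotopy U a q f) gs
      = (\<Sum>\<tau>\<in>U. \<Sum>i<length gs. (- 1) ^ i * (\<tau> a * f (\<tau> # take i gs @ drop (Suc i) gs)))"
      using 1 by (simp add: homotopy_def additive_coboundary_def sum_distrib_left sum.swap[of _ U])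
    ultimately show ?thesis by (simp add: sum_subtractf f_gs)
  next
    case 2
    then obtain g where gs: "gs = [g]" using len by (auto simp: tate_arity_def length_Suc_conv)
    have "homotopy U a (q + 1) (additive_coboundary U q f) gs = (\<Sum>\<tau>\<in>U. \<tau> a * f gs - \<tau> a * f [\<tau>])"
      using 2 by (simp add: gs homotopy_def additive_coboundary_def numeral_2_eq_2 algebra_simps)
    moreover have "additive_coboundary U (q - 1) (homotopy U a q f) gs = (\<Sum>\<tau>\<in>U. \<tau> a * f [\<tau>])"
      using 2 by (simp add: homotopy_def additive_coboundary_def insertion_base_def tate_arity_def)
    ultimately show ?thesis by (simp add: sum_subtractf f_gs)
  next
    case 3
    then obtain g gs' where gs: "gs = g # gs'" using len by (cases gs) (auto simp: tate_arity_def)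
    have base: "insertion_base q (tl gs) = gs'" "insertion_base (q - 1) gs = gs"
      using 3 len gs by (auto simp: insertion_base_def tate_arity_def)
    have arity: "tate_arity (q - 1) = Suc (tate_arity q)" using 3 by (simp add: tate_arity_def)
    have base1: "additive_coboundary U q f gs = additive_coboundary U q f (tl gs)" if "q = - 1"
      using that by (simp add: additive_coboundary_def insertion_base_def)
    have "homotopy U a (q + 1) (additive_coboundary U q f) gs = g a * additive_coboundary U q f (tl gs)"
      using 3 base1 by (cases "q = - 1") (simp_all add: homotopy_def gs)
    also have "\<dots> = (\<Sum>\<tau>\<in>U. \<Sum>i<tate_arity q. (- 1) ^ i * (g a * f (take i gs' @ \<tau> # drop i gs')))"
      using 3 base(1) by (simp add: additive_coboundary_def sum_distrib_left mult_ac)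
    moreover have "additive_coboundary U (q - 1) (homotopy U a q f) gs
      = (\<Sum>\<tau>\<in>U. \<tau> a * f gs - (\<Sum>i<tate_arity q. (- 1) ^ i * (g a * f (take i gs' @ \<tau> # drop i gs'))))"
      using 3 base(2) by (simp add: additive_coboundary_def homotopy_def arity gs sum.lessThan_Suc_shift sum_negf
          del: sum.lessThan_Suc)
    ultimately show ?thesis by (simp add: sum_subtractf f_gs)
  qed
qed

section \<open>Cohomological triviality\<close>

locale tame_formal_group = finite_galois_extension_of_local_fields +
  fixes F :: "'a fps fps" and n :: nat
  assumes law_K: "formal_group_law (valuation_ring K vK) F"
    and tame_K: "tamely_ramified K vL"
    and level: "n \<ge> 1"
begin

lemma valuation_ring_subset: "valuation_ring K vK \<subseteq> P 0"
  using valuation_extends by (fastforce simp: valuation_ring_def P_def)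

lemma formal_group_law_P: "formal_group_law (P 0) F"
  using law_K valuation_ring_subset by (auto simp: formal_group_law_def)

sublocale formal_group_level vL F n
  using formal_group_law_P level by unfold_locales

lemma Gal_P: "\<sigma> \<in> carrier (Gal K) \<Longrightarrow> \<sigma> x \<in> P N \<longleftrightarrow> x \<in> P N"
  by (rule valued_field_automorphism.P_invariant[OF Gal_automorphism])

lemma Gal_fadd:
  assumes \<sigma>: "\<sigma> \<in> carrier (Gal K)" and xy: "x \<in> P 1" "y \<in> P 1"
  shows "\<sigma> (fadd x y) = fadd (\<sigma> x) (\<sigma> y)"
proof -
  interpret \<sigma>: valued_field_automorphism vL \<sigma> by (rule Gal_automorphism[OF \<sigma>])
  have fixed: "\<sigma> (F $ i $ j) = F $ i $ j" for i j
    using law_K Gal_fixes[OF \<sigma>] by (auto simp: formal_group_law_def valuation_ring_def)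
  have "\<sigma> (partial_sum m x y) = partial_sum m (\<sigma> x) (\<sigma> y)" for m
    by (simp add: partial_sum_def \<sigma>.hom_sum case_prod_unfold \<sigma>.hom_mult \<sigma>.hom_power fixed)
  then have 1: "partial_sum m (\<sigma> x) (\<sigma> y) - \<sigma> (fadd x y) \<in> P (int m + 1)" for m
    using \<sigma>.P_invariant[of "partial_sum m x y - fadd x y"] partial_sum_approx[OF xy, of m] by (simp add: \<sigma>.hom_diff)
  have 2: "partial_sum m (\<sigma> x) (\<sigma> y) - fadd (\<sigma> x) (\<sigma> y) \<in> P (int m + 1)" for m
    using partial_sum_approx[of "\<sigma> x" "\<sigma> y" m] xy \<sigma>.P_invariant by simp
  have "\<sigma> (fadd x y) - fadd (\<sigma> x) (\<sigma> y) \<in> P (1 + int m)" for m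
    using P_diff_trans[OF P_diff_commute[OF 1] 2] by (simp add: add.commute)
  then show ?thesis using P_Inter[of "\<sigma> (fadd x y) - fadd (\<sigma> x) (\<sigma> y)" 1] by simp
qed

lemma action_eq: "x \<in> P (int n) \<Longrightarrow> galois_action vL n \<sigma> x = \<sigma> x"
  using carrier_M by (simp add: galois_action_def formal_group_points_def)

lemma finite_G_module_points:
  assumes U: "subgroup U (Gal K)"
  shows "finite_G_module (Gal K\<lparr>carrier := U\<rparr>) M (galois_action vL n)"
proof -
  let ?G = "Gal K\<lparr>carrier := U\<rparr>" and ?\<phi> = "galois_action vL n"
  interpret Gal: group "Gal K" by (rule group_Gal)
  interpret U: group ?G by (rule Gal.subgroup_imp_group[OF U])
  have sub: "\<sigma> \<in> carrier (Gal K)" if "\<sigma> \<in> U" for \<sigma>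
    using subgroup.subset[OF U] that by auto
  have Pn: "maximal_ideal_power UNIV vL n = P (int n)"
    using carrier_M by (simp add: formal_group_points_def)
  have Bij: "?\<phi> \<sigma> \<in> Bij (P (int n))" if \<sigma>: "\<sigma> \<in> U" for \<sigma>
  proof -
    have b: "bij \<sigma>" using sub[OF \<sigma>] by (simp add: Gal_iff)
    have "\<sigma> ` P (int n) = P (int n)"
    proof (intro equalityI subsetI)
      fix y assume "y \<in> P (int n)"
      moreover obtain x where "y = \<sigma> x" using b by (metis bij_pointE)
      ultimately show "y \<in> \<sigma> ` P (int n)" using Gal_P[OF sub[OF \<sigma>]] by auto
    qed (use Gal_P[OF sub[OF \<sigma>]] in auto)
    then have "bij_betw \<sigma> (P (int n)) (P (int n))"
      using bij_is_inj[OF b] by (auto simp: bij_betw_def intro: inj_on_subset)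
    then have "bij_betw (?\<phi> \<sigma>) (P (int n)) (P (int n))"
      by (rule bij_betw_cong[THEN iffD1, rotated]) (simp add: action_eq)
    then show ?thesis by (simp add: Bij_def galois_action_def Pn)
  qed
  have "?\<phi> (\<sigma> \<circ> \<tau>) = compose (P (int n)) (?\<phi> \<sigma>) (?\<phi> \<tau>)" if "\<sigma> \<in> U" "\<tau> \<in> U" for \<sigma> \<tau>
    using Gal_P[OF sub[OF that(2)]] by (auto simp: galois_action_def Pn compose_def)
  then have "group_hom ?G (BijGroup (P (int n))) ?\<phi>"
    using Bij by (intro group_hom.intro group_hom_axioms.intro homI group_BijGroup U.is_group)
      (auto simp: BijGroup_def Gal_mult)
  then have action: "group_action ?G (carrier M) ?\<phi>"
    by (simp add: group_action_def carrier_M)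
  have "?\<phi> \<sigma> \<in> hom M M" if \<sigma>: "\<sigma> \<in> U" for \<sigma>
  proof (rule homI)
    fix x y assume xy: "x \<in> carrier M" "y \<in> carrier M"
    show "?\<phi> \<sigma> x \<in> carrier M" using xy(1) Gal_P[OF sub[OF \<sigma>]] by (simp add: carrier_M action_eq)
    have "x \<otimes>\<^bsub>M\<^esub> y \<in> P (int n)" using M.m_closed[OF xy] by (simp only: carrier_M)
    moreover have "x \<in> P 1" "y \<in> P 1" using xy P1[of _ "int n"] by (auto simp: carrier_M)
    ultimately show "?\<phi> \<sigma> (x \<otimes>\<^bsub>M\<^esub> y) = ?\<phi> \<sigma> x \<otimes>\<^bsub>M\<^esub> ?\<phi> \<sigma> y"
      using Gal_fadd[OF sub[OF \<sigma>]] xy by (simp add: carrier_M action_eq mult_M)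
  qed
  moreover have "finite U" using finite_Gal subgroup.subset[OF U] by (rule rev_finite_subset)
  ultimately show ?thesis
    using action by (intro finite_G_module.intro finite_G_module_axioms.intro G_module.intro U.is_group M.comm_group_axioms) auto
qed

lemma additive_coboundary_cong:
  assumes "gs \<in> tate_tuples (Gal K\<lparr>carrier := U\<rparr>) (q + 1)"
    and "\<And>gs. gs \<in> tate_tuples (Gal K\<lparr>carrier := U\<rparr>) q \<Longrightarrow> f gs = f' gs"
    and mod: "finite_G_module (Gal K\<lparr>carrier := U\<rparr>) M (galois_action vL n)"
  shows "additive_coboundary U q f gs = additive_coboundary U q f' gs"
proof -
  interpret T: finite_G_module "Gal K\<lparr>carrier := U\<rparr>" M "galois_action vL n" by (rule mod)
  show ?thesis
    using assms(1,2) T.omission_in_tuples[of q gs] T.insertion_in_tuples[of q gs]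
    by (auto simp: additive_coboundary_def intro!: sum.cong)
qed

text \<open>
  On \<open>P k\<close> sums and inverses of the formal group agree with those of the field modulo \<open>P (k + 1)\<close>,
  and a coboundary is made up of sums and inverses.
\<close>

lemma coboundary_approx:
  assumes mod: "finite_G_module (Gal K\<lparr>carrier := U\<rparr>) M (galois_action vL n)"
    and gs: "gs \<in> tate_tuples (Gal K\<lparr>carrier := U\<rparr>) (q + 1)"
    and f: "\<And>gs. gs \<in> tate_tuples (Gal K\<lparr>carrier := U\<rparr>) q \<Longrightarrow> f gs \<in> P k" and k: "k \<ge> int n"
  shows "tate_coboundary (Gal K\<lparr>carrier := U\<rparr>) M q f gs - additive_coboundary U q f gs \<in> P (k + 1)"
proof -
  interpret T: finite_G_module "Gal K\<lparr>carrier := U\<rparr>" M "galois_action vL n" by (rule mod)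
  show ?thesis
  proof (cases "q \<ge> 0")
    case True
    then have "additive_coboundary U q f gs = (\<Sum>i<length gs. (- 1) ^ i * f (take i gs @ drop (Suc i) gs))"
      by (simp add: additive_coboundary_def)
    then show ?thesis
      unfolding T.coboundary_nonneg[OF True gs]
      using T.omission_in_tuples[OF True gs] f k sign_approx[OF _ k]
      by (auto intro!: finprod_approx_cong)
  next
    case False
    then have q: "q < 0" by simp
    note tup = T.insertion_in_tuples[OF q gs]
    have fM: "f \<in> tate_tuples (Gal K\<lparr>carrier := U\<rparr>) q \<rightarrow> carrier M"
      using f level_carrier k by blast
    let ?b = "insertion_base q gs"
    have 1: "finprod M (\<lambda>i. f (take i ?b @ \<tau> # drop i ?b) [^]\<^bsub>M\<^esub> ((- 1) ^ i :: int)) {..<tate_arity q}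
        - (\<Sum>i<tate_arity q. (- 1) ^ i * f (take i ?b @ \<tau> # drop i ?b)) \<in> P (k + 1)"
      "finprod M (\<lambda>i. f (take i ?b @ \<tau> # drop i ?b) [^]\<^bsub>M\<^esub> ((- 1) ^ i :: int)) {..<tate_arity q} \<in> P k"
      if "\<tau> \<in> U" for \<tau>
      using tup[of \<tau>] that f k sign_approx[OF _ k]
      by (auto intro!: finprod_approx_cong finprod_approx(2))
    show ?thesis
      using q 1 k by (simp add: T.coboundary_neg[OF q gs fM] additive_coboundary_def finprod_approx_cong)
  qed
qed

lemma homotopy_level:
  assumes U: "subgroup U (Gal K)" and a: "a \<in> P 0"
    and gs: "gs \<in> tate_tuples (Gal K\<lparr>carrier := U\<rparr>) (q - 1)"
    and f: "\<And>gs. gs \<in> tate_tuples (Gal K\<lparr>carrier := U\<rparr>) q \<Longrightarrow> f gs \<in> P k"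
  shows "homotopy U a q f gs \<in> P k"
proof -
  have \<sigma>a: "\<sigma> a \<in> P 0" if "\<sigma> \<in> U" for \<sigma>
    using that subgroup.subset[OF U] Gal_P a by auto
  consider "q > 0" | "q = 0" | "q < 0" by linarith
  then show ?thesis
  proof cases
    case 1
    then have "\<tau> # gs \<in> tate_tuples (Gal K\<lparr>carrier := U\<rparr>) q" if "\<tau> \<in> U" for \<tau>
      using gs that by (auto simp: tate_tuples_def tate_arity_def)
    then show ?thesis using 1 \<sigma>a f by (auto simp: homotopy_def intro!: P_sum P_mult0(1))
  next
    case 2
    then have "gs \<in> tate_tuples (Gal K\<lparr>carrier := U\<rparr>) q" "hd gs \<in> U"
      using gs by (cases gs; auto simp: tate_tuples_def tate_arity_def)+
    then show ?thesis using 2 \<sigma>a f by (auto simp: homotopy_def intro!: P_mult0(1))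
  next
    case 3
    then have "tl gs \<in> tate_tuples (Gal K\<lparr>carrier := U\<rparr>) q" "hd gs \<in> U"
      using gs by (cases gs; auto simp: tate_tuples_def tate_arity_def)+
    then show ?thesis using 3 \<sigma>a f by (auto simp: homotopy_def intro!: P_mult0(1))
  qed
qed

text \<open>Equivariance: translating the arguments by \<open>g\<close> permutes the summation variable \<open>\<tau>\<close> by \<open>\<tau> \<mapsto> g \<circ> \<tau>\<close>.\<close>

lemma homotopy_cochain:
  assumes U: "subgroup U (Gal K)" and a: "a \<in> P 0"
    and f: "f \<in> carrier (tate_cochains (Gal K\<lparr>carrier := U\<rparr>) M (galois_action vL n) q)"
  shows "restrict (homotopy U a q f) (tate_tuples (Gal K\<lparr>carrier := U\<rparr>) (q - 1))
    \<in> carrier (tate_cochains (Gal K\<lparr>carrier := U\<rparr>) M (galois_action vL n) (q - 1))"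
proof -
  let ?T = "tate_tuples (Gal K\<lparr>carrier := U\<rparr>)"
  interpret T: finite_G_module "Gal K\<lparr>carrier := U\<rparr>" M "galois_action vL n"
    by (rule finite_G_module_points[OF U])
  have fP: "f gs \<in> P (int n)" if "gs \<in> ?T q" for gs
    using T.cochain_closed[OF f that] by (simp add: carrier_M)
  have level: "homotopy U a q f gs \<in> P (int n)" if "gs \<in> ?T (q - 1)" for gs
    using homotopy_level[OF U a that fP] .
  show ?thesis
  proof (rule T.cochainI)
    fix gs assume "gs \<in> ?T (q - 1)"
    then show "homotopy U a q f gs \<in> carrier M" using level by (simp add: carrier_M)
  next
    fix g gs assume "g \<in> carrier (Gal K\<lparr>carrier := U\<rparr>)" and gs: "gs \<in> ?T (q - 1)"
    then have g: "g \<in> U" by simp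
    then have "g \<in> carrier (Gal K)" using subgroup.subset[OF U] by auto
    then interpret g: valued_field_automorphism vL g by (rule Gal_automorphism)
    have eq: "f (map (\<lambda>h. g \<circ> h) xs) = g (f xs)" if "xs \<in> ?T q" for xs
      using T.cochain_equivariant[OF f, of g xs] g that fP[OF that] by (simp add: Gal_mult action_eq)
    have "homotopy U a q f (map (\<lambda>h. g \<circ> h) gs) = g (homotopy U a q f gs)"
    proof -
      consider "q > 0" | "q = 0" | "q < 0" by linarith
      then show ?thesis
      proof cases
        case 1
        have tup: "\<tau> # gs \<in> ?T q" if "\<tau> \<in> U" for \<tau>
          using 1 gs that by (auto simp: tate_tuples_def tate_arity_def)
        have "inj_on (\<lambda>\<tau>. g \<circ> \<tau>) U" "(\<lambda>\<tau>. g \<circ> \<tau>) ` U = U"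
          using T.G.inj_on_multc T.G.surj_const_mult[of g] T.G.inj_on_cmult[of g] g by (simp_all add: Gal_mult)
        then have "(\<Sum>\<tau>\<in>U. \<tau> a * f (\<tau> # map (\<lambda>h. g \<circ> h) gs)) = (\<Sum>\<tau>\<in>U. (g \<circ> \<tau>) a * f ((g \<circ> \<tau>) # map (\<lambda>h. g \<circ> h) gs))"
          by (metis (mono_tags, lifting) sum.reindex_cong)
        also have "\<dots> = (\<Sum>\<tau>\<in>U. g (\<tau> a * f (\<tau> # gs)))"
          using eq[OF tup] by (intro sum.cong) (simp_all add: g.hom_mult)
        finally show ?thesis using 1 by (simp add: homotopy_def g.hom_sum)
      next
        case 2
        then have "gs \<in> ?T q" "gs \<noteq> []" using gs by (auto simp: tate_tuples_def tate_arity_def)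
        then show ?thesis using 2 eq[of gs] by (simp add: homotopy_def g.hom_mult hd_map)
      next
        case 3
        then have "tl gs \<in> ?T q" "gs \<noteq> []"
          using gs by (cases gs; auto simp: tate_tuples_def tate_arity_def)+
        then show ?thesis using 3 eq[of "tl gs"] by (simp add: homotopy_def g.hom_mult hd_map map_tl)
      qed
    qed
    then show "homotopy U a q f (map (\<lambda>h. g \<otimes>\<^bsub>Gal K\<lparr>carrier := U\<rparr>\<^esub> h) gs) = galois_action vL n g (homotopy U a q f gs)"
      using level[OF gs] by (simp add: Gal_mult action_eq)
  qed
qed

text \<open>
  The homotopy inverts the coboundary of a cocycle up to the next level: \<open>additive_coboundary U q
  f\<close> need not vanish for a cocycle of the formal group, but it takes values one level higher than
  \<open>f\<close>.
\<close>

lemma trivial_cohomology_points: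
  assumes U: "subgroup U (Gal K)"
  shows "trivial_group (tate_cohomology (Gal K\<lparr>carrier := U\<rparr>) M (galois_action vL n) q)"
proof -
  let ?G = "Gal K\<lparr>carrier := U\<rparr>" and ?\<phi> = "galois_action vL n"
  let ?T = "tate_tuples ?G"
  obtain a where a: "a \<in> P 0" "(\<Sum>\<sigma>\<in>U. \<sigma> a) = 1"
    using tame_trace_one[OF tame_K U] by blast
  note mod = finite_G_module_points[OF U]
  interpret T: finite_G_module ?G M ?\<phi> by (rule mod)
  show ?thesis
  proof (rule T.trivial_cohomology_by_approximation[of "\<lambda>k. P (int n + int k)"])
    show "subgroup (P (int n + int k)) M" for k by (rule subgroup_level) simp
    show "P (int n + int 0) = carrier M" by (simp add: carrier_M)
    show "?\<phi> g x \<in> P (int n + int k)" if "g \<in> carrier ?G" "x \<in> P (int n + int k)" for g k x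
    proof -
      have "g \<in> carrier (Gal K)" using that(1) subgroup.subset[OF U] by auto
      moreover have "x \<in> P (int n)" by (rule P_mono[OF that(2)]) simp
      ultimately show ?thesis using that(2) Gal_P by (simp add: action_eq)
    qed
    show "x = \<one>\<^bsub>M\<^esub>" if "\<And>k. x \<in> P (int n + int k)" for x
      using P_Inter[of x "int n"] that by (simp add: one_M)
    show "\<exists>x\<in>carrier M. \<forall>k. x \<otimes>\<^bsub>M\<^esub> inv\<^bsub>M\<^esub> s k \<in> P (int n + int k)"
      if s: "\<And>k. s k \<in> carrier M" "\<And>k. s (Suc k) \<otimes>\<^bsub>M\<^esub> inv\<^bsub>M\<^esub> s k \<in> P (int n + int k)" for s
    proof -
      have "s (Suc k) - s k \<in> P (int n + int k)" for k
        using s difference_level[of "s (Suc k)" "s k" "int n + int k"] by simp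
      then obtain l where l: "\<And>k. s k - l \<in> P (int n + int k)" using limit_exists by blast
      have "l \<in> P (int n)" using P_diff[of "s 0" "int n" "s 0 - l"] s(1)[of 0] l[of 0] by (simp add: carrier_M)
      then have lM: "l \<in> carrier M" by (simp add: carrier_M)
      have "l \<otimes>\<^bsub>M\<^esub> inv\<^bsub>M\<^esub> s k \<in> P (int n + int k)" for k
        using difference_level[OF lM s(1)[of k], of "int n + int k"] P_diff_commute[OF l[of k]] by simp
      then show ?thesis using lM by blast
    qed
  next
    fix k f
    assume f: "f \<in> carrier (tate_cochains ?G M ?\<phi> q)"
      and cocycle: "tate_coboundary ?G M q f = \<one>\<^bsub>tate_cochains ?G M ?\<phi> (q + 1)\<^esub>"
      and fP: "\<And>gs. gs \<in> ?T q \<Longrightarrow> f gs \<in> P (int n + int k)"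
    let ?k = "int n + int k"
    define b where "b = restrict (homotopy U a q f) (?T (q - 1))"
    have b: "b \<in> carrier (tate_cochains ?G M ?\<phi> (q - 1))"
      unfolding b_def by (rule homotopy_cochain[OF U a(1) f])
    have bP: "b gs \<in> P ?k" if "gs \<in> ?T (q - 1)" for gs
      using homotopy_level[OF U a(1) that fP] that by (simp add: b_def)
    have "f gs \<otimes>\<^bsub>M\<^esub> inv\<^bsub>M\<^esub> tate_coboundary ?G M (q - 1) b gs \<in> P (int n + int (Suc k))" if gs: "gs \<in> ?T q" for gs
    proof -
      have gs': "gs \<in> ?T (q - 1 + 1)" using gs by simp
      have "additive_coboundary U q f xs \<in> P (?k + 1)" if xs: "xs \<in> ?T (q + 1)" for xs
      proof -
        have "tate_coboundary ?G M q f xs = 0" using cocycle xs T.cochain_one[OF xs] by (simp add: one_M)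
        moreover have "tate_coboundary ?G M q f xs - additive_coboundary U q f xs \<in> P (?k + 1)"
          by (rule coboundary_approx[OF mod xs fP]) simp_all
        ultimately show ?thesis by simp
      qed
      then have 1: "homotopy U a (q + 1) (additive_coboundary U q f) gs \<in> P (?k + 1)"
        using homotopy_level[OF U a(1), of gs "q + 1"] gs by simp
      have 2: "tate_coboundary ?G M (q - 1) b gs - additive_coboundary U (q - 1) b gs \<in> P (?k + 1)"
        by (rule coboundary_approx[OF mod gs' bP]) simp_all
      have 3: "additive_coboundary U (q - 1) b gs = additive_coboundary U (q - 1) (homotopy U a q f) gs"
        by (rule additive_coboundary_cong[OF gs' _ mod]) (simp add: b_def)
      have "additive_coboundary U (q - 1) (homotopy U a q f) gs + homotopy U a (q + 1) (additive_coboundary U q f) gs = f gs"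
        using gs by (intro homotopy_identity a(2)) (simp add: tate_tuples_def)
      then have "f gs - tate_coboundary ?G M (q - 1) b gs
        = homotopy U a (q + 1) (additive_coboundary U q f) gs
          - (tate_coboundary ?G M (q - 1) b gs - additive_coboundary U (q - 1) b gs)"
        by (simp add: 3 algebra_simps)
      also have "\<dots> \<in> P (?k + 1)" by (rule P_diff[OF 1 2])
      finally show ?thesis
        using difference_level[OF T.cochain_closed[OF f gs] T.coboundary_closed[OF b gs'], of "?k + 1"]
        by (simp add: add_ac)
    qed
    then show "\<exists>b\<in>carrier (tate_cochains ?G M ?\<phi> (q - 1)). (\<forall>gs\<in>?T (q - 1). b gs \<in> P (int n + int k)) \<and>
        (\<forall>gs\<in>?T q. f gs \<otimes>\<^bsub>M\<^esub> inv\<^bsub>M\<^esub> tate_coboundary ?G M (q - 1) b gs \<in> P (int n + int (Suc k)))"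
      using b bP by blast
  qed
qed

end

theorem proposition3p12:
  fixes K :: "'l::field_char_0 set"
    and vK vL :: "'l \<Rightarrow> int"
    and F :: "'l fps fps"
    and n :: nat
  assumes "finite_galois_extension_of_local_fields K vK vL"
    and "formal_group_law (valuation_ring K vK) F"
    and "tamely_ramified K vL"
    and "n \<ge> 1"
  shows "cohomologically_trivial_module
           (Gal K) (formal_group_points F vL n) (galois_action vL n)"
proof -
  interpret tame_formal_group K vK vL F n
    using assms by (intro tame_formal_group.intro tame_formal_group_axioms.intro)
  interpret Gal: group "Gal K" by (rule group_Gal)
  have "Gal K\<lparr>carrier := carrier (Gal K)\<rparr> = Gal K" by simp
  then interpret T: finite_G_module "Gal K" M "galois_action vL n"
    using finite_G_module_points[OF Gal.subgroup_self] by simp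
  show ?thesis
    by (intro cohomologically_trivial_module.intro cohomologically_trivial_module_axioms.intro
        T.G_module_axioms finite_Gal trivial_cohomology_points)
qed

end
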